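(* Fix $\varepsilon>0$. Let $K$ be a complete graph on $N$ vertices with a proper edge-coloring in which every color appears on $(1+o(1))N/2$ edges (with $o(1)\to0$ as $N\to\infty$, uniformly over colors). Put $k=(2-\varepsilon)\log_2 N$. Let $R$ be a random subset of the set of colors obtained by including each color independently with probability $1/2$. Then with probability tending to $1$ as $N\to\infty$ there is a collection $\mathcal{C}$ of at most $N\log\log N/\log^2 N$ available cliques such that $R=\bigcup_{A\in\mathcal{C}}C(A)$.
   Context: A proper edge-coloring assigns colors to edges so that edges sharing a vertex get distinct colors. A rainbow clique is a set $A$ of $k$ vertices of $K$ all of whose $\binom{k}{2}$ edges have distinct colors. A rainbow clique $A$ is available if all colors of its edges belong to $R$, and then $C(A)$ denotes the set of these colors. In addition, every single edge $e$ whose color lies in $R$ is also called an available clique, with $C(e)$ the set consisting of its color.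
   Formalization: The formal theorem assumes 0 < ε < 2: for ε ≥ 2 one has k ≤ 0, only single edges contribute colors, about N/2 of them are needed, and the claim fails; k is rounded down to an integer. *)

theory Defs
  imports "HOL-Probability.Probability" "HOL-Library.Ramsey"
begin

text \<open>The edges of the complete graph on \<open>V\<close> are the two-element sets \<^term>\<open>nsets V 2\<close>.\<close>

definition proper_edge_coloring :: "'v set \<Rightarrow> ('v set \<Rightarrow> 'c) \<Rightarrow> bool" where
  "proper_edge_coloring V col \<longleftrightarrow>
     (\<forall>e\<in>nsets V 2. \<forall>f\<in>nsets V 2. e \<noteq> f \<and> e \<inter> f \<noteq> {} \<longrightarrow> col e \<noteq> col f)"

text \<open>
  For a vertex set \<open>A\<close> this is the set \<open>C(A)\<close> of colors on its edges. It also covers a single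
  edge \<open>e\<close>, viewed as a two-element vertex set, where it equals \<open>{col e}\<close>.
  With \<open>A\<close> the whole vertex set it is the set of all colors.
\<close>
definition clique_colors :: "('v set \<Rightarrow> 'c) \<Rightarrow> 'v set \<Rightarrow> 'c set" where
  "clique_colors col A = col ` nsets A 2"

definition rainbow_clique :: "'v set \<Rightarrow> ('v set \<Rightarrow> 'c) \<Rightarrow> nat \<Rightarrow> 'v set \<Rightarrow> bool" where
  "rainbow_clique V col k A \<longleftrightarrow> A \<in> nsets V k \<and> inj_on col (nsets A 2)"

definition available_clique ::
  "'v set \<Rightarrow> ('v set \<Rightarrow> 'c) \<Rightarrow> nat \<Rightarrow> 'c set \<Rightarrow> 'v set \<Rightarrow> bool" where
  "available_clique V col k R A \<longleftrightarrow>
     (rainbow_clique V col k A \<and> clique_colors col A \<subseteq> R) \<or> (A \<in> nsets V 2 \<and> col A \<in> R)"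

definition random_color_set :: "'c set \<Rightarrow> 'c set pmf" where
  "random_color_set S = map_pmf (\<lambda>b. {c\<in>S. b c}) (Pi_pmf S False (\<lambda>_. bernoulli_pmf (1/2)))"

text \<open>The real number \<open>(2 - \<epsilon>) log\<^sub>2 N\<close> is rounded down to obtain a clique size.\<close>
definition clique_size :: "real \<Rightarrow> nat \<Rightarrow> nat" where
  "clique_size \<epsilon> N = nat \<lfloor>(2 - \<epsilon>) * log 2 (real N)\<rfloor>"

end

(*
  R is uniformly distributed among all sets of colors. Call an edge with color in R an R-edge.

  Extension. Fix a rainbow R-clique S with at most a small multiple of log N vertices. Janson's
  inequality bounds the probability that S lies in no available k-clique by exp (- N^c). The
  correlation term is controlled by counting pairs of k-cliques according to the rank of the graph
  of edges of one clique whose colors occur in the other: rank r forces at most r k / 2 common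
  colors and costs a factor (polylog N / N)^r, which wins because k / 2 < (1 - epsilon / 2) log_2 N.
  A union bound shows that with high probability all such S extend simultaneously.

  Seeds. With high probability the graph of R-edges is quasirandom on all vertex sets of size
  N^(19/20). Then for every set U of R-colors with density p, a greedy choice yields an R-clique
  on Q and T, with |Q| about log N / log (1/p), |T| about log N, and all edges between Q and T
  colored from U. Extending it gives an available k-clique with order of log^2 N / log (1/p)
  colors of U, which is far more than the average p k^2 when p is small.

  Covering greedily, first down to density 1 / loglog N, then down to 1 / log^2 N, and using single
  edges for what is left, takes o (N loglog N / log^2 N) cliques.
*)
theory Submission
  imports Defs "HOL-Real_Asymp.Real_Asymp"
begin

section \<open>Janson's inequality\<close>

text \<open>The uncovered set U depends on R and on earlier choices, so it cannot be treated as
  fixed in a probability estimate. Randomness therefore enters only through properties of R that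
  speak of all sets at once: regular degrees into every large vertex set, and extendability of every
  small clique. The rest is deterministic. Regularity for all vertex sets comes from a single
  expectation, that of a signed count of closed 4-walks. Extendability must fail with probability
  far below N^(-s) for s of order log N. The pair sum in Janson's exponent may exceed the expected
  number of extensions, so the family of extensions is thinned; the bound then depends only on the
  pair sum relative to the squared expectation, here at most N^(-\<epsilon>/4). The stop at density
  1 / loglog N is due to the constant 1 in the claim: going straight to 1 / log^2 N, where Q has
  order log N / loglog N vertices, costs a large constant times N loglog N / log^2 N. Down to 1 /
  loglog N, Q can have order log N / logloglog N vertices, and only N / loglog N colors remain for
  the expensive round.\<close>

lemma sum_Pow_insert:
  fixes f :: "'a set \<Rightarrow> real"
  assumes "finite S" "x \<notin> S"
  shows "(\<Sum>R\<in>Pow (insert x S). f R) = (\<Sum>R\<in>Pow S. f R) + (\<Sum>R\<in>Pow S. f (insert x R))"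
proof -
  have "Pow S \<inter> insert x ` Pow S = {}"
    using assms(2) by auto
  moreover have "inj_on (insert x) (Pow S)"
    using assms(2) by (intro inj_onI) (metis PowD insert_ident subsetD)
  ultimately show ?thesis
    using assms(1) by (simp add: Pow_insert sum.union_disjoint sum.reindex)
qed

text \<open>Harris' correlation inequality. Splitting on membership of one element, each half obeys
  it by induction, and the two conditional averages move in opposite directions for \<open>f\<close>
  and \<open>g\<close>.\<close>

lemma harris:
  fixes f g :: "'a set \<Rightarrow> real"
  assumes "finite S"
    and "\<And>A B. A \<subseteq> B \<Longrightarrow> B \<subseteq> S \<Longrightarrow> f A \<le> f B"
    and "\<And>A B. A \<subseteq> B \<Longrightarrow> B \<subseteq> S \<Longrightarrow> g B \<le> g A"
  shows "2 ^ card S * (\<Sum>R\<in>Pow S. f R * g R) \<le> (\<Sum>R\<in>Pow S. f R) * (\<Sum>R\<in>Pow S. g R)"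
  using assms
proof (induction S arbitrary: f g rule: finite_induct)
  case empty
  then show ?case by simp
next
  case (insert x S)
  define F0 F1 G0 G1 where "F0 = (\<Sum>R\<in>Pow S. f R)" and "F1 = (\<Sum>R\<in>Pow S. f (insert x R))"
    and "G0 = (\<Sum>R\<in>Pow S. g R)" and "G1 = (\<Sum>R\<in>Pow S. g (insert x R))"
  have 1: "2 ^ card S * (\<Sum>R\<in>Pow S. f R * g R) \<le> F0 * G0"
    unfolding F0_def G0_def by (rule insert.IH) (auto intro!: insert.prems)
  have 2: "2 ^ card S * (\<Sum>R\<in>Pow S. f (insert x R) * g (insert x R)) \<le> F1 * G1"
    unfolding F1_def G1_def
    by (rule insert.IH[of "\<lambda>R. f (insert x R)" "\<lambda>R. g (insert x R)"])
      (auto intro!: insert.prems)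
  have "F0 \<le> F1" "G1 \<le> G0"
    unfolding F0_def F1_def G0_def G1_def by (auto intro!: sum_mono insert.prems)
  \<comment> \<open>Chebyshev's sum inequality for two points.\<close>
  then have "0 \<le> (F1 - F0) * (G0 - G1)"
    by simp
  then have "2 * (F0 * G0 + F1 * G1) \<le> (F0 + F1) * (G0 + G1)"
    by (simp add: algebra_simps)
  then show ?case
    using 1 2 insert.hyps
    by (simp add: sum_Pow_insert F0_def F1_def G0_def G1_def distrib_left)
qed

text \<open>A plain finite average keeps conditioning and double counting elementary;
  \<open>prob_random_color_set\<close> links it to the pmf of the theorem.\<close>

definition subset_prob :: "'a set \<Rightarrow> ('a set \<Rightarrow> bool) \<Rightarrow> real" where
  "subset_prob S E = (\<Sum>R\<in>Pow S. of_bool (E R)) / 2 ^ card S"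

lemma subset_prob_eq_card: "finite S \<Longrightarrow> subset_prob S E = card {R. R \<subseteq> S \<and> E R} / 2 ^ card S"
proof -
  assume "finite S"
  then have "(\<Sum>R\<in>Pow S. of_bool (E R) :: real) = card (Pow S \<inter> {R. E R})"
    by simp
  also have "Pow S \<inter> {R. E R} = {R. R \<subseteq> S \<and> E R}"
    by auto
  finally show ?thesis
    by (simp add: subset_prob_def)
qed

lemma subset_prob_nonneg: "0 \<le> subset_prob S E"
  unfolding subset_prob_def by (auto intro!: divide_nonneg_nonneg sum_nonneg)

lemma subset_prob_mono:
  "(\<And>R. R \<subseteq> S \<Longrightarrow> E R \<Longrightarrow> F R) \<Longrightarrow> subset_prob S E \<le> subset_prob S F"
  unfolding subset_prob_def by (auto intro!: divide_right_mono sum_mono)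

lemma subset_prob_not:
  assumes "finite S"
  shows "subset_prob S (\<lambda>R. \<not> E R) = 1 - subset_prob S E"
proof -
  have "(\<Sum>R\<in>Pow S. of_bool (\<not> E R)) = (\<Sum>R\<in>Pow S. 1 - of_bool (E R) :: real)"
    by (intro sum.cong) auto
  also have "\<dots> = 2 ^ card S - (\<Sum>R\<in>Pow S. of_bool (E R))"
    using assms by (simp add: sum_subtractf card_Pow)
  finally show ?thesis
    by (simp add: subset_prob_def diff_divide_distrib)
qed

lemma subset_prob_union_bound:
  assumes "finite I"
  shows "subset_prob S (\<lambda>R. \<exists>i\<in>I. E i R) \<le> (\<Sum>i\<in>I. subset_prob S (E i))"
proof -
  have "(\<Sum>R\<in>Pow S. of_bool (\<exists>i\<in>I. E i R)) \<le> (\<Sum>R\<in>Pow S. \<Sum>i\<in>I. of_bool (E i R) :: real)"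
  proof (intro sum_mono)
    fix R
    show "of_bool (\<exists>i\<in>I. E i R) \<le> (\<Sum>i\<in>I. of_bool (E i R) :: real)"
    proof (cases "\<exists>i\<in>I. E i R")
      case True
      then obtain i where "i \<in> I" "E i R" by blast
      then show ?thesis
        using member_le_sum[of i I "\<lambda>i. of_bool (E i R) :: real"] assms by auto
    qed (auto intro: sum_nonneg)
  qed
  then show ?thesis
    unfolding subset_prob_def
    by (subst (asm) sum.swap) (simp add: sum_divide_distrib [symmetric] divide_right_mono)
qed

text \<open>\<open>R\<close> splits into its part in \<open>B\<close> and its part outside.
  \<open>E\<close> sees only the second, so prescribing the first costs exactly the factor
  \<open>2 ^ card B\<close>.\<close>

lemma subset_prob_indep:
  assumes "finite S" "B \<subseteq> S" and E: "\<And>R. E R \<longleftrightarrow> E (R - B)"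
  shows "subset_prob S (\<lambda>R. B \<subseteq> R \<and> E R) = subset_prob S E / 2 ^ card B"
proof -
  have fin: "finite B" "finite (S - B)"
    using assms finite_subset by auto
  have E1: "E (R - B)" if "E R" for R
    using E that by blast
  have E2: "E (P \<union> Q)" if "P \<subseteq> B" "Q \<subseteq> S - B" "E Q" for P Q
  proof -
    have "(P \<union> Q) - B = Q" using that by auto
    then show ?thesis using E[of "P \<union> Q"] that by simp
  qed
  have "bij_betw (\<lambda>R. (R \<inter> B, R - B)) {R. R \<subseteq> S \<and> E R} (Pow B \<times> {R. R \<subseteq> S - B \<and> E R})"
    using assms(2) by (intro bij_betwI[where g = "\<lambda>(P, Q). P \<union> Q"]) (auto intro!: E1 E2)
  then have "card {R. R \<subseteq> S \<and> E R} = 2 ^ card B * card {R. R \<subseteq> S - B \<and> E R}"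
    using fin by (simp add: bij_betw_same_card card_cartesian_product card_Pow)
  moreover have "bij_betw (\<lambda>R. R - B) {R. R \<subseteq> S \<and> B \<subseteq> R \<and> E R} {R. R \<subseteq> S - B \<and> E R}"
    using assms(2) by (intro bij_betwI[where g = "\<lambda>R. B \<union> R"]) (auto intro!: E1 E2)
  then have "card {R. R \<subseteq> S \<and> B \<subseteq> R \<and> E R} = card {R. R \<subseteq> S - B \<and> E R}"
    by (simp add: bij_betw_same_card)
  ultimately show ?thesis
    using assms(1) by (simp add: subset_prob_eq_card)
qed

text \<open>Containing \<open>B\<close> is increasing and \<open>E\<close> is decreasing, so Harris'
  inequality stands in for independence when \<open>E\<close> depends on \<open>B\<close>.\<close>

lemma subset_prob_superset_le:
  assumes "finite S" "B \<subseteq> S" and E: "\<And>P Q. P \<subseteq> Q \<Longrightarrow> E Q \<Longrightarrow> E P"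
  shows "subset_prob S (\<lambda>R. B \<subseteq> R \<and> E R) \<le> subset_prob S E / 2 ^ card B"
proof -
  have "2 ^ card S * (\<Sum>R\<in>Pow S. of_bool (B \<subseteq> R) * of_bool (E R))
      \<le> (\<Sum>R\<in>Pow S. of_bool (B \<subseteq> R)) * (\<Sum>R\<in>Pow S. of_bool (E R) :: real)"
    using assms by (intro harris) (auto simp: of_bool_def)
  moreover have "(\<Sum>R\<in>Pow S. of_bool (B \<subseteq> R)) = (2 ^ card S / 2 ^ card B :: real)"
    using subset_prob_indep[of S B "\<lambda>_. True"] assms by (simp add: subset_prob_def card_Pow field_simps)
  moreover have "(\<Sum>R\<in>Pow S. of_bool (B \<subseteq> R) * of_bool (E R)) = (\<Sum>R\<in>Pow S. of_bool (B \<subseteq> R \<and> E R) :: real)"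
    by (intro sum.cong) auto
  ultimately show ?thesis
    by (simp add: subset_prob_def field_simps)
qed

section \<open>Janson's exponent and its thinned form\<close>

definition janson_pair :: "('i \<Rightarrow> 'a set) \<Rightarrow> 'i \<Rightarrow> 'i \<Rightarrow> real" where
  "janson_pair B i j = (if i \<noteq> j \<and> B i \<inter> B j \<noteq> {} then 1 / 2 ^ card (B i \<union> B j) else 0)"

lemma janson_pair_sym: "janson_pair B i j = janson_pair B j i"
  by (auto simp: janson_pair_def Un_commute Int_commute)

lemma janson_pair_self: "janson_pair B i i = 0"
  by (simp add: janson_pair_def)

text \<open>The Boppana-Spencer induction: a new index \<open>x\<close> multiplies the avoidance
  probability by at most \<open>1 - \<mu>\<close>, where \<open>\<mu>\<close> is the probability of
  \<open>B x \<subseteq> R\<close> minus its correlation with overlapping earlier sets. The double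
  sum runs over ordered pairs, hence the division by 2.\<close>

lemma janson:
  assumes "finite I" "finite S" "\<And>i. i \<in> I \<Longrightarrow> B i \<subseteq> S"
  shows "subset_prob S (\<lambda>R. \<forall>i\<in>I. \<not> B i \<subseteq> R)
    \<le> exp (- (\<Sum>i\<in>I. 1 / 2 ^ card (B i)) + (\<Sum>i\<in>I. \<Sum>j\<in>I. janson_pair B i j) / 2)"
  using assms
proof (induction I rule: finite_induct)
  case empty
  then show ?case by (simp add: subset_prob_def card_Pow)
next
  case (insert x I)
  let ?D = "\<lambda>R. \<forall>i\<in>I. \<not> B i \<subseteq> R"
  \<comment> \<open>\<open>?C\<close> keeps only the constraints disjoint from \<open>B x\<close>,
    which makes it independent of \<open>B x \<subseteq> R\<close>; \<open>?D\<close> is the event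
    controlled by the induction and implies \<open>?C\<close>.\<close>
  let ?C = "\<lambda>R. \<forall>i\<in>I. B i \<inter> B x = {} \<longrightarrow> \<not> B i \<subseteq> R"
  let ?P = "subset_prob S"
  let ?J = "{i\<in>I. B x \<inter> B i \<noteq> {}}"
  define \<mu> where "\<mu> = 1 / 2 ^ card (B x) - (\<Sum>i\<in>I. janson_pair B x i)"
  have J: "(\<Sum>i\<in>?J. 1 / 2 ^ card (B x \<union> B i)) = (\<Sum>i\<in>I. janson_pair B x i)"
    using insert.hyps unfolding janson_pair_def
    by (subst sum.inter_filter) (auto intro!: sum.cong)
  have "?P (\<lambda>R. B x \<subseteq> R \<and> ?C R) = ?P ?C / 2 ^ card (B x)"
    using insert.prems insert.hyps by (intro subset_prob_indep) auto
  moreover have "?P (\<lambda>R. \<exists>i\<in>?J. B x \<union> B i \<subseteq> R \<and> ?C R) \<le> ?P ?C * (\<Sum>i\<in>I. janson_pair B x i)"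
  proof -
    have "?P (\<lambda>R. \<exists>i\<in>?J. B x \<union> B i \<subseteq> R \<and> ?C R) \<le> (\<Sum>i\<in>?J. ?P (\<lambda>R. B x \<union> B i \<subseteq> R \<and> ?C R))"
      using insert.hyps by (intro subset_prob_union_bound) auto
    also have "\<dots> \<le> (\<Sum>i\<in>?J. ?P ?C / 2 ^ card (B x \<union> B i))"
    proof (intro sum_mono subset_prob_superset_le)
      fix i P Q assume "P \<subseteq> Q" "?C Q"
      then show "?C P" by blast
    qed (use insert.prems in auto)
    also have "\<dots> = ?P ?C * (\<Sum>i\<in>I. janson_pair B x i)"
      by (simp add: J [symmetric] sum_distrib_left)
    finally show ?thesis .
  qed
  moreover have "?P (\<lambda>R. B x \<subseteq> R \<and> ?C R)
      \<le> ?P (\<lambda>R. B x \<subseteq> R \<and> ?D R) + ?P (\<lambda>R. \<exists>i\<in>?J. B x \<union> B i \<subseteq> R \<and> ?C R)"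
    unfolding subset_prob_def add_divide_distrib [symmetric] sum.distrib [symmetric]
  proof (intro divide_right_mono sum_mono)
    fix R
    have "?D R \<or> (\<exists>i\<in>?J. B x \<union> B i \<subseteq> R \<and> ?C R)" if "B x \<subseteq> R" "?C R"
      using that by blast
    then have "B x \<subseteq> R \<and> ?C R \<longrightarrow> (B x \<subseteq> R \<and> ?D R) \<or> (\<exists>i\<in>?J. B x \<union> B i \<subseteq> R \<and> ?C R)"
      by blast
    then show "of_bool (B x \<subseteq> R \<and> ?C R)
        \<le> of_bool (B x \<subseteq> R \<and> ?D R) + (of_bool (\<exists>i\<in>?J. B x \<union> B i \<subseteq> R \<and> ?C R) :: real)"
      by (simp only: of_bool_def split: if_split) linarith
  qed auto
  ultimately have "?P ?C * \<mu> \<le> ?P (\<lambda>R. B x \<subseteq> R \<and> ?D R)"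
    unfolding \<mu>_def by (simp add: algebra_simps)
  moreover have "?P ?D * \<mu> \<le> ?P ?C * \<mu>" if "\<mu> \<ge> 0"
    using that by (intro mult_right_mono subset_prob_mono) auto
  \<comment> \<open>The correction may exceed the probability of \<open>B x \<subseteq> R\<close>;
    the estimate is trivial then.\<close>
  moreover have "?P ?D * \<mu> \<le> 0" if "\<mu> < 0"
    using that subset_prob_nonneg[of S ?D] by (simp add: mult_nonneg_nonpos)
  ultimately have "?P ?D * \<mu> \<le> ?P (\<lambda>R. B x \<subseteq> R \<and> ?D R)"
    using subset_prob_nonneg[of S "\<lambda>R. B x \<subseteq> R \<and> ?D R"] by linarith
  moreover have "?P (\<lambda>R. \<forall>i\<in>insert x I. \<not> B i \<subseteq> R) + ?P (\<lambda>R. B x \<subseteq> R \<and> ?D R) = ?P ?D"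
    unfolding subset_prob_def add_divide_distrib [symmetric] sum.distrib [symmetric]
    by (intro arg_cong2[where f = "(/)"] sum.cong) auto
  ultimately have "?P (\<lambda>R. \<forall>i\<in>insert x I. \<not> B i \<subseteq> R) \<le> ?P ?D * (1 - \<mu>)"
    by (simp add: algebra_simps)
  also have "\<dots> \<le> ?P ?D * exp (- \<mu>)"
    using exp_ge_add_one_self[of "-\<mu>"] by (intro mult_left_mono subset_prob_nonneg) auto
  also have "\<dots> \<le> exp (- (\<Sum>i\<in>I. 1 / 2 ^ card (B i)) + (\<Sum>i\<in>I. \<Sum>j\<in>I. janson_pair B i j) / 2) * exp (- \<mu>)"
    using insert.IH insert.prems by (intro mult_right_mono) auto
  also have "\<dots> = exp (- (\<Sum>i\<in>insert x I. 1 / 2 ^ card (B i))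
      + (\<Sum>i\<in>insert x I. \<Sum>j\<in>insert x I. janson_pair B i j) / 2)"
  proof -
    have "(\<Sum>i\<in>I. janson_pair B i x) = (\<Sum>i\<in>I. janson_pair B x i)"
      by (intro sum.cong refl janson_pair_sym)
    then show ?thesis
      using insert.hyps by (simp add: \<mu>_def janson_pair_self exp_add [symmetric] sum.distrib add_divide_distrib)
  qed
  finally show ?case .
qed

text \<open>The left-hand side is the expectation when every index is kept with probability \<open>t\<close>; indices are
  derandomized one at a time.\<close>

lemma subfamily_rounding:
  fixes a :: "'i \<Rightarrow> real" and b :: "'i \<Rightarrow> 'i \<Rightarrow> real"
  assumes "finite I" "0 \<le> t" "t \<le> 1" "\<And>i. b i i = 0" "\<And>i j. b i j = b j i"
  shows "\<exists>J\<subseteq>I. t * (\<Sum>i\<in>I. a i) - t\<^sup>2 * (\<Sum>i\<in>I. \<Sum>j\<in>I. b i j) / 2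
    \<le> (\<Sum>i\<in>J. a i) - (\<Sum>i\<in>J. \<Sum>j\<in>J. b i j) / 2"
  using assms(1)
proof (induction I arbitrary: a rule: finite_induct)
  case empty
  then show ?case by simp
next
  case (insert x I)
  let ?F = "\<lambda>a J. (\<Sum>i\<in>J. a i) - (\<Sum>i\<in>J. \<Sum>j\<in>J. b i j) / 2"
  \<comment> \<open>The expected interaction of \<open>x\<close> with an index \<open>i\<close> is
    charged to the linear weight of \<open>i\<close>; this is why the induction leaves
    \<open>a\<close> arbitrary.\<close>
  obtain J where J: "J \<subseteq> I" "t * (\<Sum>i\<in>I. a i - t * b x i) - t\<^sup>2 * (\<Sum>i\<in>I. \<Sum>j\<in>I. b i j) / 2
    \<le> ?F (\<lambda>i. a i - t * b x i) J"
    using insert.IH by blast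
  have x: "x \<notin> J" "finite J"
    using J insert.hyps finite_subset by auto
  have sym: "(\<Sum>i\<in>K. b i x) = (\<Sum>i\<in>K. b x i)" for K
    using assms by (intro sum.cong) auto
  have Fx: "?F a (insert x J) = ?F a J + a x - (\<Sum>i\<in>J. b x i)"
    using x assms(4) by (simp add: sum.distrib sym field_simps)
  have "t * (\<Sum>i\<in>insert x I. a i) - t\<^sup>2 * (\<Sum>i\<in>insert x I. \<Sum>j\<in>insert x I. b i j) / 2
    = t * a x + (t * (\<Sum>i\<in>I. a i - t * b x i) - t\<^sup>2 * (\<Sum>i\<in>I. \<Sum>j\<in>I. b i j) / 2)"
    using insert.hyps assms(4)
    by (simp add: sum.distrib sum_subtractf sum_distrib_left [symmetric] sym power2_eq_square field_simps)
  also have "\<dots> \<le> t * a x + ?F (\<lambda>i. a i - t * b x i) J"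
    using J by simp
  \<comment> \<open>A convex combination of omitting and taking \<open>x\<close>, so one of the two
    choices does at least as well.\<close>
  also have "\<dots> = (1 - t) * ?F a J + t * ?F a (insert x J)"
    unfolding Fx sum_subtractf sum_distrib_left [symmetric] by algebra
  also have "\<dots> \<le> max (?F a J) (?F a (insert x J))"
    using convex_bound_le[of "?F a J" "max (?F a J) (?F a (insert x J))" "?F a (insert x J)" "1 - t" t]
      assms(2,3) by auto
  finally have "\<exists>K\<in>{J, insert x J}. t * (\<Sum>i\<in>insert x I. a i)
      - t\<^sup>2 * (\<Sum>i\<in>insert x I. \<Sum>j\<in>insert x I. b i j) / 2 \<le> ?F a K"
    by (simp only: le_max_iff_disj bex_simps) blast
  then show ?case
    using J(1) by blast
qed

text \<open>\<open>\<kappa>\<close> bounds the pair sum relative to the square of the expectation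
  \<open>\<mu>\<close>. Keeping a proportion \<open>t\<close> of the indices scales the expectation
  by \<open>t\<close> and the pair sum by \<open>t\<^sup>2\<close>, which rescues the exponent when
  the full pair sum is larger than \<open>\<mu>\<close>.\<close>

lemma janson_uniform:
  fixes b :: nat and \<kappa> :: real
  assumes "finite I" "finite S" "\<And>i. i \<in> I \<Longrightarrow> B i \<subseteq> S" "\<And>i. i \<in> I \<Longrightarrow> card (B i) = b"
    and pair: "\<And>i. i \<in> I \<Longrightarrow> (\<Sum>j | j \<in> I \<and> B i \<inter> B j \<noteq> {}. 2 ^ card (B i \<inter> B j)) \<le> \<kappa> * card I"
    and "0 < \<kappa>" "1 \<le> \<kappa> * (card I / 2 ^ b)"
  shows "subset_prob S (\<lambda>R. \<forall>i\<in>I. \<not> B i \<subseteq> R) \<le> exp (- 1 / (2 * \<kappa>))"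
proof -
  define \<mu> where "\<mu> = card I / (2 ^ b :: real)"
  \<comment> \<open>The thinned expectation becomes \<open>1 / \<kappa>\<close> and the thinned pair
    sum at most \<open>1 / \<kappa>\<close>, so half of the exponent survives. The last hypothesis
    is what makes \<open>t \<le> 1\<close>.\<close>
  define t where "t = 1 / (\<kappa> * \<mu>)"
  have \<mu>: "1 \<le> \<kappa> * \<mu>" using assms by (simp add: \<mu>_def)
  then have \<mu>0: "\<mu> > 0" using \<open>0 < \<kappa>\<close> by (smt (verit) mult_nonneg_nonpos)
  have t: "0 \<le> t" "t \<le> 1" using \<mu> by (auto simp: t_def)
  have row: "(\<Sum>j\<in>I. janson_pair B i j) \<le> \<kappa> * \<mu> / 2 ^ b" if i: "i \<in> I" for i
  proof -
    have "(\<Sum>j\<in>I. janson_pair B i j) \<le> (\<Sum>j\<in>I. if B i \<inter> B j \<noteq> {} then 2 ^ card (B i \<inter> B j) / 2 ^ (2 * b) else 0)"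
    proof (intro sum_mono)
      fix j assume j: "j \<in> I"
      have "card (B i \<union> B j) + card (B i \<inter> B j) = 2 * b"
        using card_Un_Int[of "B i" "B j"] i j assms finite_subset by (metis mult_2)
      then have "2 ^ (2 * b) = (2 ^ card (B i \<union> B j) * 2 ^ card (B i \<inter> B j) :: real)"
        by (metis power_add)
      then show "janson_pair B i j \<le> (if B i \<inter> B j \<noteq> {} then 2 ^ card (B i \<inter> B j) / 2 ^ (2 * b) else 0)"
        unfolding janson_pair_def by (auto simp: field_simps)
    qed
    also have "\<dots> = (\<Sum>j | j \<in> I \<and> B i \<inter> B j \<noteq> {}. 2 ^ card (B i \<inter> B j)) / 2 ^ (2 * b)"
      unfolding sum_divide_distrib by (subst sum.inter_filter) (auto intro: assms)
    also have "\<dots> \<le> \<kappa> * card I / 2 ^ (2 * b)"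
      using pair[OF i] by (intro divide_right_mono) auto
    finally show ?thesis
      by (simp add: \<mu>_def power_mult power2_eq_square mult_2 power_add field_simps)
  qed
  obtain J where J: "J \<subseteq> I" "t * (\<Sum>i\<in>I. 1 / 2 ^ card (B i)) - t\<^sup>2 * (\<Sum>i\<in>I. \<Sum>j\<in>I. janson_pair B i j) / 2
    \<le> (\<Sum>i\<in>J. 1 / 2 ^ card (B i)) - (\<Sum>i\<in>J. \<Sum>j\<in>J. janson_pair B i j) / 2"
    using subfamily_rounding[OF \<open>finite I\<close> t, of "janson_pair B" "\<lambda>i. 1 / 2 ^ card (B i)"]
    using janson_pair_sym[of B] by (auto simp: janson_pair_self)
  have "(\<Sum>i\<in>I. \<Sum>j\<in>I. janson_pair B i j) \<le> (\<Sum>i\<in>I. \<kappa> * \<mu> / 2 ^ b)"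
    using row by (intro sum_mono) auto
  also have "\<dots> = \<kappa> * \<mu>\<^sup>2"
    by (simp add: \<mu>_def power2_eq_square)
  finally have "t\<^sup>2 * (\<Sum>i\<in>I. \<Sum>j\<in>I. janson_pair B i j) \<le> t\<^sup>2 * (\<kappa> * \<mu>\<^sup>2)"
    by (intro mult_left_mono) auto
  also have "\<dots> = 1 / \<kappa>"
    using \<mu>0 \<open>0 < \<kappa>\<close> by (simp add: t_def power2_eq_square field_simps)
  finally have 1: "t\<^sup>2 * (\<Sum>i\<in>I. \<Sum>j\<in>I. janson_pair B i j) \<le> 1 / \<kappa>" .
  have "t * (\<Sum>i\<in>I. 1 / 2 ^ card (B i)) = t * \<mu>"
    using assms(4) by (simp add: \<mu>_def)
  also have "\<dots> = 1 / \<kappa>"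
    using \<mu>0 by (simp add: t_def)
  finally have 2: "1 / (2 * \<kappa>) \<le> (\<Sum>i\<in>J. 1 / 2 ^ card (B i)) - (\<Sum>i\<in>J. \<Sum>j\<in>J. janson_pair B i j) / 2"
    using J(2) 1 by (simp add: field_simps)
  have "subset_prob S (\<lambda>R. \<forall>i\<in>I. \<not> B i \<subseteq> R) \<le> subset_prob S (\<lambda>R. \<forall>i\<in>J. \<not> B i \<subseteq> R)"
    using J by (intro subset_prob_mono) auto
  also have "\<dots> \<le> exp (- (\<Sum>i\<in>J. 1 / 2 ^ card (B i)) + (\<Sum>i\<in>J. \<Sum>j\<in>J. janson_pair B i j) / 2)"
    using J assms finite_subset[OF J(1)] by (intro janson) auto
  also have "\<dots> \<le> exp (- 1 / (2 * \<kappa>))"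
    using 2 by simp
  finally show ?thesis .
qed

section \<open>Counting maps with a prescribed forest\<close>

text \<open>The edge added last comes first; its second component is a vertex not used before.\<close>

fun forest :: "('i \<times> 'i) list \<Rightarrow> bool" where
  "forest [] = True"
| "forest ((a, b) # es) = (b \<noteq> a \<and> b \<notin> fst ` set es \<union> snd ` set es \<and> forest es)"

lemma forest_append:
  assumes "forest xs" "forest ys" "(fst ` set xs \<union> snd ` set xs) \<inter> (fst ` set ys \<union> snd ` set ys) = {}"
  shows "forest (xs @ ys)"
  using assms
proof (induction xs)
  case (Cons e xs)
  obtain a b where "e = (a, b)" by fastforce
  with Cons show ?case by auto
qed simp

text \<open>A largest vertex set spanned by a tree through \<open>r\<close> is closed under
  \<open>E\<close>, since a crossing edge could be put in front of the list. As \<open>r\<close> is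
  never a second component, it is the root.\<close>

lemma grow_tree:
  assumes "finite J" "r \<in> J" and sym: "\<And>x y. E x y \<Longrightarrow> E y x"
  shows "\<exists>S es. r \<in> S \<and> S \<subseteq> J \<and> forest es \<and> set es \<subseteq> {(a, b) \<in> S \<times> S. E a b} \<and> r \<notin> snd ` set es
    \<and> card S = Suc (length es) \<and> (\<forall>x\<in>S. \<forall>y\<in>J - S. \<not> E x y)"
proof -
  define P where "P S \<longleftrightarrow> r \<in> S \<and> S \<subseteq> J \<and> (\<exists>es. forest es \<and> set es \<subseteq> {(a, b) \<in> S \<times> S. E a b}
    \<and> r \<notin> snd ` set es \<and> card S = Suc (length es))" for S
  have "P {r}"
    unfolding P_def using assms by (auto intro!: exI[of _ "[]"])
  moreover have "\<forall>S. P S \<longrightarrow> card S < Suc (card J)"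
    using assms(1) by (auto simp: P_def intro: card_mono le_imp_less_Suc)
  ultimately obtain S where S: "P S" "\<And>T. P T \<Longrightarrow> card T \<le> card S"
    using arg_max_nat_lemma[of P "{r}" card "Suc (card J)"] by blast
  obtain es where es: "forest es" "set es \<subseteq> {(a, b) \<in> S \<times> S. E a b}" "r \<notin> snd ` set es"
    "card S = Suc (length es)" and rS: "r \<in> S" "S \<subseteq> J"
    using S(1) unfolding P_def by blast
  have fin: "finite S" using rS assms finite_subset by blast
  have "\<not> E x y" if "x \<in> S" "y \<in> J - S" for x y
  proof
    assume "E x y"
    have "y \<notin> fst ` set es \<union> snd ` set es"
      using es(2) that(2) by auto
    then have "P (insert y S)"
      unfolding P_def using es rS that \<open>E x y\<close> fin
      by (intro conjI exI[of _ "(x, y) # es"]) auto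
    then have "card (insert y S) \<le> card S"
      by (rule S(2))
    then show False
      using that fin by simp
  qed
  then show ?thesis
    using es rS by blast
qed

text \<open>Components are peeled off, starting with that of \<open>r\<close> if \<open>r\<close> is
  present. A component of size c has at most c (c - 1) ordered adjacent pairs and a tree with c - 1
  edges, which gives at most \<open>card J\<close> pairs per forest edge. All neighbors of
  \<open>r\<close> lie in its own component, so its degree is at most the size of that tree.\<close>

lemma spanning_forest:
  assumes "finite J" and sym: "\<And>x y. E x y \<Longrightarrow> E y x" and irr: "\<And>x. \<not> E x x"
  shows "\<exists>es. forest es \<and> set es \<subseteq> {(a, b) \<in> J \<times> J. E a b} \<and> r \<notin> snd ` set es
    \<and> card {(a, b) \<in> J \<times> J. E a b} \<le> card J * length es
    \<and> (r \<in> J \<longrightarrow> card {b \<in> J. E r b} \<le> length es)"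
  using assms(1)
proof (induction "card J" arbitrary: J rule: less_induct)
  case less
  show ?case
  proof (cases "J = {}")
    case False
    then obtain a where a: "a \<in> J" "r \<in> J \<Longrightarrow> a = r" by auto
    obtain S es where S: "a \<in> S" "S \<subseteq> J" "forest es" "set es \<subseteq> {(a, b) \<in> S \<times> S. E a b}"
      "a \<notin> snd ` set es" "card S = Suc (length es)" "\<forall>x\<in>S. \<forall>y\<in>J - S. \<not> E x y"
      using grow_tree[OF less.prems a(1), of E] sym by blast
    have finS: "finite S" using S less.prems finite_subset by blast
    have "card (J - S) < card J"
      using S less.prems by (intro psubset_card_mono) auto
    then obtain fs where fs: "forest fs" "set fs \<subseteq> {(a, b) \<in> (J - S) \<times> (J - S). E a b}"
      "card {(a, b) \<in> (J - S) \<times> (J - S). E a b} \<le> card (J - S) * length fs"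
      using less.hyps[of "J - S"] less.prems by auto
    have "forest (fs @ es)"
      using S fs by (intro forest_append) auto
    moreover have "set (fs @ es) \<subseteq> {(a, b) \<in> J \<times> J. E a b}"
      using S fs by auto
    moreover have "r \<notin> snd ` set (fs @ es)"
    proof
      assume "r \<in> snd ` set (fs @ es)"
      then have "r \<in> snd ` set es \<or> r \<in> snd ` set fs"
        by (simp add: image_Un disj_commute)
      moreover have "snd ` set es \<subseteq> S" "snd ` set fs \<subseteq> J - S"
        using S(4) fs(2) by auto
      ultimately have "r \<in> J" "r \<in> snd ` set es \<or> r \<notin> S"
        using S(2) by blast+
      then show False using a(2) S(1,5) by blast
    qed
    moreover have "card {(a, b) \<in> J \<times> J. E a b} \<le> card J * length (fs @ es)"
    proof -
      have sub: "{(a, b) \<in> J \<times> J. E a b}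
          \<subseteq> (SIGMA a:S. S - {a}) \<union> {(a, b) \<in> (J - S) \<times> (J - S). E a b}"
        using S(7) sym irr by fastforce
      have "card {(a, b) \<in> J \<times> J. E a b}
          \<le> card ((SIGMA a:S. S - {a}) \<union> {(a, b) \<in> (J - S) \<times> (J - S). E a b})"
        using finS less.prems by (intro card_mono sub finite_UnI) (auto intro: finite_subset[of _ "J \<times> J"])
      also have "\<dots> \<le> card (SIGMA a:S. S - {a}) + card {(a, b) \<in> (J - S) \<times> (J - S). E a b}"
        by (rule card_Un_le)
      also have "card (SIGMA a:S. S - {a}) = card S * length es"
        using finS S(6) by (subst card_SigmaI) auto
      also have "card S * length es + card {(a, b) \<in> (J - S) \<times> (J - S). E a b}
          \<le> card J * length es + card J * length fs"
        using fs(3) S(2) less.prems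
        by (intro add_mono mult_right_mono order.trans[OF fs(3)] card_mono) auto
      finally show ?thesis by (simp add: algebra_simps)
    qed
    moreover have "card {b \<in> J. E r b} \<le> length (fs @ es)" if "r \<in> J"
    proof -
      have ar: "a = r" using a(2) that .
      have "{b \<in> J. E r b} \<subseteq> S - {r}"
        using S(1,7) irr ar by blast
      then have "card {b \<in> J. E r b} \<le> card (S - {r})"
        using finS by (intro card_mono) auto
      also have "\<dots> = length es"
        using S(1,6) ar by simp
      finally show ?thesis by simp
    qed
    ultimately show ?thesis
      by (intro exI[of _ "fs @ es"] conjI impI)
  qed (auto intro!: exI[of _ "[]"])
qed

text \<open>The root \<open>r\<close> stands for a vertex outside the range of the random map \<open>w\<close>.\<close>

lemma card_forest_maps:
  fixes h :: "'v option \<Rightarrow> 'v set" and D :: nat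
  assumes "finite V" "\<And>u. h u \<subseteq> V" "\<And>u. card (h u) \<le> D"
    and "finite I" "r \<notin> I" "forest es" "set es \<subseteq> insert r I \<times> I"
  shows "card {w \<in> I \<rightarrow>\<^sub>E V. \<forall>(a, b)\<in>set es. w b \<in> h (if a = r then None else Some (w a))} * card V ^ length es
    \<le> card V ^ card I * D ^ length es"
  using assms(4-)
proof (induction es arbitrary: I)
  case Nil
  then show ?case by (simp add: card_funcsetE)
next
  case (Cons e es)
  obtain a b where e: "e = (a, b)" by fastforce
  have ab: "b \<in> I" "a \<noteq> b" "b \<notin> fst ` set es \<union> snd ` set es" "forest es" "a \<in> insert r I" "b \<noteq> r"
    using Cons.prems e by auto
  define I' where "I' = I - {b}"
  have I: "I = insert b I'" "b \<notin> I'" "finite I'" "r \<notin> I'"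
    using ab Cons.prems by (auto simp: I'_def)
  have es: "set es \<subseteq> insert r I' \<times> I'"
  proof
    fix p assume p: "p \<in> set es"
    then have "fst p \<noteq> b" "snd p \<noteq> b" "p \<in> insert r I \<times> I"
      using Cons.prems(4) ab(3) by auto
    then show "p \<in> insert r I' \<times> I'"
      by (cases p) (auto simp: I'_def)
  qed
  let ?W = "{w \<in> I' \<rightarrow>\<^sub>E V. \<forall>(a, b)\<in>set es. w b \<in> h (if a = r then None else Some (w a))}"
  let ?f = "\<lambda>w. if a = r then None else Some (w a)"
  have finh: "finite (h u)" for u
    using assms(1,2) by (rule finite_subset[rotated])
  have finW: "finite ?W"
    by (rule finite_subset[OF _ finite_PiE[OF I(3), of "\<lambda>_. V"]]) (use assms(1) in auto)
  \<comment> \<open>\<open>b\<close> is a leaf: with the other values fixed it has at most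
    \<open>D\<close> choices instead of \<open>card V\<close>. Resetting it to
    \<open>undefined\<close> lands in the extensional maps on \<open>I'\<close>.\<close>
  have "{w \<in> I \<rightarrow>\<^sub>E V. \<forall>(a, b)\<in>set (e # es). w b \<in> h (if a = r then None else Some (w a))}
    \<subseteq> (\<lambda>(w, y). w(b := y)) ` (SIGMA w:?W. h (?f w))" (is "?L \<subseteq> _")
  proof
    fix w assume w: "w \<in> ?L"
    let ?w = "w(b := undefined)"
    have "?w \<in> I' \<rightarrow>\<^sub>E V"
      using w I by (auto simp: PiE_iff extensional_def)
    moreover have "?w y \<in> h (if x = r then None else Some (?w x))" if "(x, y) \<in> set es" for x y
    proof -
      have "x \<noteq> b" "y \<noteq> b"
        using that ab(3) by force+
      moreover have "w y \<in> h (if x = r then None else Some (w x))"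
        using w that by auto
      ultimately show ?thesis by auto
    qed
    moreover have "w b \<in> h (?f ?w)"
      using w e ab by auto
    ultimately have "(?w, w b) \<in> (SIGMA w:?W. h (?f w))"
      by blast
    moreover have "w = (\<lambda>(w, y). w(b := y)) (?w, w b)"
      by simp
    ultimately show "w \<in> (\<lambda>(w, y). w(b := y)) ` (SIGMA w:?W. h (?f w))"
      by (rule rev_image_eqI)
  qed
  moreover have finS: "finite (SIGMA w:?W. h (?f w))"
    by (rule finite_SigmaI[OF finW]) (rule finh)
  ultimately have "card ?L \<le> card ((\<lambda>(w, y). w(b := y)) ` (SIGMA w:?W. h (?f w)))"
    by (intro card_mono) auto
  also have "\<dots> \<le> card (SIGMA w:?W. h (?f w))"
    by (rule card_image_le[OF finS])
  also have "\<dots> = (\<Sum>w\<in>?W. card (h (?f w)))"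
    by (rule card_SigmaI[OF finW]) (intro ballI finh)
  also have "\<dots> \<le> card ?W * D"
    using sum_bounded_above[of ?W "\<lambda>w. card (h (?f w))" D] assms(3) by simp
  finally have "card ?L * card V ^ length (e # es) \<le> (card ?W * card V ^ length es) * (D * card V)"
    using mult_right_mono[of "card ?L" "card ?W * D" "card V ^ length (e # es)"] by (simp add: ac_simps)
  also have "\<dots> \<le> (card V ^ card I' * D ^ length es) * (D * card V)"
    using Cons.IH[OF I(3,4) ab(4) es] by (intro mult_right_mono) auto
  also have "\<dots> = card V ^ card I * D ^ length (e # es)"
    using I by (simp add: ac_simps)
  finally show ?case .
qed

section \<open>Quasirandomness of the random color set\<close>

lemma sum_swap3:
  "(\<Sum>i\<in>I. \<Sum>j\<in>J. \<Sum>k\<in>K. f i j k) = (\<Sum>j\<in>J. \<Sum>k\<in>K. \<Sum>i\<in>I. f i j k)"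
  by (subst sum.swap, rule sum.cong[OF refl], rule sum.swap)

section \<open>Neighborhoods and rainbow extensions under a proper coloring\<close>

locale colored_graph =
  fixes V :: "'v set" and col :: "'v set \<Rightarrow> 'c"
  assumes finV: "finite V" and proper: "proper_edge_coloring V col"
begin

definition nbr :: "'c set \<Rightarrow> 'v \<Rightarrow> 'v set" where
  "nbr R x = {y \<in> V. x \<in> V \<and> y \<noteq> x \<and> col {x, y} \<in> R}"

definition forb :: "'v set \<Rightarrow> 'v set" where
  "forb T = {y \<in> V. y \<in> T \<or> \<not> inj_on col (nsets (insert y T) 2)}"

lemma col_eq_imp_eq:
  assumes "x \<in> V" "y \<in> V" "y' \<in> V" "y \<noteq> x" "y' \<noteq> x" "col {x, y} = col {x, y'}"
  shows "y = y'"
proof (rule ccontr)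
  assume "y \<noteq> y'"
  then have "{x, y} \<noteq> {x, y'}" using assms by (auto simp: doubleton_eq_iff)
  moreover have "{x, y} \<in> nsets V 2" "{x, y'} \<in> nsets V 2"
    using assms by (auto simp: nsets_def card_insert_if)
  ultimately show False
    using proper assms(6) unfolding proper_edge_coloring_def
    by (metis Int_iff empty_iff insertI1)
qed

lemma nbr_subset: "nbr R x \<subseteq> V"
  by (auto simp: nbr_def)

lemma finite_nbr: "finite (nbr R x)"
  using nbr_subset finV finite_subset by blast

lemma nbr_sym: "y \<in> nbr R x \<longleftrightarrow> x \<in> nbr R y"
  by (auto simp: nbr_def insert_commute)

lemma nbr_mono: "U \<subseteq> R \<Longrightarrow> nbr U x \<subseteq> nbr R x"
  by (auto simp: nbr_def)

text \<open>Edges at \<open>x\<close> have distinct colors, so a neighbor is determined by its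
  color.\<close>

lemma card_nbr_le:
  assumes "finite R"
  shows "card (nbr R x) \<le> card R"
proof (rule card_inj_on_le[OF _ _ assms])
  show "inj_on (\<lambda>y. col {x, y}) (nbr R x)"
    using col_eq_imp_eq by (intro inj_onI) (auto simp: nbr_def)
qed (auto simp: nbr_def)

lemma nsets2_insert:
  assumes "y \<notin> T"
  shows "nsets (insert y T) 2 = nsets T 2 \<union> (\<lambda>t. {y, t}) ` T"
  using assms by (auto simp: nsets_2_eq)

lemma clique_colors_insert:
  assumes "y \<notin> T"
  shows "clique_colors col (insert y T) = clique_colors col T \<union> (\<lambda>t. col {y, t}) ` T"
  using assms by (auto simp: clique_colors_def nsets2_insert)

lemma clique_colors_mono: "A \<subseteq> B \<Longrightarrow> clique_colors col A \<subseteq> clique_colors col B"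
  by (auto simp: clique_colors_def nsets_def)

lemma clique_colors_insert_subset:
  assumes "clique_colors col T \<subseteq> R" "T \<subseteq> nbr R y"
  shows "clique_colors col (insert y T) \<subseteq> R"
proof (cases "y \<in> T")
  case True
  then show ?thesis using assms by (simp add: insert_absorb)
next
  case False
  then show ?thesis using assms by (auto simp: clique_colors_insert nbr_def)
qed

lemma card_nsets2_le: "finite T \<Longrightarrow> card (nsets T 2) \<le> card T ^ 2"
  by (simp add: choose_two power2_eq_square) (meson div_le_dividend le_trans diff_le_self mult_le_mono2)

text \<open>Two edges leaving a new vertex \<open>y\<close> towards \<open>T\<close> never share a
  color, by properness. So \<open>y\<close> spoils the rainbow property only if one of these edges
  repeats a color from inside \<open>T\<close>.\<close>

lemma forb_subset:
  assumes "T \<subseteq> V" "inj_on col (nsets T 2)"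
  shows "forb T \<subseteq> T \<union> (\<Union>t\<in>T. nbr (col ` nsets T 2) t)"
proof
  fix y assume "y \<in> forb T"
  then have y: "y \<in> V" "y \<in> T \<or> \<not> inj_on col (nsets (insert y T) 2)"
    by (auto simp: forb_def)
  show "y \<in> T \<union> (\<Union>t\<in>T. nbr (col ` nsets T 2) t)"
  proof (rule ccontr)
    assume n: "\<not> ?thesis"
    then have yT: "y \<notin> T" by simp
    have "inj_on col ((\<lambda>t. {y, t}) ` T)"
    proof (rule inj_onI)
      fix e f assume "e \<in> (\<lambda>t. {y, t}) ` T" "f \<in> (\<lambda>t. {y, t}) ` T" "col e = col f"
      then obtain s t where "e = {y, s}" "f = {y, t}" "s \<in> T" "t \<in> T" "col {y, s} = col {y, t}"
        by auto
      moreover from this have "s = t"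
        using assms y yT by (intro col_eq_imp_eq[of y s t]) auto
      ultimately show "e = f" by simp
    qed
    moreover have "col {y, t} \<notin> col ` nsets T 2" if "t \<in> T" for t
    proof -
      have "y \<notin> nbr (col ` nsets T 2) t" "t \<in> V" "y \<noteq> t"
        using n that assms(1) yT by auto
      then show ?thesis
        using y(1) by (simp add: nbr_def insert_commute)
    qed
    then have "col ` nsets T 2 \<inter> col ` (\<lambda>t. {y, t}) ` T = {}"
      unfolding image_image by (auto simp only: disjoint_iff imageI elim!: imageE) (metis imageI)
    ultimately have "inj_on col (nsets T 2 \<union> (\<lambda>t. {y, t}) ` T)"
      using assms(2) unfolding inj_on_Un by blast
    then show False
      using y(2) yT by (simp add: nsets2_insert)
  qed
qed

lemma card_forb_le:
  assumes "T \<subseteq> V" "inj_on col (nsets T 2)" "card T \<le> K"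
  shows "card (forb T) \<le> K + K ^ 3"
proof -
  have fT: "finite T" using assms finV finite_subset by blast
  have fin: "finite (nsets T 2)" using fT by (simp add: finite_imp_finite_nsets)
  have "card (forb T) \<le> card (T \<union> (\<Union>t\<in>T. nbr (col ` nsets T 2) t))"
    using fT finite_nbr by (intro card_mono forb_subset assms) auto
  also have "\<dots> \<le> card T + card (\<Union>t\<in>T. nbr (col ` nsets T 2) t)"
    by (rule card_Un_le)
  also have "card (\<Union>t\<in>T. nbr (col ` nsets T 2) t) \<le> (\<Sum>t\<in>T. card (nbr (col ` nsets T 2) t))"
    by (rule card_UN_le[OF fT])
  also have "\<dots> \<le> card T * card T ^ 2"
  proof -
    have "card (nbr (col ` nsets T 2) t) \<le> card T ^ 2" for t
      using card_nbr_le[of "col ` nsets T 2" t] fin card_image_le[OF fin, of col] card_nsets2_le[OF fT]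
      by force
    then show ?thesis
      using sum_bounded_above[of T "\<lambda>t. card (nbr (col ` nsets T 2) t)" "card T ^ 2"] by simp
  qed
  also have "card T * card T ^ 2 \<le> K * K ^ 2"
    using assms(3) by (intro mult_mono power_mono) auto
  finally show ?thesis
    using assms(3) by (simp add: power3_eq_cube power2_eq_square)
qed

section \<open>Signed counts of closed 4-walks\<close>

definition edge_sign :: "'c set \<Rightarrow> 'v \<Rightarrow> 'v \<Rightarrow> real" where
  "edge_sign R x y = (if x = y then 0 else if col {x, y} \<in> R then 1 else -1)"

definition sign_corr :: "'c set \<Rightarrow> 'v \<Rightarrow> 'v \<Rightarrow> real" where
  "sign_corr R x x' = (\<Sum>y\<in>V. edge_sign R x y * edge_sign R x' y)"

text \<open>The trace of the fourth power of the signed adjacency matrix, as in the 4-cycle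
  criterion for quasirandom graphs.\<close>

definition corr_energy :: "'c set \<Rightarrow> real" where
  "corr_energy R = (\<Sum>x\<in>V. \<Sum>x'\<in>V. (sign_corr R x x')\<^sup>2)"

lemma edge_sign_bound: "\<bar>edge_sign R x y\<bar> \<le> 1"
  by (simp add: edge_sign_def)

lemma finite_colors: "finite (clique_colors col V)"
  using finV by (simp add: clique_colors_def finite_imp_finite_nsets)

lemma sum_Pow_flip:
  fixes f :: "'a set \<Rightarrow> real"
  assumes "finite S" "d \<in> S" "\<And>R. R \<subseteq> S \<Longrightarrow> d \<notin> R \<Longrightarrow> f (insert d R) = - f R"
  shows "(\<Sum>R\<in>Pow S. f R) = 0"
proof -
  have "(\<Sum>R\<in>Pow (insert d (S - {d})). f R)
      = (\<Sum>R\<in>Pow (S - {d}). f R) + (\<Sum>R\<in>Pow (S - {d}). f (insert d R))"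
    using assms(1) by (intro sum_Pow_insert) auto
  also have "(\<Sum>R\<in>Pow (S - {d}). f (insert d R)) = (\<Sum>R\<in>Pow (S - {d}). - f R)"
    using assms(3) by (intro sum.cong) auto
  finally show ?thesis
    using assms(2) by (simp add: insert_absorb sum_negf)
qed

text \<open>Expanding the square gives the sign of the 4-cycle x y x' y'. The color of xy is absent
  from the two edges adjacent to it, so toggling it flips the sign unless the opposite edge x'y' has
  the same color. Besides \<open>y' = y\<close>, properness leaves at most one such
  \<open>y'\<close> for each \<open>y\<close>.\<close>

lemma sum_sign_corr_sq:
  assumes x: "x \<in> V" "x' \<in> V" "x \<noteq> x'"
  shows "(\<Sum>R\<in>Pow (clique_colors col V). (sign_corr R x x')\<^sup>2) \<le> 2 * card V * 2 ^ card (clique_colors col V)"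
proof -
  let ?\<Gamma> = "clique_colors col V"
  let ?t = "\<lambda>R y y'. edge_sign R x y * edge_sign R x' y * (edge_sign R x y' * edge_sign R x' y')"
  have zero: "(\<Sum>R\<in>Pow ?\<Gamma>. ?t R y y') = 0"
    if y: "y \<in> V" "y' \<in> V" "y \<noteq> y'" "y' \<notin> nbr {col {x, y}} x'" for y y'
  proof (cases "y = x \<or> y = x' \<or> y' = x \<or> y' = x'")
    case True
    then show ?thesis
      by (intro sum.neutral) (auto simp: edge_sign_def)
  next
    case False
    let ?d = "col {x, y}"
    have "col {x', y'} \<noteq> ?d"
      using y x False by (auto simp: nbr_def)
    moreover have "col {x, y'} \<noteq> ?d"
      using col_eq_imp_eq[of x y y'] x y False by auto
    moreover have "col {x', y} \<noteq> ?d"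
      using col_eq_imp_eq[of y x x'] x y False by (auto simp: insert_commute)
    ultimately have "?t (insert ?d R) y y' = - ?t R y y'" if "?d \<notin> R" for R
      using that False by (simp add: edge_sign_def)
    moreover have "?d \<in> ?\<Gamma>"
      using x y False by (auto simp: clique_colors_def nsets_def card_insert_if)
    ultimately show ?thesis
      using finite_colors by (intro sum_Pow_flip[of _ ?d]) auto
  qed
  have le: "(\<Sum>R\<in>Pow ?\<Gamma>. ?t R y y') \<le> 2 ^ card ?\<Gamma>" for y y'
  proof -
    have "?t R y y' \<le> 1" for R
    proof -
      have "\<bar>?t R y y'\<bar> \<le> 1 * 1 * (1 * 1)"
        unfolding abs_mult by (intro mult_mono edge_sign_bound) auto
      then show ?thesis by linarith
    qed
    then have "(\<Sum>R\<in>Pow ?\<Gamma>. ?t R y y') \<le> (\<Sum>R\<in>Pow ?\<Gamma>. 1)"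
      by (intro sum_mono)
    then show ?thesis
      using finite_colors by (simp add: card_Pow)
  qed
  have row: "(\<Sum>y'\<in>V. \<Sum>R\<in>Pow ?\<Gamma>. ?t R y y') \<le> 2 * 2 ^ card ?\<Gamma>" if "y \<in> V" for y
  proof -
    let ?B = "insert y (nbr {col {x, y}} x')"
    have "(\<Sum>y'\<in>V. \<Sum>R\<in>Pow ?\<Gamma>. ?t R y y') = (\<Sum>y'\<in>?B. \<Sum>R\<in>Pow ?\<Gamma>. ?t R y y')"
      using that finV nbr_subset by (intro sum.mono_neutral_right ballI zero) auto
    also have "\<dots> \<le> of_nat (card ?B) * 2 ^ card ?\<Gamma>"
      by (intro sum_bounded_above le)
    also have "\<dots> \<le> 2 * 2 ^ card ?\<Gamma>"
    proof -
      have "card ?B \<le> Suc (card (nbr {col {x, y}} x'))"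
        by (rule card_insert_le_m1) auto
      also have "\<dots> \<le> 2"
        using card_nbr_le[of "{col {x, y}}" x'] by simp
      finally show ?thesis
        by (intro mult_right_mono) auto
    qed
    finally show ?thesis .
  qed
  have "(\<Sum>R\<in>Pow ?\<Gamma>. (sign_corr R x x')\<^sup>2) = (\<Sum>R\<in>Pow ?\<Gamma>. \<Sum>y\<in>V. \<Sum>y'\<in>V. ?t R y y')"
    by (simp add: sign_corr_def power2_eq_square sum_product)
  also have "\<dots> = (\<Sum>y\<in>V. \<Sum>y'\<in>V. \<Sum>R\<in>Pow ?\<Gamma>. ?t R y y')"
    by (rule sum_swap3)
  also have "\<dots> \<le> (\<Sum>y\<in>V. 2 * 2 ^ card ?\<Gamma>)"
    by (intro sum_mono row)
  finally show ?thesis by simp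
qed

text \<open>On average over \<open>R\<close>, a diagonal entry costs at most N^2 and an off-diagonal
  one at most 2 N, so the total is N^3 + 2 N^3.\<close>

lemma sum_corr_energy:
  "(\<Sum>R\<in>Pow (clique_colors col V). corr_energy R) \<le> 3 * card V ^ 3 * 2 ^ card (clique_colors col V)"
proof -
  let ?\<Gamma> = "clique_colors col V" and ?N = "real (card V)"
  have diag: "(\<Sum>R\<in>Pow ?\<Gamma>. (sign_corr R x x)\<^sup>2) \<le> ?N ^ 2 * 2 ^ card ?\<Gamma>" for x
  proof -
    have "(sign_corr R x x)\<^sup>2 \<le> ?N ^ 2" for R
    proof -
      have "\<bar>sign_corr R x x\<bar> \<le> (\<Sum>y\<in>V. 1)"
        unfolding sign_corr_def
      proof (rule sum_abs[THEN order.trans], rule sum_mono)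
        fix y
        show "\<bar>edge_sign R x y * edge_sign R x y\<bar> \<le> 1"
          by (simp add: edge_sign_def)
      qed
      then show ?thesis
        by (simp add: abs_le_square_iff [symmetric])
    qed
    then have "(\<Sum>R\<in>Pow ?\<Gamma>. (sign_corr R x x)\<^sup>2) \<le> (\<Sum>R\<in>Pow ?\<Gamma>. ?N ^ 2)"
      by (intro sum_mono)
    then show ?thesis
      using finite_colors by (simp add: card_Pow mult.commute)
  qed
  have row: "(\<Sum>x'\<in>V. \<Sum>R\<in>Pow ?\<Gamma>. (sign_corr R x x')\<^sup>2) \<le> 3 * ?N ^ 2 * 2 ^ card ?\<Gamma>" if x: "x \<in> V" for x
  proof -
    have "(\<Sum>x'\<in>V. \<Sum>R\<in>Pow ?\<Gamma>. (sign_corr R x x')\<^sup>2)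
        = (\<Sum>R\<in>Pow ?\<Gamma>. (sign_corr R x x)\<^sup>2) + (\<Sum>x'\<in>V - {x}. \<Sum>R\<in>Pow ?\<Gamma>. (sign_corr R x x')\<^sup>2)"
      using finV x by (rule sum.remove)
    also have "\<dots> \<le> ?N ^ 2 * 2 ^ card ?\<Gamma> + (\<Sum>x'\<in>V - {x}. 2 * ?N * 2 ^ card ?\<Gamma>)"
      using x by (intro add_mono diag sum_mono) (use sum_sign_corr_sq in auto)
    also have "(\<Sum>x'\<in>V - {x}. 2 * ?N * 2 ^ card ?\<Gamma>) \<le> ?N * (2 * ?N * 2 ^ card ?\<Gamma>)"
      using finV x by (simp add: mult_right_mono)
    finally show ?thesis
      by (simp add: power2_eq_square algebra_simps)
  qed
  have "(\<Sum>R\<in>Pow ?\<Gamma>. corr_energy R) = (\<Sum>x\<in>V. \<Sum>x'\<in>V. \<Sum>R\<in>Pow ?\<Gamma>. (sign_corr R x x')\<^sup>2)"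
    unfolding corr_energy_def by (rule sum_swap3)
  also have "\<dots> \<le> (\<Sum>x\<in>V. 3 * ?N ^ 2 * 2 ^ card ?\<Gamma>)"
    by (intro sum_mono row)
  finally show ?thesis
    by (simp add: power2_eq_square power3_eq_cube algebra_simps)
qed

lemma corr_energy_nonneg: "0 \<le> corr_energy R"
  by (simp add: corr_energy_def sum_nonneg)

lemma prob_corr_energy_large:
  assumes "G > 0"
  shows "subset_prob (clique_colors col V) (\<lambda>R. corr_energy R > G) \<le> 3 * card V ^ 3 / G"
proof -
  let ?\<Gamma> = "clique_colors col V"
  have "G * (\<Sum>R\<in>Pow ?\<Gamma>. of_bool (corr_energy R > G)) \<le> (\<Sum>R\<in>Pow ?\<Gamma>. corr_energy R)"
    unfolding sum_distrib_left by (intro sum_mono) (auto simp: corr_energy_nonneg)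
  also note sum_corr_energy
  finally show ?thesis
    using assms by (simp add: subset_prob_def field_simps)
qed

section \<open>Regular degrees into all large vertex sets\<close>

definition quasirandom :: "real \<Rightarrow> real \<Rightarrow> real \<Rightarrow> 'c set \<Rightarrow> bool" where
  "quasirandom w \<beta> \<tau> R \<longleftrightarrow> (\<forall>X\<subseteq>V. w \<le> real (card X) \<longrightarrow>
     real (card {y \<in> V. \<tau> * real (card X) < \<bar>real (card (nbr R y \<inter> X)) - real (card X) / 2\<bar>}) \<le> \<beta>)"

lemma sum_edge_sign:
  assumes "y \<in> V" "X \<subseteq> V"
  shows "(\<Sum>x\<in>X. edge_sign R x y) = 2 * real (card (nbr R y \<inter> X)) - real (card (X - {y}))"
proof -
  have fX: "finite X" using assms finV finite_subset by blast
  have "(\<Sum>x\<in>X. edge_sign R x y) = (\<Sum>x\<in>X - {y}. edge_sign R x y)"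
    using fX by (intro sum.mono_neutral_right) (auto simp: edge_sign_def)
  also have "\<dots> = (\<Sum>x\<in>X - {y}. 2 * of_bool (x \<in> nbr R y) - 1 :: real)"
    using assms by (intro sum.cong) (auto simp: edge_sign_def nbr_def insert_commute)
  also have "\<dots> = 2 * (\<Sum>x\<in>X - {y}. of_bool (x \<in> nbr R y)) - real (card (X - {y}))"
    by (simp add: sum_subtractf sum_distrib_left)
  also have "(\<Sum>x\<in>X - {y}. of_bool (x \<in> nbr R y)) = real (card ((X - {y}) \<inter> {x. x \<in> nbr R y}))"
    using fX by simp
  also have "(X - {y}) \<inter> {x. x \<in> nbr R y} = nbr R y \<inter> X"
    by (auto simp: nbr_def)
  finally show ?thesis .
qed

text \<open>Exchanging sums turns squared deviations into correlations over
  \<open>X \<times> X\<close>. After Cauchy-Schwarz the set \<open>X\<close> enters only through its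
  size, so one bound on the energy serves all vertex sets.\<close>

lemma sum_edge_sign_sq_le:
  assumes "X \<subseteq> V"
  shows "(\<Sum>y\<in>V. (\<Sum>x\<in>X. edge_sign R x y)\<^sup>2) \<le> card X * sqrt (corr_energy R)"
proof -
  have fX: "finite X" using assms finV finite_subset by blast
  have "(\<Sum>y\<in>V. (\<Sum>x\<in>X. edge_sign R x y)\<^sup>2)
      = (\<Sum>y\<in>V. \<Sum>x\<in>X. \<Sum>x'\<in>X. edge_sign R x y * edge_sign R x' y)"
    by (simp add: power2_eq_square sum_product)
  also have "\<dots> = (\<Sum>x\<in>X. \<Sum>x'\<in>X. sign_corr R x x')"
    unfolding sign_corr_def by (rule sum_swap3)
  also have "\<dots> = (\<Sum>p\<in>X \<times> X. sign_corr R (fst p) (snd p))"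
    by (simp add: sum.cartesian_product case_prod_unfold)
  also have "\<dots> \<le> sqrt (card (X \<times> X) * (\<Sum>p\<in>X \<times> X. (sign_corr R (fst p) (snd p))\<^sup>2))"
    using sum_squared_le_sum_of_squares[of "\<lambda>p. sign_corr R (fst p) (snd p)" "X \<times> X"]
    by (intro real_le_rsqrt) (simp only: mult.commute)
  also have "(\<Sum>p\<in>X \<times> X. (sign_corr R (fst p) (snd p))\<^sup>2) \<le> (\<Sum>p\<in>V \<times> V. (sign_corr R (fst p) (snd p))\<^sup>2)"
    using finV assms by (intro sum_mono2) auto
  also have "\<dots> = corr_energy R"
    by (simp add: corr_energy_def sum.cartesian_product case_prod_unfold)
  also have "sqrt (card (X \<times> X) * corr_energy R) = card X * sqrt (corr_energy R)"
    by (simp add: card_cartesian_product real_sqrt_mult)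
  finally show ?thesis
    by (simp add: mult_left_mono)
qed

text \<open>Chebyshev's argument: every irregular vertex contributes at least
  \<open>(\<tau> * card X)\<^sup>2\<close> to the sum bounded in
  \<open>sum_edge_sign_sq_le\<close>.\<close>

lemma quasirandomI:
  fixes \<tau> \<beta> w :: real
  assumes "corr_energy R \<le> G" "\<tau> > 0" "1 \<le> \<tau> * w" "sqrt G \<le> \<beta> * \<tau>\<^sup>2 * w"
  shows "quasirandom w \<beta> \<tau> R"
  unfolding quasirandom_def
proof (intro allI impI)
  fix X assume X: "X \<subseteq> V" "w \<le> real (card X)"
  let ?B = "{y \<in> V. \<tau> * real (card X) < \<bar>real (card (nbr R y \<inter> X)) - real (card X) / 2\<bar>}"
  have fX: "finite X" using X finV finite_subset by blast
  have w: "w > 0" using assms(2,3) by (smt (verit) mult_nonneg_nonpos)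
  have X0: "0 < real (card X)" using X w by linarith
  have \<tau>X: "1 \<le> \<tau> * card X"
    using assms X by (smt (verit) mult_left_mono)
  \<comment> \<open>Twice the deviation exceeds \<open>2 * \<tau> * card X\<close>. If
    \<open>y\<close> lies in \<open>X\<close> its own sign is 0, an error of 1, which
    \<open>1 \<le> \<tau> * w\<close> allows to be absorbed by half of that.\<close>
  have bad: "(\<tau> * card X)\<^sup>2 \<le> (\<Sum>x\<in>X. edge_sign R x y)\<^sup>2" if y: "y \<in> ?B" for y
  proof -
    have "card X - 1 \<le> card (X - {y})"
      using fX by (simp add: card_Diff_singleton_if)
    then have "card X - 1 \<le> real (card (X - {y}))" by linarith
    moreover have "card (X - {y}) \<le> card X"
      using fX by (intro card_mono) auto
    ultimately have "\<tau> * card X \<le> \<bar>\<Sum>x\<in>X. edge_sign R x y\<bar>"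
      using y X \<tau>X sum_edge_sign[of y X R] by auto
    then show ?thesis
      using \<tau>X by (simp add: abs_le_square_iff [symmetric])
  qed
  have "card ?B * (\<tau> * card X)\<^sup>2 = (\<Sum>y\<in>?B. (\<tau> * card X)\<^sup>2)"
    by simp
  also have "\<dots> \<le> (\<Sum>y\<in>?B. (\<Sum>x\<in>X. edge_sign R x y)\<^sup>2)"
    by (intro sum_mono bad)
  also have "\<dots> \<le> (\<Sum>y\<in>V. (\<Sum>x\<in>X. edge_sign R x y)\<^sup>2)"
    using finV by (intro sum_mono2) auto
  also have "\<dots> \<le> card X * sqrt (corr_energy R)"
    by (rule sum_edge_sign_sq_le[OF X(1)])
  also have "\<dots> \<le> card X * (\<beta> * \<tau>\<^sup>2 * w)"
    using assms by (intro mult_left_mono) (auto intro: order.trans[OF real_sqrt_le_mono])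
  finally have "(card ?B * \<tau>\<^sup>2 * card X) * card X \<le> (\<beta> * \<tau>\<^sup>2 * w) * card X"
    by (simp add: power2_eq_square algebra_simps)
  then have 1: "card ?B * \<tau>\<^sup>2 * card X \<le> \<beta> * \<tau>\<^sup>2 * w"
    by (rule mult_right_le_imp_le) (rule X0)
  have "card ?B * \<tau>\<^sup>2 * w \<le> card ?B * \<tau>\<^sup>2 * card X"
    using X by (intro mult_left_mono) auto
  with 1 have "card ?B * (\<tau>\<^sup>2 * w) \<le> \<beta> * (\<tau>\<^sup>2 * w)"
    by (simp add: algebra_simps)
  then show "card ?B \<le> \<beta>"
    using w assms(2) by (simp add: mult_le_cancel_right)
qed

end

section \<open>Cliques meeting a given color set\<close>

context colored_graph
begin

definition common_nbr :: "'c set \<Rightarrow> 'v set \<Rightarrow> 'v set" where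
  "common_nbr R Q = {x \<in> V. Q \<subseteq> nbr R x}"

lemma common_nbr_insert: "common_nbr R (insert q Q) = common_nbr R Q \<inter> nbr R q"
  using nbr_subset nbr_sym[of _ R q] by (auto simp: common_nbr_def)

lemma common_nbr_empty: "common_nbr R {} = V"
  by (simp add: common_nbr_def)

lemma common_nbr_subset: "common_nbr R Q \<subseteq> V"
  by (auto simp: common_nbr_def)

definition irregular :: "real \<Rightarrow> 'c set \<Rightarrow> 'v set \<Rightarrow> 'v set" where
  "irregular \<tau> R X = {y \<in> V. \<tau> * real (card X) < \<bar>real (card (nbr R y \<inter> X)) - real (card X) / 2\<bar>}"

lemma not_irregularD:
  assumes "y \<in> V" "y \<notin> irregular \<tau> R X"
  shows "(1/2 - \<tau>) * card X \<le> card (X \<inter> nbr R y)" "card (X \<inter> nbr R y) \<le> (1/2 + \<tau>) * card X"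
  using assms by (auto simp: irregular_def Int_commute algebra_simps abs_le_iff not_less)

lemma card_irregular:
  assumes "quasirandom w \<beta> \<tau> R" "X \<subseteq> V" "w \<le> real (card X)"
  shows "real (card (irregular \<tau> R X)) \<le> \<beta>"
  using assms by (simp add: irregular_def quasirandom_def)

lemma finite_irregular: "finite (irregular \<tau> R X)"
  using finV by (simp add: irregular_def)

lemma finite_forb: "finite (forb T)"
  using finV by (simp add: forb_def)

lemma not_forbD:
  assumes "y \<in> V" "y \<notin> forb T"
  shows "y \<notin> T" "inj_on col (nsets (insert y T) 2)"
  using assms by (auto simp: forb_def)

text \<open>\<open>Q\<close> is built vertex by vertex. The common neighborhood and its part in each
  \<open>Z y\<close> shrink at nearly the same rate, so the relative density \<open>p\<close> of
  that part survives up to a factor 2, and averaging finds a next vertex accepted by many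
  \<open>y\<close>. In the application \<open>Z y\<close> is \<open>nbr U y\<close>.\<close>

lemma clique_with_many_common_points:
  fixes \<tau> \<beta> w p :: real
  assumes q: "quasirandom w \<beta> \<tau> R" and \<tau>: "0 \<le> \<tau>" "\<tau> < 1/2"
    and Y0: "Y0 \<subseteq> V" "Y0 \<noteq> {}" and Z: "\<And>y. y \<in> Y0 \<Longrightarrow> Z y \<subseteq> V" "\<And>y. y \<in> Y0 \<Longrightarrow> p * card V \<le> card (Z y)"
    and p: "0 < p"
    and big: "w \<le> (1/2 - \<tau>) ^ s * p * card V" "4 * (2 * \<beta> + real s + real s ^ 3) \<le> (1/2 - \<tau>) ^ s * p * card V"
    and ratio: "(1/2 + \<tau>) ^ s \<le> 2 * (1/2 - \<tau>) ^ s"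
    and "n \<le> s"
  shows "\<exists>Q Y. Q \<subseteq> V \<and> card Q = n \<and> inj_on col (nsets Q 2) \<and> clique_colors col Q \<subseteq> R
    \<and> Y \<subseteq> Y0 \<and> (\<forall>y\<in>Y. Q \<subseteq> Z y) \<and> card Y0 * (p / 4) ^ n \<le> card Y
    \<and> card (common_nbr R Q) \<le> (1/2 + \<tau>) ^ n * card V
    \<and> (\<forall>y\<in>Y. (1/2 - \<tau>) ^ n * p * card V \<le> card (Z y \<inter> common_nbr R Q))"
  using \<open>n \<le> s\<close>
proof (induction n)
  case 0
  show ?case
    using Y0 Z
    by (intro exI[of _ "{}"] exI[of _ Y0])
      (auto simp: common_nbr_empty clique_colors_def nsets_2_eq Int_absorb2)
next
  case (Suc n)
  define lo hi N where "lo = 1/2 - \<tau>" and "hi = 1/2 + \<tau>" and "N = real (card V)"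
  have lo: "0 < lo" "lo \<le> 1" "lo \<le> hi" using \<tau> by (auto simp: lo_def hi_def)
  obtain Q Y where Q: "Q \<subseteq> V" "card Q = n" "inj_on col (nsets Q 2)" "clique_colors col Q \<subseteq> R"
    and Y: "Y \<subseteq> Y0" "\<And>y. y \<in> Y \<Longrightarrow> Q \<subseteq> Z y" "card Y0 * (p / 4) ^ n \<le> card Y"
    and X: "card (common_nbr R Q) \<le> hi ^ n * N"
    and ZX: "\<And>y. y \<in> Y \<Longrightarrow> lo ^ n * p * N \<le> card (Z y \<inter> common_nbr R Q)"
    using Suc unfolding lo_def hi_def N_def by auto
  define X' where "X' = common_nbr R Q"
  have fin: "finite Y" "finite X'" "X' \<subseteq> V" "finite Q"
    using finite_subset[OF _ finV] Y(1) Y0(1) Q(1) common_nbr_subset[of R Q] unfolding X'_def by auto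
  have "0 < card Y0" using Y0 finite_subset[OF Y0(1) finV] by (simp add: card_gt_0_iff)
  then have "0 < card Y0 * (p / 4) ^ n" using p by simp
  then have "0 < card Y" using Y(3) by linarith
  then obtain y0 where y0: "y0 \<in> Y" by fastforce
  have "lo ^ s \<le> lo ^ n"
    using lo Suc.prems by (intro power_decreasing) auto
  then have "lo ^ s * (p * N) \<le> lo ^ n * (p * N)"
    using p by (intro mult_right_mono) (auto simp: N_def)
  then have big': "w \<le> lo ^ n * p * N" "4 * (2 * \<beta> + real s + real s ^ 3) \<le> lo ^ n * p * N"
    using big unfolding lo_def N_def by (auto simp: algebra_simps)
  have X'ge: "lo ^ n * p * N \<le> card X'"
    using ZX[OF y0] card_mono[of X' "Z y0 \<inter> X'"] fin unfolding X'_def by auto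
  then have irrX: "card (irregular \<tau> R X') \<le> \<beta>"
    using big' fin by (intro card_irregular[OF q]) auto
  have "0 < card V" using Y0 finV by (auto simp: card_gt_0_iff)
  then have A0: "0 < lo ^ n * p * N"
    using lo p by (simp add: N_def)
  \<comment> \<open>Admissible next vertices for \<open>y\<close>: they split both the common
    neighborhood and its part in \<open>Z y\<close> nearly in half, and they keep \<open>Q\<close>
    rainbow. The excluded vertices make up at most half of \<open>Z y \<inter> X'\<close>.\<close>
  define G where "G y = (Z y \<inter> X') - irregular \<tau> R X' - irregular \<tau> R (Z y \<inter> X') - forb Q" for y
  have G: "lo ^ n * p * N / 2 \<le> card (G y)" if y: "y \<in> Y" for y
  proof -
    have irr: "card (irregular \<tau> R (Z y \<inter> X')) \<le> \<beta>"
      using big' ZX[OF y] fin unfolding X'_def by (intro card_irregular[OF q]) auto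
    have "card (forb Q) \<le> s + s ^ 3"
      using Q Suc.prems by (intro card_forb_le) auto
    then have fb: "real (card (forb Q)) \<le> real s + real s ^ 3"
      by (metis of_nat_add of_nat_le_iff of_nat_power)
    have "card (Z y \<inter> X') \<le> card (G y \<union> irregular \<tau> R X' \<union> irregular \<tau> R (Z y \<inter> X') \<union> forb Q)"
      using fin finite_irregular finite_forb by (intro card_mono) (auto simp: G_def)
    also have "\<dots> \<le> card (G y) + card (irregular \<tau> R X') + card (irregular \<tau> R (Z y \<inter> X')) + card (forb Q)"
      by (intro order.trans[OF card_Un_le] add_mono order.refl)
    finally have "real (card (Z y \<inter> X')) \<le> card (G y) + \<beta> + \<beta> + (real s + real s ^ 3)"
      using irrX irr fb by linarith
    moreover have "A / 2 \<le> g" if "z \<le> g + \<beta> + \<beta> + (a + b)" "A \<le> z"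
      "4 * (2 * \<beta> + a + b) \<le> A" "0 < A" for A z g a b :: real
      using that by (simp add: field_simps)
    ultimately show ?thesis
      using ZX[OF y] big'(2) A0 unfolding X'_def by blast
  qed
  have X0: "0 < card X'"
    using A0 X'ge by linarith
  \<comment> \<open>Each \<open>G y\<close> has at least \<open>lo ^ n * p * N / 2\<close> elements
    inside the set \<open>X'\<close> of size at most \<open>2 * lo ^ n * N\<close>; the quotient is
    \<open>p / 4\<close>.\<close>
  have "\<exists>q\<in>X'. card Y * (p / 4) \<le> card {y \<in> Y. q \<in> G y}"
  proof (rule ccontr)
    assume "\<not> ?thesis"
    then have "(\<Sum>q\<in>X'. real (card {y \<in> Y. q \<in> G y})) < card X' * (card Y * (p / 4))"
      using X0 by (intro sum_bounded_above_strict) (simp_all add: not_le)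
    also have "\<dots> \<le> (hi ^ n * N) * (card Y * (p / 4))"
      using X p unfolding X'_def by (intro mult_right_mono) auto
    also have "\<dots> \<le> (2 * lo ^ n * N) * (card Y * (p / 4))"
    proof -
      \<comment> \<open>The ratio of the powers of \<open>hi\<close> and \<open>lo\<close> grows
        with the exponent, so the bound at exponent \<open>s\<close> yields the one at
        \<open>n\<close>.\<close>
      have "hi ^ n * lo ^ (s - n) \<le> hi ^ n * hi ^ (s - n)"
        using lo by (intro mult_left_mono power_mono) auto
      also have "\<dots> = hi ^ s" using Suc.prems by (simp add: power_add [symmetric])
      also have "\<dots> \<le> 2 * lo ^ s" using ratio unfolding hi_def lo_def .
      also have "\<dots> = (2 * lo ^ n) * lo ^ (s - n)" using Suc.prems by (simp add: power_add [symmetric])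
      finally have "hi ^ n \<le> 2 * lo ^ n"
        using lo by (simp add: mult_le_cancel_right)
      then show ?thesis
        using p by (intro mult_right_mono) (auto simp: N_def)
    qed
    also have "\<dots> = (\<Sum>y\<in>Y. lo ^ n * p * N / 2)"
      by simp
    also have "\<dots> \<le> (\<Sum>y\<in>Y. real (card (G y)))"
      by (intro sum_mono G)
    also have "\<dots> = real (\<Sum>y\<in>Y. card {q \<in> X'. q \<in> G y})"
      unfolding of_nat_sum by (intro sum.cong refl arg_cong[of _ _ "\<lambda>A. real (card A)"]) (auto simp: G_def)
    also have "\<dots> = real (\<Sum>q\<in>X'. card {y \<in> Y. q \<in> G y})"
      by (subst sum_multicount_gen[OF fin(2,1), of "\<lambda>q y. q \<in> G y"]) auto
    finally show False by simp
  qed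
  then obtain v where v: "v \<in> X'" "card Y * (p / 4) \<le> card {y \<in> Y. v \<in> G y}" by blast
  let ?Y = "{y \<in> Y. v \<in> G y}"
  have "0 < card Y * (p / 4)" using \<open>0 < card Y\<close> p by simp
  then have "0 < card ?Y" using v by linarith
  then obtain y1 where "y1 \<in> ?Y" unfolding card_gt_0_iff by blast
  then have v': "v \<in> V" "v \<notin> irregular \<tau> R X'" "v \<notin> forb Q"
    using fin(3) v(1) by (auto simp: G_def)
  have vQ: "v \<notin> Q" "inj_on col (nsets (insert v Q) 2)"
    using not_forbD v' by blast+
  have "Q \<subseteq> nbr R v" using v(1) by (simp add: X'_def common_nbr_def)
  have lo_hi: "lo * card B \<le> card (B \<inter> nbr R v)" "card (B \<inter> nbr R v) \<le> hi * card B"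
    if "v \<notin> irregular \<tau> R B" for B
    using not_irregularD[OF v'(1) that] by (auto simp: lo_def hi_def)
  have "insert v Q \<subseteq> V" using v' Q by simp
  moreover have "card (insert v Q) = Suc n" using vQ fin Q by simp
  moreover note vQ(2)
  moreover have "clique_colors col (insert v Q) \<subseteq> R"
    using Q \<open>Q \<subseteq> nbr R v\<close> by (intro clique_colors_insert_subset)
  moreover have "?Y \<subseteq> Y0" using Y by auto
  moreover have "\<forall>y\<in>?Y. insert v Q \<subseteq> Z y"
    using Y by (auto simp: G_def)
  moreover have "card Y0 * (p / 4) ^ Suc n \<le> card ?Y"
  proof -
    have "card Y0 * (p / 4) ^ Suc n = (card Y0 * (p / 4) ^ n) * (p / 4)" by simp
    also have "\<dots> \<le> card Y * (p / 4)" using Y p by (intro mult_right_mono) auto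
    finally show ?thesis using v by linarith
  qed
  moreover have "card (common_nbr R (insert v Q)) \<le> hi ^ Suc n * N"
  proof -
    have "real (card (common_nbr R (insert v Q))) \<le> hi * card X'"
      using lo_hi(2)[OF v'(2)] by (simp add: common_nbr_insert X'_def)
    also have "\<dots> \<le> hi * (hi ^ n * N)"
      using X lo unfolding X'_def by (intro mult_left_mono) auto
    finally show ?thesis by simp
  qed
  moreover have "\<forall>y\<in>?Y. lo ^ Suc n * p * N \<le> card (Z y \<inter> common_nbr R (insert v Q))"
  proof
    fix y assume y: "y \<in> ?Y"
    have "lo ^ Suc n * p * N = lo * (lo ^ n * p * N)" by simp
    also have "\<dots> \<le> lo * card (Z y \<inter> X')"
      using ZX y lo unfolding X'_def by (intro mult_left_mono) auto
    also have "\<dots> \<le> card (Z y \<inter> X' \<inter> nbr R v)"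
      using y by (intro lo_hi(1)) (auto simp: G_def)
    finally show "lo ^ Suc n * p * N \<le> card (Z y \<inter> common_nbr R (insert v Q))"
      by (simp add: common_nbr_insert X'_def Int_assoc)
  qed
  ultimately show ?case
    unfolding lo_def hi_def N_def by (intro exI[of _ "insert v Q"] exI[of _ ?Y] conjI)
qed

text \<open>The same greedy choice with a single set to follow: a vertex that is neither irregular
  nor forbidden keeps a proportion \<open>1/2 - \<tau>\<close> of the current part of
  \<open>W\<close>. Adjacency to \<open>Q\<close> is automatic inside
  \<open>common_nbr R Q\<close>.\<close>

lemma extend_clique_inside:
  fixes \<tau> \<beta> w :: real
  assumes q: "quasirandom w \<beta> \<tau> R" and \<tau>: "0 \<le> \<tau>" "\<tau> < 1/2"
    and Q: "Q \<subseteq> V" "inj_on col (nsets Q 2)" "clique_colors col Q \<subseteq> R"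
    and W: "W \<subseteq> common_nbr R Q"
    and big: "w \<le> (1/2 - \<tau>) ^ m * card W"
      "\<beta> + real (card Q + m) + real (card Q + m) ^ 3 < (1/2 - \<tau>) ^ m * card W"
    and "n \<le> m"
  shows "\<exists>T\<subseteq>W. card T = n \<and> T \<inter> Q = {} \<and> inj_on col (nsets (Q \<union> T) 2) \<and> clique_colors col (Q \<union> T) \<subseteq> R
    \<and> (1/2 - \<tau>) ^ n * card W \<le> card (W \<inter> common_nbr R T)"
  using \<open>n \<le> m\<close>
proof (induction n)
  case 0
  have "W \<inter> common_nbr R {} = W"
    using W common_nbr_subset by (auto simp: common_nbr_empty)
  then show ?case
    using Q by (intro exI[of _ "{}"]) auto
next
  case (Suc n)
  define lo where "lo = 1/2 - \<tau>"
  have lo: "0 < lo" "lo \<le> 1" using \<tau> by (auto simp: lo_def)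
  obtain T where T: "T \<subseteq> W" "card T = n" "T \<inter> Q = {}" "inj_on col (nsets (Q \<union> T) 2)"
    "clique_colors col (Q \<union> T) \<subseteq> R" "lo ^ n * card W \<le> card (W \<inter> common_nbr R T)"
    using Suc unfolding lo_def by auto
  define X where "X = W \<inter> common_nbr R T"
  have XV: "X \<subseteq> V" "finite X" "W \<subseteq> V"
    using finite_subset[OF _ finV] common_nbr_subset[of R Q] W unfolding X_def by auto
  have "lo ^ m \<le> lo ^ n"
    using lo Suc.prems by (intro power_decreasing) auto
  then have "lo ^ m * card W \<le> lo ^ n * card W"
    by (intro mult_right_mono) auto
  then have big': "w \<le> card X" "\<beta> + real (card Q + m) + real (card Q + m) ^ 3 < card X"
    using big T(6) unfolding X_def lo_def by linarith+
  have irr: "card (irregular \<tau> R X) \<le> \<beta>"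
    using XV big' by (intro card_irregular[OF q]) auto
  have fT: "finite T" "finite Q"
    using finite_subset[OF _ finV] T(1) XV(3) Q(1) by auto
  have "card (forb (Q \<union> T)) \<le> (card Q + m) + (card Q + m) ^ 3"
    using T Q XV Suc.prems fT by (intro card_forb_le) (auto simp: card_Un_disjoint Int_commute)
  then have "real (card (forb (Q \<union> T))) \<le> real (card Q + m) + real (card Q + m) ^ 3"
    by (metis of_nat_add of_nat_le_iff of_nat_power)
  then have "real (card (irregular \<tau> R X) + card (forb (Q \<union> T))) < card X"
    using irr big' by simp
  then have "card (irregular \<tau> R X) + card (forb (Q \<union> T)) < card X"
    by linarith
  moreover have "card (irregular \<tau> R X \<union> forb (Q \<union> T)) \<le> card (irregular \<tau> R X) + card (forb (Q \<union> T))"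
    by (rule card_Un_le)
  ultimately have "\<not> X \<subseteq> irregular \<tau> R X \<union> forb (Q \<union> T)"
    using card_mono[of "irregular \<tau> R X \<union> forb (Q \<union> T)" X] finite_irregular finite_forb by force
  then obtain t where t: "t \<in> X" "t \<notin> irregular \<tau> R X" "t \<notin> forb (Q \<union> T)" by blast
  then have tV: "t \<in> V" using XV by auto
  have t': "t \<notin> Q \<union> T" "inj_on col (nsets (insert t (Q \<union> T)) 2)"
    using not_forbD[OF tV t(3)] by auto
  have "Q \<union> T \<subseteq> nbr R t"
    using t(1) W by (auto simp: X_def common_nbr_def)
  then have "clique_colors col (insert t (Q \<union> T)) \<subseteq> R"
    using T by (intro clique_colors_insert_subset)
  moreover have "lo ^ Suc n * card W \<le> card (W \<inter> common_nbr R (insert t T))"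
  proof -
    have "lo ^ Suc n * card W = lo * (lo ^ n * card W)" by simp
    also have "\<dots> \<le> lo * card X"
      using T lo unfolding X_def by (intro mult_left_mono) auto
    also have "\<dots> \<le> card (X \<inter> nbr R t)"
      using not_irregularD(1)[OF tV t(2)] by (simp add: lo_def)
    finally show ?thesis by (simp add: X_def common_nbr_insert Int_assoc)
  qed
  moreover have "insert t T \<subseteq> W" "card (insert t T) = Suc n" "insert t T \<inter> Q = {}"
    using t(1) t' T fT by (auto simp: X_def)
  ultimately show ?case
    using t' unfolding lo_def by (intro exI[of _ "insert t T"]) auto
qed

text \<open>Double counting of the edges colored from \<open>U\<close>. Forgetting the order of the
  endpoints gives away a factor 2, which is affordable.\<close>

lemma sum_card_nbr_ge:
  assumes U: "U \<subseteq> clique_colors col V"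
    and classes: "\<And>c. c \<in> clique_colors col V \<Longrightarrow> card V / 4 \<le> card {e \<in> nsets V 2. col e = c}"
  shows "card U * (card V / 4) \<le> (\<Sum>y\<in>V. real (card (nbr U y)))"
proof -
  have fU: "finite U" using U finite_colors finite_subset by blast
  have fe: "finite (nsets V 2)" using finV by (simp add: finite_imp_finite_nsets)
  have "card U * (card V / 4) = (\<Sum>c\<in>U. card V / 4)" by simp
  also have "\<dots> \<le> (\<Sum>c\<in>U. real (card {e \<in> nsets V 2. col e = c}))"
    using U classes by (intro sum_mono) auto
  also have "\<dots> = card (\<Union>c\<in>U. {e \<in> nsets V 2. col e = c})"
    using fU fe by (subst card_UN_disjoint) auto
  also have "\<dots> \<le> card ((\<lambda>(x, y). {x, y}) ` (SIGMA y:V. nbr U y))"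
  proof -
    have "(\<Union>c\<in>U. {e \<in> nsets V 2. col e = c}) \<subseteq> (\<lambda>(x, y). {x, y}) ` (SIGMA y:V. nbr U y)"
      by (force simp: nsets_2_eq nbr_def)
    then show ?thesis
      using finV finite_nbr by (intro of_nat_mono card_mono finite_imageI finite_SigmaI) auto
  qed
  also have "\<dots> \<le> card (SIGMA y:V. nbr U y)"
    using finV finite_nbr by (intro of_nat_mono card_image_le finite_SigmaI) auto
  also have "\<dots> = (\<Sum>y\<in>V. real (card (nbr U y)))"
    using finV finite_nbr by (subst card_SigmaI) auto
  finally show ?thesis .
qed

text \<open>\<open>T\<close> is chosen among common \<open>U\<close>-neighbors of \<open>Q\<close>.
  All \<open>s * m\<close> edges between the two parts then have colors in \<open>U\<close>, and
  these are distinct because the union is rainbow.\<close>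

lemma clique_meeting_color_set:
  fixes \<tau> \<beta> w p :: real
  assumes q: "quasirandom w \<beta> \<tau> R" and \<tau>: "0 \<le> \<tau>" "\<tau> < 1/2"
    and U: "U \<subseteq> R" "U \<subseteq> clique_colors col V" "p * card V \<le> card U" and p: "0 < p" and V: "V \<noteq> {}"
    and classes: "\<And>c. c \<in> clique_colors col V \<Longrightarrow> card V / 4 \<le> card {e \<in> nsets V 2. col e = c}"
    and big: "w \<le> (1/2 - \<tau>) ^ s * (p / 8) * card V"
      "4 * (2 * \<beta> + real s + real s ^ 3) \<le> (1/2 - \<tau>) ^ s * (p / 8) * card V"
    and ratio: "(1/2 + \<tau>) ^ s \<le> 2 * (1/2 - \<tau>) ^ s"
    and big': "w \<le> (1/2 - \<tau>) ^ m * (p / 8 * card V * (p / 32) ^ s)"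
      "\<beta> + real (s + m) + real (s + m) ^ 3 < (1/2 - \<tau>) ^ m * (p / 8 * card V * (p / 32) ^ s)"
  shows "\<exists>S\<subseteq>V. card S = s + m \<and> inj_on col (nsets S 2) \<and> clique_colors col S \<subseteq> R
    \<and> s * m \<le> card (clique_colors col S \<inter> U)"
proof -
  define N where "N = real (card V)"
  have N: "0 < N" using V finV by (simp add: N_def card_gt_0_iff)
  \<comment> \<open>The average degree in \<open>U\<close> is at least \<open>p * N / 4\<close>.
    Vertices below half of that account for at most half of the degree sum, which leaves many above
    it.\<close>
  define Y0 where "Y0 = {y \<in> V. p / 8 * N \<le> card (nbr U y)}"
  have fU: "finite U" using U finite_colors finite_subset by blast
  have Y0: "p / 8 * N \<le> card Y0"
  proof -
    have "(p * N) * (N / 4) \<le> card U * (N / 4)"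
      using U N by (intro mult_right_mono) (auto simp: N_def)
    also have "\<dots> \<le> (\<Sum>y\<in>V. real (card (nbr U y)))"
      using sum_card_nbr_ge[OF U(2) classes] by (simp add: N_def)
    also have "\<dots> = (\<Sum>y\<in>Y0. real (card (nbr U y))) + (\<Sum>y\<in>V - Y0. real (card (nbr U y)))"
      using finV by (subst add.commute, intro sum.subset_diff) (auto simp: Y0_def)
    also have "(\<Sum>y\<in>Y0. real (card (nbr U y))) \<le> card Y0 * N"
      using finV nbr_subset by (intro sum_bounded_above) (auto simp: N_def card_mono)
    also have "(\<Sum>y\<in>V - Y0. real (card (nbr U y))) \<le> card (V - Y0) * (p / 8 * N)"
      by (intro sum_bounded_above) (auto simp: Y0_def)
    also have "\<dots> \<le> N * (p / 8 * N)"
      using p N finV by (intro mult_right_mono) (auto simp: N_def intro!: card_mono)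
    finally have "p / 8 * N * N \<le> card Y0 * N"
      by (simp add: algebra_simps)
    then show ?thesis using N by simp
  qed
  have "0 < p / 8 * N" using p N by simp
  then have "0 < card Y0" using Y0 by linarith
  then have Y0ne: "Y0 \<noteq> {}" by auto
  \<comment> \<open>The density here is \<open>p / 8\<close>, so each vertex of \<open>Q\<close>
    keeps a proportion \<open>p / 32\<close> of the candidates.\<close>
  obtain Q Y where Q: "Q \<subseteq> V" "card Q = s" "inj_on col (nsets Q 2)" "clique_colors col Q \<subseteq> R"
    and Y: "Y \<subseteq> Y0" "\<forall>y\<in>Y. Q \<subseteq> nbr U y" "card Y0 * (p / 8 / 4) ^ s \<le> card Y"
    using clique_with_many_common_points[OF q \<tau>, of Y0 "nbr U" "p / 8" s s] Y0ne nbr_subset p big ratio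
    by (auto simp: Y0_def N_def)
  have WQ: "Y \<subseteq> common_nbr R Q"
    using Y nbr_mono[OF U(1)] by (fastforce simp: common_nbr_def Y0_def)
  have "p / 8 * N * (p / 32) ^ s \<le> card Y0 * (p / 32) ^ s"
    using Y0 p by (intro mult_right_mono) auto
  also have "\<dots> \<le> card Y" using Y(3) by simp
  finally have "(1/2 - \<tau>) ^ m * (p / 8 * N * (p / 32) ^ s) \<le> (1/2 - \<tau>) ^ m * card Y"
    using \<tau> by (intro mult_left_mono) auto
  then have "w \<le> (1/2 - \<tau>) ^ m * card Y" "\<beta> + real (s + m) + real (s + m) ^ 3 < (1/2 - \<tau>) ^ m * card Y"
    using big' unfolding N_def by linarith+
  then obtain T where T: "T \<subseteq> Y" "card T = m" "T \<inter> Q = {}" "inj_on col (nsets (Q \<union> T) 2)"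
    "clique_colors col (Q \<union> T) \<subseteq> R"
    using extend_clique_inside[OF q \<tau> Q(1,3,4) WQ, of m m] Q(2) by auto
  have TV: "T \<subseteq> V" using T Y by (auto simp: Y0_def)
  have fin: "finite Q" "finite T" using Q TV finV finite_subset by blast+
  have "inj_on (\<lambda>(x, y). col {x, y}) (Q \<times> T)"
  proof (rule inj_onI, clarify)
    fix x y x' y' assume "x \<in> Q" "y \<in> T" "x' \<in> Q" "y' \<in> T" "col {x, y} = col {x', y'}"
    moreover from this have "{x, y} \<in> nsets (Q \<union> T) 2" "{x', y'} \<in> nsets (Q \<union> T) 2"
      using T(3) by auto
    ultimately have "{x, y} = {x', y'}"
      using T(4) by (auto dest: inj_onD)
    then show "x = x' \<and> y = y'"
      using T(3) \<open>x \<in> Q\<close> \<open>y \<in> T\<close> \<open>x' \<in> Q\<close> \<open>y' \<in> T\<close> by (auto simp: doubleton_eq_iff)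
  qed
  moreover have "(\<lambda>(x, y). col {x, y}) ` (Q \<times> T) \<subseteq> clique_colors col (Q \<union> T) \<inter> U"
  proof clarify
    fix x y assume xy: "x \<in> Q" "y \<in> T"
    then have "x \<in> nbr U y" using Y T by auto
    then show "col {x, y} \<in> clique_colors col (Q \<union> T) \<inter> U"
      using xy T(3) by (auto simp: nbr_def clique_colors_def insert_commute)
  qed
  moreover have "finite (clique_colors col (Q \<union> T) \<inter> U)" using fU by simp
  ultimately have "card (Q \<times> T) \<le> card (clique_colors col (Q \<union> T) \<inter> U)"
    by (intro card_inj_on_le)
  then have "s * m \<le> card (clique_colors col (Q \<union> T) \<inter> U)"
    using Q T by (simp add: card_cartesian_product)
  moreover have "card (Q \<union> T) = s + m"
    using Q T fin by (simp add: card_Un_disjoint Int_commute)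
  ultimately show ?thesis
    using T Q TV by (intro exI[of _ "Q \<union> T"]) auto
qed

end

section \<open>Extending small cliques\<close>

text \<open>Each edge introduces its own second component, so these are distinct.\<close>

lemma forest_length_le:
  assumes "forest es" "snd ` set es \<subseteq> A" "finite A"
  shows "length es \<le> card A"
proof -
  have "distinct (map snd es)"
    using assms(1) by (induction es rule: forest.induct) auto
  then have "length es = card (snd ` set es)"
    by (metis distinct_card length_map list.set_map)
  then show ?thesis
    using card_mono[OF assms(3,2)] by simp
qed

lemma sum_powers_le:
  fixes \<zeta> :: real
  assumes "0 \<le> \<zeta>" "\<zeta> \<le> 1/2"
  shows "(\<Sum>l=1..z. \<zeta> ^ l) \<le> 2 * \<zeta>"
proof -
  have "(\<Sum>l=1..z. \<zeta> ^ l) \<le> 2 * \<zeta> * (1 - (1/2) ^ z)"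
  proof (induction z)
    case (Suc z)
    have "\<zeta> ^ Suc z \<le> \<zeta> * (1/2) ^ z"
      using assms by (simp add: mult_left_mono power_mono)
    then show ?case using Suc by (simp add: algebra_simps)
  qed simp
  also have "\<dots> \<le> 2 * \<zeta> * 1"
    using assms by (intro mult_left_mono) auto
  finally show ?thesis by simp
qed

section \<open>Rainbow extensions and the color overlap of two of them\<close>

context colored_graph
begin

text \<open>The added vertices are ordered: extensions become maps on an index set, as
  \<open>card_forest_maps\<close> requires, and can be counted one coordinate at a time.\<close>

definition tuples :: "'v set \<Rightarrow> nat \<Rightarrow> (nat \<Rightarrow> 'v) set" where
  "tuples S z = {v \<in> {..<z} \<rightarrow>\<^sub>E V. \<forall>i<z. v i \<notin> forb (S \<union> v ` {..<i})}"

definition new_colors :: "'v set \<Rightarrow> nat \<Rightarrow> (nat \<Rightarrow> 'v) \<Rightarrow> 'c set" where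
  "new_colors S z v = clique_colors col (S \<union> v ` {..<z}) - clique_colors col S"

lemma finite_tuples: "finite (tuples S z)"
  by (rule finite_subset[OF _ finite_PiE[of "{..<z}" "\<lambda>_. V"]]) (auto simp: tuples_def finV)

lemma tuples_clique:
  assumes S: "S \<subseteq> V" "inj_on col (nsets S 2)" and v: "v \<in> tuples S z" and "j \<le> z"
  shows "S \<union> v ` {..<j} \<subseteq> V" "inj_on col (nsets (S \<union> v ` {..<j}) 2)" "card (S \<union> v ` {..<j}) = card S + j"
proof -
  have "S \<union> v ` {..<j} \<subseteq> V \<and> inj_on col (nsets (S \<union> v ` {..<j}) 2) \<and> card (S \<union> v ` {..<j}) = card S + j"
    using \<open>j \<le> z\<close>
  proof (induction j)
    case 0
    then show ?case using S by simp
  next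
    case (Suc j)
    let ?A = "S \<union> v ` {..<j}"
    have A: "?A \<subseteq> V" "card ?A = card S + j" using Suc by auto
    have vj: "v j \<in> V" "v j \<notin> forb ?A"
      using v Suc.prems by (auto simp: tuples_def)
    have "S \<union> v ` {..<Suc j} = insert (v j) ?A"
      by (auto simp: lessThan_Suc)
    moreover have "finite ?A" using finite_subset[OF A(1) finV] .
    ultimately show ?case
      using A vj not_forbD[OF vj] by simp
  qed
  then show "S \<union> v ` {..<j} \<subseteq> V" "inj_on col (nsets (S \<union> v ` {..<j}) 2)" "card (S \<union> v ` {..<j}) = card S + j"
    by auto
qed

lemma tuples_inj:
  assumes "v \<in> tuples S z"
  shows "inj_on v {..<z}"
proof (rule linorder_inj_onI)
  fix i j assume "i < j" "i \<in> {..<z}" "j \<in> {..<z}"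
  then have "v j \<in> V" "v j \<notin> forb (S \<union> v ` {..<j})"
    using assms by (auto simp: tuples_def)
  then have "v j \<notin> v ` {..<j}" using not_forbD(1) by blast
  then show "v i \<noteq> v j" using \<open>i < j\<close> by (metis imageI lessThan_iff)
qed auto

text \<open>Every coordinate avoids at most \<open>k + k ^ 3\<close> forbidden vertices, since the
  clique built so far has at most \<open>k\<close> vertices.\<close>

lemma card_tuples_ge:
  assumes S: "S \<subseteq> V" "inj_on col (nsets S 2)" and "card S + z \<le> k"
  shows "(card V - (k + k ^ 3)) ^ z \<le> card (tuples S z)"
  using assms(3)
proof (induction z)
  case 0
  have "tuples S 0 = {\<lambda>_. undefined}" by (auto simp: tuples_def)
  then show ?case by simp
next
  case (Suc z)
  let ?F = "k + k ^ 3"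
  let ?P = "SIGMA v:tuples S z. V - forb (S \<union> v ` {..<z})"
  have "(\<lambda>(v, y). v(z := y)) ` ?P \<subseteq> tuples S (Suc z)"
  proof clarify
    fix v y assume v: "v \<in> tuples S z" and y: "y \<in> V" "y \<notin> forb (S \<union> v ` {..<z})"
    have "(v(z := y)) ` {..<i} = v ` {..<i}" if "i \<le> z" for i
      using that by auto
    then show "v(z := y) \<in> tuples S (Suc z)"
      using v y by (auto simp: tuples_def less_Suc_eq PiE_iff extensional_def)
  qed
  then have "card ((\<lambda>(v, y). v(z := y)) ` ?P) \<le> card (tuples S (Suc z))"
    by (rule card_mono[OF finite_tuples])
  moreover have "inj_on (\<lambda>(v, y). v(z := y)) ?P"
  proof (rule inj_onI, clarify)
    fix v y v' y' assume v: "v \<in> tuples S z" "v' \<in> tuples S z" and eq: "v(z := y) = v'(z := y')"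
    have "v z = undefined" "v' z = undefined"
      using v by (auto simp: tuples_def PiE_iff extensional_def)
    then show "v = v' \<and> y = y'"
      using eq by (metis fun_upd_same fun_upd_triv fun_upd_upd)
  qed
  moreover have "card (tuples S z) * (card V - ?F) \<le> card ?P"
  proof -
    have "card V - ?F \<le> card (V - forb (S \<union> v ` {..<z}))" if v: "v \<in> tuples S z" for v
    proof -
      note A = tuples_clique[OF S v order.refl]
      have "card (forb (S \<union> v ` {..<z})) \<le> ?F"
        using A Suc.prems by (intro card_forb_le) auto
      moreover have "card (V - forb (S \<union> v ` {..<z})) = card V - card (forb (S \<union> v ` {..<z}))"
        by (rule card_Diff_subset[OF finite_forb]) (auto simp: forb_def)
      ultimately show ?thesis by simp
    qed
    then have "card (tuples S z) * (card V - ?F) \<le> (\<Sum>v\<in>tuples S z. card (V - forb (S \<union> v ` {..<z})))"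
      using sum_mono[of "tuples S z" "\<lambda>_. card V - ?F"] by simp
    also have "\<dots> = card ?P"
      using finite_tuples finV by (subst card_SigmaI) auto
    finally show ?thesis .
  qed
  moreover have "(card V - ?F) ^ Suc z \<le> card (tuples S z) * (card V - ?F)"
    using Suc by simp
  ultimately show ?case
    unfolding card_image[OF \<open>inj_on (\<lambda>(v, y). v(z := y)) ?P\<close>] by linarith
qed

text \<open>The graph lives on the indices of the tuple and one extra index \<open>z\<close>, a root
  that stands for all of \<open>S\<close>. With r forest edges there are at most (z + 1) r / 2
  repeated colors inside the tuple. The root has at most r neighbors, each responsible for at most
  \<open>card S\<close> repeated colors towards \<open>S\<close>.\<close>

lemma new_colors_overlap:
  fixes C :: "'c set"
  assumes S: "S \<subseteq> V" "inj_on col (nsets S 2)" and w: "w \<in> tuples S z"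
  defines "h \<equiv> \<lambda>u. case u of None \<Rightarrow> (\<Union>t\<in>S. nbr C t) | Some x \<Rightarrow> nbr C x"
  shows "\<exists>es. forest es \<and> set es \<subseteq> {..z} \<times> {..<z} \<and> (\<forall>(a, b)\<in>set es. w b \<in> h (if a = z then None else Some (w a)))
    \<and> 2 * card (new_colors S z w \<inter> C) \<le> (z + 1 + 2 * card S) * length es"
proof -
  define E where "E a b \<longleftrightarrow> a \<noteq> b \<and> (a < z \<and> b < z \<and> col {w a, w b} \<in> C
    \<or> a = z \<and> b < z \<and> w b \<in> h None \<or> b = z \<and> a < z \<and> w a \<in> h None)" for a b :: nat
  have sym: "E x y \<Longrightarrow> E y x" for x y
    by (auto simp: E_def insert_commute)
  have irr: "\<not> E x x" for x by (simp add: E_def)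
  obtain es where es: "forest es" "set es \<subseteq> {(a, b) \<in> {..z} \<times> {..z}. E a b}" "z \<notin> snd ` set es"
    "card {(a, b) \<in> {..z} \<times> {..z}. E a b} \<le> card {..z} * length es"
    "card {b \<in> {..z}. E z b} \<le> length es"
    using spanning_forest[of "{..z}" E z, OF _ sym irr] by auto
  have inj: "inj_on w {..<z}" using tuples_inj w by blast
  have wV: "w i \<in> V" if "i < z" for i
    using w that by (auto simp: tuples_def)
  have sub: "set es \<subseteq> {..z} \<times> {..<z}"
  proof
    fix e assume e: "e \<in> set es"
    then have "snd e \<noteq> z" using es(3) by auto
    then show "e \<in> {..z} \<times> {..<z}" using e es(2) by auto
  qed
  have sat: "w b \<in> h (if a = z then None else Some (w a))" if "(a, b) \<in> set es" for a b
  proof -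
    have ab: "E a b" "b < z" using that es(2) sub by auto
    show ?thesis
    proof (cases "a = z")
      case True
      then show ?thesis using ab by (auto simp: E_def)
    next
      case False
      then have "a < z" "a \<noteq> b" "col {w a, w b} \<in> C" using ab by (auto simp: E_def)
      moreover from this have "w a \<noteq> w b" using inj ab by (auto dest: inj_onD)
      ultimately show ?thesis
        using False ab wV by (auto simp: h_def nbr_def)
    qed
  qed
  let ?P = "{(a, b). a < b \<and> b < z \<and> col {w a, w b} \<in> C}"
  let ?T = "{b. b < z \<and> w b \<in> h None}"
  have finP: "finite ?P" by (rule finite_subset[of _ "{..z} \<times> {..z}"]) auto
  have finS: "finite S" using finite_subset[OF S(1) finV] .
  have "new_colors S z w \<inter> C \<subseteq> (\<lambda>(a, b). col {w a, w b}) ` ?P \<union> (\<lambda>(b, t). col {w b, t}) ` (?T \<times> S)"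
  proof
    fix c assume c: "c \<in> new_colors S z w \<inter> C"
    then obtain e where "e \<in> nsets (S \<union> w ` {..<z}) 2" "c = col e"
      unfolding new_colors_def clique_colors_def by blast
    then obtain x y where xy: "x \<in> S \<union> w ` {..<z}" "y \<in> S \<union> w ` {..<z}" "x \<noteq> y" "c = col {x, y}"
      by (metis nsets2_E)
    have mixed: "c \<in> (\<lambda>(b, t). col {w b, t}) ` (?T \<times> S)"
      if "t \<in> S" "b < z" "t \<noteq> w b" "c = col {w b, t}" for b t
    proof -
      have "w b \<in> nbr C t" using that c S wV by (auto simp: nbr_def insert_commute)
      then have "w b \<in> h None" using that by (auto simp: h_def)
      then show ?thesis using that by (intro image_eqI[of _ _ "(b, t)"]) auto
    qed
    show "c \<in> (\<lambda>(a, b). col {w a, w b}) ` ?P \<union> (\<lambda>(b, t). col {w b, t}) ` (?T \<times> S)"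
    proof (cases "x \<in> S"; cases "y \<in> S")
      assume "x \<in> S" "y \<in> S"
      then have "c \<in> clique_colors col S"
        using xy by (auto simp: clique_colors_def)
      then show ?thesis using c by (simp add: new_colors_def)
    next
      assume "x \<in> S" "y \<notin> S"
      then obtain b where "y = w b" "b < z" using xy by auto
      then show ?thesis using mixed[of x b] \<open>x \<in> S\<close> xy by (simp add: insert_commute)
    next
      assume "x \<notin> S" "y \<in> S"
      then obtain b where "x = w b" "b < z" using xy by auto
      then show ?thesis using mixed[of y b] \<open>y \<in> S\<close> xy by simp
    next
      assume "x \<notin> S" "y \<notin> S"
      then obtain a b where ab: "x = w a" "y = w b" "a < z" "b < z" using xy by auto
      then have "(a, b) \<in> ?P \<or> (b, a) \<in> ?P"
        using xy c by (cases a b rule: linorder_cases) (auto simp: insert_commute)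
      moreover have "c = (\<lambda>(a, b). col {w a, w b}) (a, b)" "c = (\<lambda>(a, b). col {w a, w b}) (b, a)"
        using xy(4) ab by (simp_all add: insert_commute)
      ultimately show ?thesis
        by (metis (no_types, lifting) UnI1 rev_image_eqI)
    qed
  qed
  then have "card (new_colors S z w \<inter> C) \<le> card ((\<lambda>(a, b). col {w a, w b}) ` ?P \<union> (\<lambda>(b, t). col {w b, t}) ` (?T \<times> S))"
    using finP finS by (intro card_mono) auto
  also have "\<dots> \<le> card ((\<lambda>(a, b). col {w a, w b}) ` ?P) + card ((\<lambda>(b, t). col {w b, t}) ` (?T \<times> S))"
    by (rule card_Un_le)
  also have "\<dots> \<le> card ?P + card (?T \<times> S)"
    using finP finS by (intro add_mono card_image_le) auto
  finally have 1: "card (new_colors S z w \<inter> C) \<le> card ?P + card ?T * card S"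
    by (simp add: card_cartesian_product)
  have "card ?T \<le> card {b \<in> {..z}. E z b}"
    by (intro card_mono) (auto simp: E_def)
  then have 2: "card ?T * card S \<le> length es * card S"
    using es(5) by (intro mult_right_mono) auto
  \<comment> \<open>The forest bound counts ordered adjacent pairs, so every pair inside the tuple
    occurs twice.\<close>
  have "2 * card ?P = card ?P + card (prod.swap ` ?P)"
    by (simp add: card_image)
  also have "\<dots> = card (?P \<union> prod.swap ` ?P)"
    using finP by (intro card_Un_disjoint [symmetric]) auto
  also have "\<dots> \<le> card {(a, b) \<in> {..z} \<times> {..z}. E a b}"
  proof (rule card_mono)
    show "finite {(a, b) \<in> {..z} \<times> {..z}. E a b}"
      by (rule finite_subset[of _ "{..z} \<times> {..z}"]) auto
    show "?P \<union> prod.swap ` ?P \<subseteq> {(a, b) \<in> {..z} \<times> {..z}. E a b}"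
      by (auto simp: E_def insert_commute)
  qed
  finally have "2 * card ?P \<le> (z + 1) * length es" using es(4) by simp
  with 1 2 have "2 * card (new_colors S z w \<inter> C) \<le> (z + 1) * length es + 2 * (length es * card S)"
    by linarith
  also have "\<dots> = (z + 1 + 2 * card S) * length es"
    by (simp add: algebra_simps)
  finally have "2 * card (new_colors S z w \<inter> C) \<le> (z + 1 + 2 * card S) * length es" .
  then show ?thesis
    using es(1) sub sat by blast
qed

text \<open>Each tuple is charged to a forest that it satisfies. With l edges there are at most ((z
  + 1) z)^l forests, each satisfied by at most a proportion (D / N)^l of all maps, and
  \<open>x ^ l\<close> pays for the overlap: a geometric series with ratio \<open>\<zeta>\<close>.
  \<open>D\<close> bounds the choices for a child, which number at most \<open>card C\<close> below
  a tuple vertex and \<open>card S * card C\<close> below the root.\<close>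

lemma sum_new_colors_overlap:
  fixes D z :: nat and \<zeta> :: real
  assumes S: "S \<subseteq> V" "inj_on col (nsets S 2)" and V: "V \<noteq> {}"
    and D: "finite C" "card C \<le> D" "card S * card C \<le> D"
    and \<zeta>_def: "\<zeta> = real (z + 1) * real z * real D * 2 powr (real (z + 1 + 2 * card S) / 2) / card V"
    and \<zeta>_le: "\<zeta> \<le> 1/2"
  shows "(\<Sum>w | w \<in> tuples S z \<and> C \<inter> new_colors S z w \<noteq> {}. 2 ^ card (C \<inter> new_colors S z w)) \<le> 2 * \<zeta> * card V ^ z"
proof -
  define x where "x = 2 powr (real (z + 1 + 2 * card S) / 2)"
  define N where "N = real (card V)"
  have N: "0 < N" using V finV by (simp add: N_def card_gt_0_iff)
  have x: "0 < x" by (simp add: x_def)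
  define h where "h = (\<lambda>u. case u of None \<Rightarrow> (\<Union>t\<in>S. nbr C t) | Some y \<Rightarrow> nbr C y)"
  have finS: "finite S" using finite_subset[OF S(1) finV] .
  have h: "h u \<subseteq> V" "card (h u) \<le> D" for u
  proof -
    show "h u \<subseteq> V" using nbr_subset by (auto simp: h_def split: option.splits)
    show "card (h u) \<le> D"
    proof (cases u)
      case None
      have "card (\<Union>t\<in>S. nbr C t) \<le> (\<Sum>t\<in>S. card (nbr C t))"
        by (rule card_UN_le[OF finS])
      also have "\<dots> \<le> card S * card C"
        using sum_bounded_above[of S "\<lambda>t. card (nbr C t)" "card C"] card_nbr_le[OF D(1)] by simp
      finally show ?thesis using None D by (simp add: h_def)
    next
      case (Some y)
      then show ?thesis using card_nbr_le[OF D(1), of y] D by (simp add: h_def)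
    qed
  qed
  define sat where "sat w es \<longleftrightarrow> (\<forall>(a, b)\<in>set es. w b \<in> h (if a = z then None else Some (w a)))"
    for w :: "nat \<Rightarrow> 'v" and es
  define L where "L l = {es. set es \<subseteq> {..z} \<times> {..<z} \<and> length es = l}" for l
  define ES where "ES = (\<Union>l\<in>{1..z}. {es \<in> L l. forest es})"
  have finL: "finite (L l)" for l unfolding L_def by (intro finite_lists_length_eq) auto
  have cardL: "card (L l) = ((z + 1) * z) ^ l" for l
    unfolding L_def by (subst card_lists_length_eq) (auto simp: card_cartesian_product)
  have finES: "finite ES" using finL by (simp add: ES_def)
  let ?T = "{w \<in> tuples S z. C \<inter> new_colors S z w \<noteq> {}}"
  have finT: "finite ?T" using finite_tuples by simp
  have pt: "2 ^ card (C \<inter> new_colors S z w) \<le> (\<Sum>es\<in>ES. if sat w es then x ^ length es else 0)"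
    if w: "w \<in> ?T" for w
  proof -
    obtain es where es: "forest es" "set es \<subseteq> {..z} \<times> {..<z}" "sat w es"
      "2 * card (new_colors S z w \<inter> C) \<le> (z + 1 + 2 * card S) * length es"
      using new_colors_overlap[OF S, of w z C] w unfolding sat_def h_def by blast
    have "0 < card (C \<inter> new_colors S z w)"
      using w D by (simp add: card_gt_0_iff)
    \<comment> \<open>An empty forest would mean an empty overlap. Hence the series starts at
      \<open>\<zeta>\<close> instead of 1, and the whole sum is small.\<close>
    then have "1 \<le> length es"
      using es(4) by (cases es) (auto simp: Int_commute)
    moreover have "length es \<le> z"
    proof -
      have "snd ` set es \<subseteq> {..<z}" using es(2) by auto
      from forest_length_le[OF es(1) this] show ?thesis by simp
    qed
    ultimately have "es \<in> ES"
      using es by (auto simp: ES_def L_def)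
    moreover have "2 ^ card (C \<inter> new_colors S z w) \<le> x ^ length es"
    proof -
      have "real (2 * card (new_colors S z w \<inter> C)) \<le> real ((z + 1 + 2 * card S) * length es)"
        using es(4) by (rule of_nat_mono)
      then have "real (card (C \<inter> new_colors S z w)) \<le> real (z + 1 + 2 * card S) / 2 * length es"
        by (simp only: of_nat_mult Int_commute)
      then have "2 powr real (card (C \<inter> new_colors S z w)) \<le> 2 powr (real (z + 1 + 2 * card S) / 2 * length es)"
        by (intro powr_mono) auto
      also have "\<dots> = x powr real (length es)"
        unfolding x_def powr_powr ..
      finally show ?thesis using x by (simp add: powr_realpow)
    qed
    moreover have "(if sat w es then x ^ length es else 0) \<le> (\<Sum>es\<in>ES. if sat w es then x ^ length es else 0)"
      using \<open>es \<in> ES\<close> finES x by (intro member_le_sum) auto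
    ultimately show ?thesis
      using es(3) by simp
  qed
  have one: "(\<Sum>w\<in>?T. if sat w es then x ^ length es else 0) \<le> N ^ z * (x * D / N) ^ length es"
    if es: "es \<in> ES" for es
  proof -
    have es': "forest es" "set es \<subseteq> insert z {..<z} \<times> {..<z}"
      using es by (auto simp: ES_def L_def)
    let ?W = "{w \<in> {..<z} \<rightarrow>\<^sub>E V. sat w es}"
    have "card ?W * card V ^ length es \<le> card V ^ card {..<z} * D ^ length es"
      unfolding sat_def by (rule card_forest_maps[OF finV h _ _ es']) auto
    then have "real (card ?W * card V ^ length es) \<le> real (card V ^ z * D ^ length es)"
      by (intro of_nat_mono) simp
    then have W: "card ?W \<le> N ^ z * (D / N) ^ length es"
      using N by (simp add: N_def power_divide field_simps)
    have finW: "finite ?W"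
      by (rule finite_subset[OF _ finite_PiE[of "{..<z}" "\<lambda>_. V"]]) (auto simp: finV)
    have "(\<Sum>w\<in>?T. if sat w es then x ^ length es else 0) = card {w \<in> ?T. sat w es} * x ^ length es"
      using finT by (simp add: sum.If_cases Int_def)
    also have "\<dots> \<le> card ?W * x ^ length es"
      using finW x by (intro mult_right_mono of_nat_mono card_mono) (auto simp: tuples_def)
    also have "\<dots> \<le> (N ^ z * (D / N) ^ length es) * x ^ length es"
      using W x by (intro mult_right_mono) auto
    also have "\<dots> = N ^ z * (x * D / N) ^ length es"
      by (simp add: power_mult_distrib power_divide)
    finally show ?thesis .
  qed
  have \<zeta>: "\<zeta> = real ((z + 1) * z) * (x * D / N)" "0 \<le> \<zeta>"
    using x N by (simp_all add: \<zeta>_def x_def N_def algebra_simps)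
  have "(\<Sum>w\<in>?T. 2 ^ card (C \<inter> new_colors S z w)) \<le> (\<Sum>w\<in>?T. \<Sum>es\<in>ES. if sat w es then x ^ length es else 0)"
    by (intro sum_mono pt)
  also have "\<dots> = (\<Sum>es\<in>ES. \<Sum>w\<in>?T. if sat w es then x ^ length es else 0)"
    by (rule sum.swap)
  also have "\<dots> \<le> (\<Sum>es\<in>ES. N ^ z * (x * D / N) ^ length es)"
    by (intro sum_mono one)
  also have "\<dots> = (\<Sum>l=1..z. \<Sum>es\<in>{es \<in> L l. forest es}. N ^ z * (x * D / N) ^ length es)"
    unfolding ES_def
  proof (rule sum.UNION_disjoint)
    show "\<forall>l\<in>{1..z}. finite {es \<in> L l. forest es}" using finL by simp
  qed (auto simp: L_def)
  also have "\<dots> \<le> (\<Sum>l=1..z. N ^ z * \<zeta> ^ l)"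
  proof (intro sum_mono)
    fix l
    have "(\<Sum>es\<in>{es \<in> L l. forest es}. N ^ z * (x * D / N) ^ length es) \<le> (\<Sum>es\<in>L l. N ^ z * (x * D / N) ^ length es)"
      using finL x N by (intro sum_mono2) auto
    also have "\<dots> = (\<Sum>es\<in>L l. N ^ z * (x * D / N) ^ l)"
      by (intro sum.cong) (auto simp: L_def)
    also have "\<dots> = N ^ z * \<zeta> ^ l"
      by (simp only: sum_constant cardL \<zeta>(1) power_mult_distrib of_nat_power of_nat_mult mult_ac)
    finally show "(\<Sum>es\<in>{es \<in> L l. forest es}. N ^ z * (x * D / N) ^ length es) \<le> N ^ z * \<zeta> ^ l" .
  qed
  also have "\<dots> = N ^ z * (\<Sum>l=1..z. \<zeta> ^ l)"
    by (simp add: sum_distrib_left)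
  also have "\<dots> \<le> N ^ z * (2 * \<zeta>)"
    using N \<zeta>(2) \<zeta>_le by (intro mult_left_mono sum_powers_le) auto
  finally show ?thesis
    by (simp add: N_def mult_ac)
qed

section \<open>Probability that a small clique fails to extend\<close>

definition extends :: "nat \<Rightarrow> 'c set \<Rightarrow> 'v set \<Rightarrow> bool" where
  "extends k R S \<longleftrightarrow> (\<exists>A. S \<subseteq> A \<and> rainbow_clique V col k A \<and> clique_colors col A \<subseteq> R)"

text \<open>Once \<open>R\<close> contains the colors of \<open>S\<close>, failing to extend means
  that \<open>R\<close> contains none of the sets \<open>new_colors S z v\<close>. These all have
  the same size, so the thinned Janson bound applies to them.\<close>

lemma prob_not_extends:
  fixes \<kappa> :: real
  assumes S: "S \<subseteq> V" "inj_on col (nsets S 2)" "card S = s" and V: "V \<noteq> {}" and k: "k = s + z"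
    and \<kappa>: "0 < \<kappa>" "\<kappa> \<le> 1"
      "8 * real k ^ 5 * 2 powr (real (k + 1 + s) / 2) / card V \<le> \<kappa>"
    and sz: "real (card V) ^ z \<le> 2 * real (card V - (k + k ^ 3)) ^ z"
    and \<mu>: "2 * 2 ^ ((k choose 2) - (s choose 2)) \<le> \<kappa> * real (card V) ^ z"
  shows "subset_prob (clique_colors col V) (\<lambda>R. clique_colors col S \<subseteq> R \<and> \<not> extends k R S) \<le> exp (- 1 / (2 * \<kappa>))"
proof -
  let ?I = "tuples S z" and ?B = "new_colors S z" and ?b = "(k choose 2) - (s choose 2)"
  define N where "N = real (card V)"
  have N: "0 < N" using V finV by (simp add: N_def card_gt_0_iff)
  have finS: "finite S" using finite_subset[OF S(1) finV] .
  have A: "S \<union> v ` {..<z} \<subseteq> V" "inj_on col (nsets (S \<union> v ` {..<z}) 2)" "card (S \<union> v ` {..<z}) = k"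
    "finite (S \<union> v ` {..<z})" if "v \<in> ?I" for v
    using tuples_clique[OF S(1,2) that order.refl] S(3) k finS by auto
  have cardA: "card (clique_colors col (S \<union> v ` {..<z})) = k choose 2" if "v \<in> ?I" for v
    using A[OF that] by (simp add: clique_colors_def card_image)
  have cardS: "card (clique_colors col S) = s choose 2"
    using S by (simp add: clique_colors_def card_image)
  have Bsub: "?B v \<subseteq> clique_colors col V" if "v \<in> ?I" for v
    using clique_colors_mono[OF A(1)[OF that]] by (auto simp: new_colors_def)
  have finB: "finite (?B v)" if "v \<in> ?I" for v
    using finite_subset[OF Bsub[OF that] finite_colors] .
  have cardB: "card (?B v) = ?b" if "v \<in> ?I" for v
  proof -
    have "clique_colors col S \<subseteq> clique_colors col (S \<union> v ` {..<z})"
      by (intro clique_colors_mono) auto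
    moreover have "finite (clique_colors col S)"
      using finS by (simp add: clique_colors_def finite_imp_finite_nsets)
    ultimately show ?thesis
      using cardA[OF that] cardS unfolding new_colors_def by (simp add: card_Diff_subset)
  qed
  have kk: "k choose 2 \<le> k ^ 2"
    by (simp add: choose_two power2_eq_square) (meson div_le_dividend le_trans diff_le_self mult_le_mono2)
  have I: "N ^ z \<le> 2 * card ?I"
  proof -
    have "(card V - (k + k ^ 3)) ^ z \<le> card ?I"
      using card_tuples_ge[OF S(1,2), of z k] S(3) k by simp
    then have "real (card V - (k + k ^ 3)) ^ z \<le> card ?I"
      by (metis of_nat_le_iff of_nat_power)
    then show ?thesis using sz unfolding N_def by linarith
  qed
  have pair: "(\<Sum>j | j \<in> ?I \<and> ?B i \<inter> ?B j \<noteq> {}. 2 ^ card (?B i \<inter> ?B j)) \<le> \<kappa> * card ?I" if i: "i \<in> ?I" for i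
  proof -
    \<comment> \<open>\<open>k ^ 3\<close> takes the role of \<open>D\<close>: a tuple has at most
      \<open>k ^ 2\<close> new colors and \<open>S\<close> at most \<open>k\<close> vertices.
      Together with the number of possible forest edges this yields \<open>k ^ 5\<close>.\<close>
    define \<zeta> where "\<zeta> = real (z + 1) * real z * real (k ^ 3) * 2 powr (real (z + 1 + 2 * card S) / 2) / card V"
    have \<zeta>le: "4 * \<zeta> \<le> \<kappa>"
    proof (cases "z = 0")
      case True
      then show ?thesis using \<kappa> by (simp add: \<zeta>_def)
    next
      case False
      have "real (z + 1) \<le> 2 * real k" "real z \<le> real k" using k False by auto
      then have "real (z + 1) * real z * real (k ^ 3) \<le> (2 * real k) * real k * real (k ^ 3)"
        by (intro mult_mono) auto
      also have "\<dots> = 2 * real k ^ 5" by (simp add: power_numeral_reduce)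
      finally have "4 * (real (z + 1) * real z * real (k ^ 3)) \<le> 8 * real k ^ 5" by linarith
      then have "4 * (real (z + 1) * real z * real (k ^ 3)) * (2 powr (real (z + 1 + 2 * card S) / 2) / card V)
          \<le> 8 * real k ^ 5 * (2 powr (real (z + 1 + 2 * card S) / 2) / card V)"
        by (rule mult_right_mono) auto
      also have "\<dots> = 8 * real k ^ 5 * 2 powr (real (k + 1 + s) / 2) / card V"
        using k S(3) by (simp add: algebra_simps)
      also have "4 * (real (z + 1) * real z * real (k ^ 3)) * (2 powr (real (z + 1 + 2 * card S) / 2) / card V) = 4 * \<zeta>"
        by (simp add: \<zeta>_def)
      finally show ?thesis using \<kappa> by linarith
    qed
    have "card (?B i) \<le> k ^ 2" using cardB[OF i] kk by linarith
    moreover have "card S \<le> k" using S k by simp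
    moreover have "k ^ 2 \<le> k ^ 3" by (cases k) (auto simp: power_increasing)
    moreover have "card S * card (?B i) \<le> k * k ^ 2"
      using calculation by (intro mult_mono) auto
    moreover have "k * k ^ 2 = k ^ 3" by (simp add: power3_eq_cube power2_eq_square)
    ultimately have D: "card (?B i) \<le> k ^ 3" "card S * card (?B i) \<le> k ^ 3"
      by linarith+
    have "(\<Sum>j | j \<in> ?I \<and> ?B i \<inter> ?B j \<noteq> {}. 2 ^ card (?B i \<inter> ?B j)) \<le> 2 * \<zeta> * card V ^ z"
      by (rule sum_new_colors_overlap[OF S(1,2) V finB[OF i] D \<zeta>_def]) (use \<zeta>le \<kappa> in simp)
    also have "\<dots> = 2 * \<zeta> * N ^ z" by (simp add: N_def)
    also have "\<dots> \<le> 2 * \<zeta> * (2 * card ?I)"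
      using I by (intro mult_left_mono) (auto simp: \<zeta>_def)
    also have "\<dots> = 4 * \<zeta> * card ?I" by simp
    also have "\<dots> \<le> \<kappa> * card ?I"
      using \<zeta>le by (intro mult_right_mono) auto
    finally show ?thesis .
  qed
  have "2 * 2 ^ ?b \<le> \<kappa> * (2 * card ?I)"
    using \<mu> I \<kappa>(1) unfolding N_def by (meson mult_left_mono order.trans less_imp_le)
  then have "1 \<le> \<kappa> * (card ?I / 2 ^ ?b)"
    by (simp add: field_simps)
  then have main: "subset_prob (clique_colors col V) (\<lambda>R. \<forall>v\<in>?I. \<not> ?B v \<subseteq> R) \<le> exp (- 1 / (2 * \<kappa>))"
    using finite_tuples finite_colors Bsub cardB pair \<kappa>(1) by (intro janson_uniform) auto
  have "subset_prob (clique_colors col V) (\<lambda>R. clique_colors col S \<subseteq> R \<and> \<not> extends k R S)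
      \<le> subset_prob (clique_colors col V) (\<lambda>R. \<forall>v\<in>?I. \<not> ?B v \<subseteq> R)"
  proof (rule subset_prob_mono, elim conjE, intro ballI notI)
    fix R v assume "clique_colors col S \<subseteq> R" "\<not> extends k R S" and v: "v \<in> ?I" "?B v \<subseteq> R"
    moreover from this have "clique_colors col (S \<union> v ` {..<z}) \<subseteq> R"
      by (auto simp: new_colors_def)
    ultimately show False
      using A[OF v(1)] by (auto simp: extends_def rainbow_clique_def nsets_def)
  qed
  with main show ?thesis by linarith
qed

lemma prob_some_not_extends:
  fixes \<kappa> :: real
  assumes "V \<noteq> {}" and "k = s + z"
    and "0 < \<kappa>" "\<kappa> \<le> 1"
      "8 * real k ^ 5 * 2 powr (real (k + 1 + s) / 2) / card V \<le> \<kappa>"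
    and "real (card V) ^ z \<le> 2 * real (card V - (k + k ^ 3)) ^ z"
    and "2 * 2 ^ ((k choose 2) - (s choose 2)) \<le> \<kappa> * real (card V) ^ z"
  shows "subset_prob (clique_colors col V)
    (\<lambda>R. \<exists>S\<in>nsets V s. inj_on col (nsets S 2) \<and> clique_colors col S \<subseteq> R \<and> \<not> extends k R S)
    \<le> real (card V) ^ s * exp (- 1 / (2 * \<kappa>))"
proof -
  let ?J = "{S \<in> nsets V s. inj_on col (nsets S 2)}"
  let ?P = "subset_prob (clique_colors col V)"
  have fin: "finite (nsets V s)" using finV by (rule finite_imp_finite_nsets)
  have "?P (\<lambda>R. \<exists>S\<in>nsets V s. inj_on col (nsets S 2) \<and> clique_colors col S \<subseteq> R \<and> \<not> extends k R S)
      \<le> ?P (\<lambda>R. \<exists>S\<in>?J. clique_colors col S \<subseteq> R \<and> \<not> extends k R S)"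
    by (intro subset_prob_mono) auto
  also have "\<dots> \<le> (\<Sum>S\<in>?J. ?P (\<lambda>R. clique_colors col S \<subseteq> R \<and> \<not> extends k R S))"
    using fin by (intro subset_prob_union_bound) auto
  also have "\<dots> \<le> real (card ?J) * exp (- 1 / (2 * \<kappa>))"
    using assms by (intro sum_bounded_above prob_not_extends) (auto simp: nsets_def)
  also have "\<dots> \<le> real (card V) ^ s * exp (- 1 / (2 * \<kappa>))"
  proof (intro mult_right_mono)
    have "card ?J \<le> card (nsets V s)" using fin by (intro card_mono) auto
    also have "\<dots> \<le> card V ^ s"
      by (cases "s \<le> card V") (auto intro: binomial_le_pow simp: binomial_eq_0)
    finally show "real (card ?J) \<le> real (card V) ^ s"
      by (metis of_nat_le_iff of_nat_power)
  qed auto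
  finally show ?thesis .
qed

end

section \<open>Covering\<close>

text \<open>Every chosen set removes at least \<open>f\<close> elements that were still uncovered,
  and these portions are disjoint.\<close>

lemma greedy_cover:
  fixes g :: "'a \<Rightarrow> 'c set" and u :: real
  assumes "finite U" "0 < f" "0 < u"
    and step: "\<And>W. W \<subseteq> U \<Longrightarrow> u \<le> card W \<Longrightarrow> \<exists>A\<in>\<A>. f \<le> card (g A \<inter> W)"
  shows "\<exists>\<C>\<subseteq>\<A>. finite \<C> \<and> card \<C> * f \<le> card U \<and> card (U - (\<Union>A\<in>\<C>. g A)) < u"
  using assms(1,4)
proof (induction "card U" arbitrary: U rule: less_induct)
  case less
  show ?case
  proof (cases "u \<le> card U")
    case False
    then show ?thesis by (intro exI[of _ "{}"]) auto
  next
    case True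
    then obtain A where A: "A \<in> \<A>" "f \<le> card (g A \<inter> U)"
      using less.prems(2)[of U] by blast
    have "card (U - g A) + card (g A \<inter> U) = card U"
      using less.prems(1) by (metis Int_commute card_Int_Diff add.commute)
    then have lt: "card (U - g A) + f \<le> card U" using A by linarith
    then have "card (U - g A) < card U" using \<open>0 < f\<close> by linarith
    moreover have "\<exists>A\<in>\<A>. f \<le> card (g A \<inter> W)" if "W \<subseteq> U - g A" "u \<le> card W" for W
      using less.prems(2)[of W] that by blast
    ultimately obtain \<C> where C: "\<C> \<subseteq> \<A>" "finite \<C>" "card \<C> * f \<le> card (U - g A)"
      "card (U - g A - (\<Union>A\<in>\<C>. g A)) < u"
      using less.hyps[of "U - g A"] less.prems(1) by auto
    have "card (insert A \<C>) * f \<le> (card \<C> + 1) * f"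
      using C by (intro mult_right_mono) (auto simp: card_insert_if)
    then have "card (insert A \<C>) * f \<le> card U" using C lt by simp
    moreover have "U - (\<Union>A\<in>insert A \<C>. g A) = U - g A - (\<Union>A\<in>\<C>. g A)" by auto
    ultimately show ?thesis
      using A C by (intro exI[of _ "insert A \<C>"]) auto
  qed
qed

text \<open>The numerical hypotheses of \<open>clique_meeting_color_set\<close> in one predicate.
  Positivity of \<open>s\<close> and \<open>m\<close> is added so that each greedy step makes
  progress.\<close>

definition seed_params :: "real \<Rightarrow> real \<Rightarrow> real \<Rightarrow> real \<Rightarrow> nat \<Rightarrow> nat \<Rightarrow> real \<Rightarrow> bool" where
  "seed_params N w \<beta> \<tau> s m p \<longleftrightarrow> 0 \<le> \<tau> \<and> \<tau> < 1/2 \<and> 0 < p \<and> 0 < s \<and> 0 < m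
    \<and> w \<le> (1/2 - \<tau>) ^ s * (p / 8) * N
    \<and> 4 * (2 * \<beta> + real s + real s ^ 3) \<le> (1/2 - \<tau>) ^ s * (p / 8) * N
    \<and> (1/2 + \<tau>) ^ s \<le> 2 * (1/2 - \<tau>) ^ s
    \<and> w \<le> (1/2 - \<tau>) ^ m * (p / 8 * N * (p / 32) ^ s)
    \<and> \<beta> + real (s + m) + real (s + m) ^ 3 < (1/2 - \<tau>) ^ m * (p / 8 * N * (p / 32) ^ s)"

text \<open>The numerical hypotheses of \<open>prob_some_not_extends\<close> for
  \<open>z = k - s\<close>.\<close>

definition extension_params :: "nat \<Rightarrow> nat \<Rightarrow> nat \<Rightarrow> real \<Rightarrow> bool" where
  "extension_params N k s \<kappa> \<longleftrightarrow> s \<le> k \<and> 0 < \<kappa> \<and> \<kappa> \<le> 1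
    \<and> 8 * real k ^ 5 * 2 powr (real (k + 1 + s) / 2) / N \<le> \<kappa>
    \<and> real N ^ (k - s) \<le> 2 * real (N - (k + k ^ 3)) ^ (k - s)
    \<and> 2 * 2 ^ ((k choose 2) - (s choose 2)) \<le> \<kappa> * real N ^ (k - s)"

context colored_graph
begin

definition extendable :: "nat \<Rightarrow> nat \<Rightarrow> 'c set \<Rightarrow> bool" where
  "extendable k s R \<longleftrightarrow> (\<forall>S\<in>nsets V s. inj_on col (nsets S 2) \<and> clique_colors col S \<subseteq> R \<longrightarrow> extends k R S)"

text \<open>A seed is found for whatever set \<open>W\<close> is still uncovered, because
  quasirandomness speaks of \<open>R\<close> alone. Enlarging the seed to a \<open>k\<close>-clique
  can only cover more of \<open>W\<close>.\<close>

lemma cover_phase: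
  fixes w \<beta> \<tau> p :: real
  assumes q: "quasirandom w \<beta> \<tau> R" and par: "seed_params (card V) w \<beta> \<tau> s m p" and ext: "extendable k (s + m) R"
    and U: "U \<subseteq> R" "R \<subseteq> clique_colors col V" and V: "V \<noteq> {}"
    and classes: "\<And>c. c \<in> clique_colors col V \<Longrightarrow> card V / 4 \<le> card {e \<in> nsets V 2. col e = c}"
  shows "\<exists>\<C>. finite \<C> \<and> card \<C> * (s * m) \<le> card U \<and> card (U - (\<Union>A\<in>\<C>. clique_colors col A)) < p * card V
    \<and> (\<forall>A\<in>\<C>. rainbow_clique V col k A \<and> clique_colors col A \<subseteq> R)"
proof -
  let ?A = "{A. rainbow_clique V col k A \<and> clique_colors col A \<subseteq> R}"
  have N: "0 < real (card V)" using V finV by (simp add: card_gt_0_iff)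
  have p: "0 < p" using par by (simp add: seed_params_def)
  have fR: "finite R" using finite_subset[OF U(2) finite_colors] .
  have "\<exists>A\<in>?A. s * m \<le> card (clique_colors col A \<inter> W)" if W: "W \<subseteq> U" "p * card V \<le> card W" for W
  proof -
    have "\<exists>S\<subseteq>V. card S = s + m \<and> inj_on col (nsets S 2) \<and> clique_colors col S \<subseteq> R
        \<and> s * m \<le> card (clique_colors col S \<inter> W)"
      using par W U by (intro clique_meeting_color_set[OF q _ _ _ _ _ _ V classes, where p = p])
        (auto simp: seed_params_def)
    then obtain S where S: "S \<subseteq> V" "card S = s + m" "inj_on col (nsets S 2)" "clique_colors col S \<subseteq> R"
      "s * m \<le> card (clique_colors col S \<inter> W)" by blast
    have "finite S" using finite_subset[OF S(1) finV] .
    then have "S \<in> nsets V (s + m)" using S by (simp add: nsets_def)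
    then obtain A where A: "S \<subseteq> A" "rainbow_clique V col k A" "clique_colors col A \<subseteq> R"
      using ext S unfolding extendable_def extends_def by blast
    have "card (clique_colors col S \<inter> W) \<le> card (clique_colors col A \<inter> W)"
      using clique_colors_mono[OF A(1)] finite_subset[OF A(3) fR] by (intro card_mono) auto
    then show ?thesis using S A by (intro bexI[of _ A]) auto
  qed
  moreover have "finite U" using finite_subset[OF U(1) fR] .
  moreover have "0 < s * m" using par by (simp add: seed_params_def)
  moreover have "0 < p * card V" using p N by simp
  ultimately obtain \<C> where "\<C> \<subseteq> ?A" "finite \<C>" "card \<C> * (s * m) \<le> card U"
    "card (U - (\<Union>A\<in>\<C>. clique_colors col A)) < p * card V"
    using greedy_cover[of U "s * m" "p * card V" ?A "clique_colors col"] by blast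
  then show ?thesis by blast
qed

text \<open>At most N^2 edges are divided into classes of at least N / 4 edges.\<close>

lemma card_colors_le:
  assumes classes: "\<And>c. c \<in> clique_colors col V \<Longrightarrow> card V / 4 \<le> card {e \<in> nsets V 2. col e = c}" and V: "V \<noteq> {}"
  shows "card (clique_colors col V) \<le> 4 * real (card V)"
proof -
  have N: "0 < real (card V)" using V finV by (simp add: card_gt_0_iff)
  have fe: "finite (nsets V 2)" using finV by (rule finite_imp_finite_nsets)
  have "card (clique_colors col V) * (card V / 4) = (\<Sum>c\<in>clique_colors col V. card V / 4)" by simp
  also have "\<dots> \<le> (\<Sum>c\<in>clique_colors col V. real (card {e \<in> nsets V 2. col e = c}))"
    by (intro sum_mono classes)
  also have "\<dots> = card (\<Union>c\<in>clique_colors col V. {e \<in> nsets V 2. col e = c})"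
    using finite_colors fe by (subst card_UN_disjoint) auto
  also have "\<dots> \<le> card (nsets V 2)"
    using fe by (intro of_nat_mono card_mono) auto
  also have "\<dots> \<le> card V ^ 2"
    using card_nsets2_le[OF finV] by (intro of_nat_mono)
  also have "\<dots> = (4 * real (card V)) * (card V / 4)"
    by (simp add: power2_eq_square)
  finally show ?thesis
    using N by (subst (asm) mult_le_cancel_right_pos) auto
qed

lemma clique_colors_edge: "e \<in> nsets V 2 \<Longrightarrow> clique_colors col e = {col e}"
proof -
  assume "e \<in> nsets V 2"
  then obtain x y where "e = {x, y}" "x \<noteq> y" by (metis nsets2_E)
  then have "nsets e 2 = {e}" by (auto simp: nsets_2_eq insert_commute)
  then show ?thesis by (simp add: clique_colors_def)
qed

text \<open>The summands of the bound belong to the two greedy rounds and the single edges: at most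
  4 N colors at the start, fewer than \<open>p1 * card V\<close> for the second round, fewer than
  \<open>p2 * card V\<close> at the end.\<close>

lemma cover_exists:
  fixes w \<beta> \<tau> p1 p2 :: real
  assumes q: "quasirandom w \<beta> \<tau> R"
    and par: "seed_params (card V) w \<beta> \<tau> s1 m p1" "seed_params (card V) w \<beta> \<tau> s2 m p2"
    and ext: "extendable k (s1 + m) R" "extendable k (s2 + m) R"
    and R: "R \<subseteq> clique_colors col V" and V: "V \<noteq> {}"
    and classes: "\<And>c. c \<in> clique_colors col V \<Longrightarrow> card V / 4 \<le> card {e \<in> nsets V 2. col e = c}"
  shows "\<exists>\<C>. finite \<C>
    \<and> card \<C> \<le> 4 * real (card V) / (real s1 * real m) + p1 * card V / (real s2 * real m) + p2 * card V
    \<and> (\<forall>A\<in>\<C>. available_clique V col k R A) \<and> R = (\<Union>A\<in>\<C>. clique_colors col A)"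
proof -
  have sm: "0 < real (s1 * m)" "0 < real (s2 * m)"
    using par by (auto simp: seed_params_def)
  have fR: "finite R" using finite_subset[OF R finite_colors] .
  obtain C1 where C1: "finite C1" "card C1 * (s1 * m) \<le> card R"
    "card (R - (\<Union>A\<in>C1. clique_colors col A)) < p1 * card V"
    "\<forall>A\<in>C1. rainbow_clique V col k A \<and> clique_colors col A \<subseteq> R"
    using cover_phase[OF q par(1) ext(1) order.refl R V classes] by blast
  define U1 where "U1 = R - (\<Union>A\<in>C1. clique_colors col A)"
  have "U1 \<subseteq> R" by (auto simp: U1_def)
  then obtain C2 where C2: "finite C2" "card C2 * (s2 * m) \<le> card U1"
    "card (U1 - (\<Union>A\<in>C2. clique_colors col A)) < p2 * card V"
    "\<forall>A\<in>C2. rainbow_clique V col k A \<and> clique_colors col A \<subseteq> R"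
    using cover_phase[OF q par(2) ext(2) _ R V classes] by blast
  define U2 where "U2 = U1 - (\<Union>A\<in>C2. clique_colors col A)"
  have U2: "U2 \<subseteq> R" "finite U2" using fR by (auto simp: U2_def U1_def)
  have "\<forall>c\<in>U2. \<exists>e. e \<in> nsets V 2 \<and> col e = c"
    using U2 R by (auto simp: clique_colors_def)
  then obtain e where e: "\<And>c. c \<in> U2 \<Longrightarrow> e c \<in> nsets V 2" "\<And>c. c \<in> U2 \<Longrightarrow> col (e c) = c"
    by metis
  have ec: "clique_colors col (e c) = {c}" if "c \<in> U2" for c
    using clique_colors_edge[OF e(1)[OF that]] e(2)[OF that] by simp
  let ?C = "C1 \<union> C2 \<union> e ` U2"
  have "real (card C1) * real (s1 * m) \<le> 4 * real (card V)"
  proof -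
    have "real (card C1) * real (s1 * m) \<le> card R"
      using C1(2) by (metis of_nat_le_iff of_nat_mult)
    also have "\<dots> \<le> card (clique_colors col V)"
      using R finite_colors by (intro of_nat_mono card_mono)
    finally show ?thesis using card_colors_le[OF classes V] by linarith
  qed
  then have 1: "card C1 \<le> 4 * real (card V) / (real s1 * real m)"
    using sm by (simp add: pos_le_divide_eq)
  have "real (card C2) * real (s2 * m) \<le> card U1"
    using C2(2) by (metis of_nat_le_iff of_nat_mult)
  then have "real (card C2) * real (s2 * m) \<le> p1 * card V"
    using C1(3) unfolding U1_def by linarith
  then have 2: "card C2 \<le> p1 * card V / (real s2 * real m)"
    using sm by (simp add: pos_le_divide_eq)
  have "card (e ` U2) \<le> card U2" by (rule card_image_le[OF U2(2)])
  then have 3: "card (e ` U2) \<le> p2 * card V" using C2(3) unfolding U2_def by linarith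
  have "card ?C \<le> card C1 + card C2 + card (e ` U2)"
    by (intro order.trans[OF card_Un_le] add_mono order.refl card_Un_le)
  then have "card ?C \<le> 4 * real (card V) / (real s1 * real m) + p1 * card V / (real s2 * real m) + p2 * card V"
    using 1 2 3 by linarith
  moreover have "\<forall>A\<in>?C. available_clique V col k R A"
    using C1(4) C2(4) e U2 by (auto simp: available_clique_def)
  moreover have "R = (\<Union>A\<in>?C. clique_colors col A)"
  proof
    show "R \<subseteq> (\<Union>A\<in>?C. clique_colors col A)"
    proof
      fix c assume "c \<in> R"
      then show "c \<in> (\<Union>A\<in>?C. clique_colors col A)"
        using ec by (cases "c \<in> U2") (auto simp: U2_def U1_def)
    qed
    show "(\<Union>A\<in>?C. clique_colors col A) \<subseteq> R"
      using C1(4) C2(4) ec U2(1) by auto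
  qed
  moreover have "finite ?C" using C1 C2 U2 by simp
  ultimately show ?thesis by (intro exI[of _ ?C] conjI)
qed

lemma prob_not_extendable:
  assumes "extension_params (card V) k s \<kappa>" "V \<noteq> {}"
  shows "subset_prob (clique_colors col V) (\<lambda>R. \<not> extendable k s R) \<le> real (card V) ^ s * exp (- 1 / (2 * \<kappa>))"
proof -
  have "subset_prob (clique_colors col V) (\<lambda>R. \<not> extendable k s R) \<le> subset_prob (clique_colors col V)
    (\<lambda>R. \<exists>S\<in>nsets V s. inj_on col (nsets S 2) \<and> clique_colors col S \<subseteq> R \<and> \<not> extends k R S)"
    by (intro subset_prob_mono) (auto simp: extendable_def)
  also have "\<dots> \<le> real (card V) ^ s * exp (- 1 / (2 * \<kappa>))"
    using assms by (intro prob_some_not_extends[where z = "k - s"]) (auto simp: extension_params_def)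
  finally show ?thesis .
qed

text \<open>Outside three bad events, namely large energy and a non-extendable seed of either size,
  the covering is deterministic; a union bound finishes.\<close>

lemma prob_cover:
  fixes w \<beta> \<tau> p1 p2 G b :: real
  assumes par: "seed_params (card V) w \<beta> \<tau> s1 m p1" "seed_params (card V) w \<beta> \<tau> s2 m p2"
    and qp: "0 < G" "0 < \<tau>" "1 \<le> \<tau> * w" "sqrt G \<le> \<beta> * \<tau>\<^sup>2 * w"
    and ext: "extension_params (card V) k (s1 + m) \<kappa>" "extension_params (card V) k (s2 + m) \<kappa>"
    and V: "V \<noteq> {}"
    and classes: "\<And>c. c \<in> clique_colors col V \<Longrightarrow> card V / 4 \<le> card {e \<in> nsets V 2. col e = c}"
    and b: "4 * real (card V) / (real s1 * real m) + p1 * card V / (real s2 * real m) + p2 * card V \<le> b"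
  shows "1 - (3 * card V ^ 3 / G + (real (card V) ^ (s1 + m) + real (card V) ^ (s2 + m)) * exp (- 1 / (2 * \<kappa>)))
    \<le> subset_prob (clique_colors col V) (\<lambda>R. \<exists>\<C>. finite \<C> \<and> card \<C> \<le> b
        \<and> (\<forall>A\<in>\<C>. available_clique V col k R A) \<and> R = (\<Union>A\<in>\<C>. clique_colors col A))"
    (is "_ \<le> subset_prob ?\<Gamma> ?E")
proof -
  define F where "F i = (if i = (0::nat) then (\<lambda>R. corr_energy R > G)
    else if i = 1 then (\<lambda>R. \<not> extendable k (s1 + m) R) else (\<lambda>R. \<not> extendable k (s2 + m) R))" for i
  have "subset_prob ?\<Gamma> (\<lambda>R. \<not> ?E R) \<le> subset_prob ?\<Gamma> (\<lambda>R. \<exists>i\<in>{0, 1, 2}. F i R)"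
  proof (rule subset_prob_mono, rule ccontr)
    fix R assume R: "R \<subseteq> ?\<Gamma>" "\<not> ?E R" and "\<not> (\<exists>i\<in>{0, 1, 2}. F i R)"
    then have *: "corr_energy R \<le> G" "extendable k (s1 + m) R" "extendable k (s2 + m) R"
      by (auto simp: F_def)
    have "quasirandom w \<beta> \<tau> R"
      using *(1) qp by (intro quasirandomI)
    from cover_exists[OF this par *(2,3) R(1) V classes] R(2) b show False
      by (meson order.trans)
  qed
  also have "\<dots> \<le> (\<Sum>i\<in>{0, 1, 2}. subset_prob ?\<Gamma> (F i))"
    by (intro subset_prob_union_bound) auto
  also have "\<dots> = subset_prob ?\<Gamma> (\<lambda>R. corr_energy R > G)
      + (subset_prob ?\<Gamma> (\<lambda>R. \<not> extendable k (s1 + m) R) + subset_prob ?\<Gamma> (\<lambda>R. \<not> extendable k (s2 + m) R))"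
    by (simp add: F_def)
  also have "\<dots> \<le> 3 * card V ^ 3 / G + (real (card V) ^ (s1 + m) * exp (- 1 / (2 * \<kappa>))
      + real (card V) ^ (s2 + m) * exp (- 1 / (2 * \<kappa>)))"
    using qp V ext by (intro add_mono prob_corr_energy_large prob_not_extendable) auto
  finally show ?thesis
    unfolding subset_prob_not[OF finite_colors] distrib_right by linarith
qed

end

section \<open>Asymptotics\<close>

text \<open>Powers of \<open>1/2 - \<tau>\<close> cost at most N^(2 \<theta>) and
  \<open>(p / 32) ^ s\<close> at most N^(3 \<theta>). With \<theta> at most 1/200 this is at most
  N^(1/40), which leaves N^(39/40) up to powers of \<open>L\<close>, still above N^(19/20).\<close>

lemma seed_paramsI:
  fixes N L \<theta> p :: real and s m :: nat
  assumes N: "0 < N" and L: "L = ln N" "1 \<le> L" and \<theta>: "0 < \<theta>" "\<theta> \<le> 1/200"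
    and s: "0 < s" "real s \<le> \<theta> * L" and m: "0 < m" "real m \<le> \<theta> * L"
    and p: "1 / L\<^sup>2 \<le> p" "real s * ln (32 / p) \<le> 3 * \<theta> * L"
    and E1: "6 * N powr (-1/10) * L \<le> 1/2"
    and E2: "8 * L\<^sup>2 * N powr (19/20) \<le> N powr (39/40)"
    and E3: "8 * N powr (17/20) + 4 * L + 4 * L ^ 3 < N powr (19/20)"
  shows "seed_params N (N powr (19/20)) (N powr (17/20)) (N powr (-1/10)) s m p"
proof -
  define \<tau> where "\<tau> = N powr (-1/10)"
  have p0: "0 < p" using p L by (smt (verit) zero_less_divide_1_iff zero_less_power)
  have "\<tau> * 1 \<le> \<tau> * L" using L by (intro mult_left_mono) (auto simp: \<tau>_def)
  moreover have "6 * \<tau> * L \<le> 1/2" using E1 by (simp add: \<tau>_def)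
  ultimately have \<tau>: "0 < \<tau>" "\<tau> \<le> 1/12" using N by (simp_all add: \<tau>_def [symmetric]) (simp add: \<tau>_def)
  have \<theta>L: "\<theta> * L \<le> L / 200" using \<theta> L by (simp add: field_simps)
  have \<theta>L0: "0 \<le> \<theta> * L" using \<theta> L by simp
  \<comment> \<open>Both \<open>\<tau> \<le> 1/12\<close> and \<open>3 \<le> exp 2\<close> enter
    through the comparison with 1/3.\<close>
  have lo: "exp (- 2 * \<theta> * L) \<le> (1/2 - \<tau>) ^ j" if "real j \<le> \<theta> * L" for j
  proof -
    have "exp (- 2 * \<theta> * L) \<le> exp (real j * (- 2))" using that by simp
    also have "\<dots> = exp (- 2) ^ j" by (rule exp_of_nat_mult)
    also have "\<dots> \<le> (1/3) ^ j"
    proof (intro power_mono)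
      have "(3::real) \<le> exp 2" using exp_ge_add_one_self[of 2] by simp
      then show "exp (- 2) \<le> (1/3::real)" by (simp add: exp_minus field_simps)
    qed auto
    also have "\<dots> \<le> (1/2 - \<tau>) ^ j" using \<tau> by (intro power_mono) auto
    finally show ?thesis .
  qed
  have NL: "N = exp L" using N L by simp
  have pow: "N powr a = exp (a * L)" for a using N L by (simp add: powr_def)
  have W: "N powr (19/20) \<le> exp (- 2 * \<theta> * L) * ((1 / L\<^sup>2) / 8) * N * exp (- 3 * \<theta> * L)"
  proof -
    have "N powr (19/20) \<le> N powr (39/40) / (8 * L\<^sup>2)"
      using E2 L by (simp add: field_simps)
    also have "N powr (39/40) \<le> exp (L - 5 * \<theta> * L)"
      unfolding pow using \<theta>L by simp
    also have "exp (L - 5 * \<theta> * L) / (8 * L\<^sup>2) = exp (- 2 * \<theta> * L) * ((1 / L\<^sup>2) / 8) * N * exp (- 3 * \<theta> * L)"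
      unfolding NL by (simp add: exp_add [symmetric] exp_diff exp_minus field_simps)
    finally show ?thesis by (simp add: divide_right_mono)
  qed
  have Q1: "N powr (19/20) \<le> (1/2 - \<tau>) ^ s * (p / 8) * N"
  proof -
    have "exp (- 2 * \<theta> * L) * ((1 / L\<^sup>2) / 8) * N * exp (- 3 * \<theta> * L)
        \<le> exp (- 2 * \<theta> * L) * ((1 / L\<^sup>2) / 8) * N * 1"
      using N \<theta>L0 by (intro mult_left_mono) (auto simp: mult.commute)
    also have "\<dots> \<le> (1/2 - \<tau>) ^ s * (p / 8) * N * 1"
      using lo[OF s(2)] p N \<tau> by (intro mult_right_mono mult_mono) auto
    finally have "exp (- 2 * \<theta> * L) * ((1 / L\<^sup>2) / 8) * N * exp (- 3 * \<theta> * L) \<le> (1/2 - \<tau>) ^ s * (p / 8) * N"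
      by (simp only: mult_1_right)
    with W show ?thesis by (rule order.trans)
  qed
  have Q2: "N powr (19/20) \<le> (1/2 - \<tau>) ^ m * (p / 8 * N * (p / 32) ^ s)"
  proof -
    have "exp (- 3 * \<theta> * L) \<le> exp (real s * (- ln (32 / p)))" using p by simp
    also have "\<dots> = exp (- ln (32 / p)) ^ s" by (rule exp_of_nat_mult)
    also have "exp (- ln (32 / p)) = p / 32" using p0 by (simp add: exp_minus)
    finally have "exp (- 3 * \<theta> * L) \<le> (p / 32) ^ s" .
    then have "exp (- 2 * \<theta> * L) * ((1 / L\<^sup>2) / 8) * N * exp (- 3 * \<theta> * L)
        \<le> (1/2 - \<tau>) ^ m * (p / 8) * N * (p / 32) ^ s"
      using lo[OF m(2)] p N \<tau> p0 by (intro mult_mono) auto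
    then have "N powr (19/20) \<le> (1/2 - \<tau>) ^ m * (p / 8) * N * (p / 32) ^ s"
      by (rule order.trans[OF W])
    then show ?thesis by (simp only: mult.assoc)
  qed
  have sL: "real s \<le> L" "real (s + m) \<le> L" using s(2) m(2) \<theta>L L(2) by linarith+
  have cube: "real s ^ 3 \<le> L ^ 3" "real (s + m) ^ 3 \<le> L ^ 3"
    using sL by (auto intro!: power_mono)
  have N0: "0 \<le> N powr (17/20)" by simp
  have "4 * (2 * N powr (17/20) + real s + real s ^ 3) \<le> N powr (19/20)"
    using sL cube E3 by argo
  moreover have "N powr (17/20) + real (s + m) + real (s + m) ^ 3 < N powr (19/20)"
  proof -
    have "0 \<le> L ^ 3" using L by simp
    then show ?thesis using sL cube E3 N0 L by argo
  qed
  \<comment> \<open>The bases differ by a factor at most \<open>1 + 6 * \<tau>\<close>, and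
    \<open>6 * \<tau> * s\<close> is at most 1/2, so the powers differ by at most
    \<open>exp (1/2)\<close>.\<close>
  moreover have "(1/2 + \<tau>) ^ s \<le> 2 * (1/2 - \<tau>) ^ s"
  proof -
    have "\<tau> * \<tau> \<le> \<tau> * (1/12)" using \<tau> by (intro mult_left_mono) auto
    then have "1/2 + \<tau> \<le> (1/2 - \<tau>) * (1 + 6 * \<tau>)" using \<tau> by (simp add: algebra_simps)
    then have "(1/2 + \<tau>) ^ s \<le> ((1/2 - \<tau>) * (1 + 6 * \<tau>)) ^ s" using \<tau> by (intro power_mono) auto
    also have "\<dots> = (1/2 - \<tau>) ^ s * (1 + 6 * \<tau>) ^ s" by (rule power_mult_distrib)
    also have "(1 + 6 * \<tau>) ^ s \<le> exp (6 * \<tau>) ^ s"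
      using \<tau> exp_ge_add_one_self[of "6 * \<tau>"] by (intro power_mono) auto
    also have "\<dots> = exp (real s * (6 * \<tau>))" by (rule exp_of_nat_mult [symmetric])
    also have "\<dots> \<le> exp (1/2)"
    proof -
      have "real s * (6 * \<tau>) \<le> L * (6 * \<tau>)" using sL \<tau> by (intro mult_right_mono) auto
      then show ?thesis using E1 by (simp add: \<tau>_def mult_ac)
    qed
    also have "exp (1/2) \<le> (2::real)" using exp_bound[of "1/2"] by (simp add: power2_eq_square)
    finally show ?thesis using \<tau> by (simp add: mult_left_mono mult_ac)
  qed
  ultimately show ?thesis
    using Q1 Q2 \<tau> p0 s m unfolding seed_params_def \<tau>_def [symmetric] by auto
qed

text \<open>In powers of N: the overlap weight is about N^(1 - \<epsilon>/2 + \<theta>) with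
  \<theta> at most \<epsilon>/8, the factor \<open>k ^ 5\<close> is absorbed by a further
  N^(\<epsilon>/8), and dividing by N leaves N^(-\<epsilon>/4). The bound \<theta> at most (2 -
  \<epsilon>)/4 keeps the seed smaller than \<open>k\<close>. The constant 3888 is 8 * 3^5 * 2, from
  \<open>k \<le> 3 * L\<close>.\<close>

lemma extension_paramsI:
  fixes N s :: nat and L \<theta> \<epsilon> :: real
  assumes \<epsilon>: "0 < \<epsilon>" "\<epsilon> < 2" and \<theta>: "0 < \<theta>" "\<theta> \<le> \<epsilon> / 8" "\<theta> \<le> (2 - \<epsilon>) / 4"
    and N: "0 < N" and L: "L = ln (real N)" "1 \<le> L" and s: "real s \<le> 2 * \<theta> * L"
    and F1: "2 \<le> (2 - \<epsilon>) / 2 * L" and F2: "3888 * L ^ 5 \<le> exp (\<epsilon> / 8 * L)"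
    and F3: "3 * L * (3 * L + (3 * L) ^ 3) \<le> N / 2" and F4: "1 \<le> \<epsilon> / 8 * L"
  shows "extension_params N (clique_size \<epsilon> N) s (real N powr (- \<epsilon> / 4))"
proof -
  define k where "k = clique_size \<epsilon> N"
  have NL: "real N = exp L" using N L by simp
  have ln2: "2/3 \<le> ln (2::real)" "ln (2::real) \<le> 1"
    using ln2_ge_two_thirds ln_2_less_1 by auto
  have lg: "log 2 (real N) = L / ln 2" by (simp add: log_def L)
  have pos: "0 \<le> (2 - \<epsilon>) * log 2 (real N)" using \<epsilon> L by (auto simp: lg)
  have k_le: "real k \<le> (2 - \<epsilon>) * (L / ln 2)"
    using pos unfolding k_def clique_size_def lg by simp
  have k_ge: "(2 - \<epsilon>) * (L / ln 2) - 1 < real k"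
    using pos unfolding k_def clique_size_def lg by linarith
  have kln: "real k * ln 2 \<le> (2 - \<epsilon>) * L"
    using k_le ln2 by (simp add: field_simps)
  have k3: "real k \<le> 3 * L"
  proof -
    have "(2 - \<epsilon>) * L \<le> 2 * L" using \<epsilon> L by (intro mult_right_mono) auto
    also have "2 * L \<le> 3 * L * ln 2" using ln2 L by (simp add: mult_le_cancel_left_pos)
    finally have "real k * ln 2 \<le> 3 * L * ln 2" using kln by linarith
    then show ?thesis using ln2 by (simp add: mult_le_cancel_right)
  qed
  have sk: "s < k"
  proof -
    have "2 * \<theta> * L \<le> (2 - \<epsilon>) / 2 * L" using \<theta> L by (intro mult_right_mono) auto
    moreover have "(2 - \<epsilon>) * L \<le> (2 - \<epsilon>) * (L / ln 2)"
      using \<epsilon> L ln2 by (intro mult_left_mono) (auto simp: field_simps)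
    moreover have "(2 - \<epsilon>) * L = (2 - \<epsilon>) / 2 * L + (2 - \<epsilon>) / 2 * L" by (simp add: field_simps)
    ultimately have "real s < real k" using s k_ge F1 by linarith
    then show ?thesis by simp
  qed
  have sln: "real s * ln 2 \<le> 2 * \<theta> * L"
    using s ln2 mult_left_mono[of "ln 2" 1 "real s"] by simp
  have \<kappa>: "real N powr (- \<epsilon> / 4) = exp (- \<epsilon> / 4 * L)" using N by (simp add: powr_def L)
  have half: "real (k + s) / 2 * ln 2 \<le> (1 - \<epsilon> / 2 + \<theta>) * L"
  proof -
    have "real (k + s) / 2 * ln 2 = real k * ln 2 / 2 + real s * ln 2 / 2"
      by (simp add: algebra_simps add_divide_distrib)
    also have "\<dots> \<le> (2 - \<epsilon>) * L / 2 + 2 * \<theta> * L / 2" using kln sln by linarith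
    also have "\<dots> = (1 - \<epsilon> / 2 + \<theta>) * L" by (simp add: field_simps)
    finally show ?thesis .
  qed
  have c1: "8 * real k ^ 5 * 2 powr (real (k + 1 + s) / 2) / real N \<le> exp (- \<epsilon> / 4 * L)"
  proof -
    have "2 powr (real (k + 1 + s) / 2) = exp (real (k + s) / 2 * ln 2 + ln 2 / 2)"
      by (simp add: powr_def algebra_simps add_divide_distrib)
    also have "\<dots> \<le> exp ((1 - \<epsilon> / 2 + \<theta>) * L + ln 2)"
      using half ln2 by simp
    also have "\<dots> = 2 * exp ((1 - \<epsilon> / 2 + \<theta>) * L)" by (simp add: exp_add)
    finally have "8 * real k ^ 5 * 2 powr (real (k + 1 + s) / 2) \<le> 8 * (3 * L) ^ 5 * (2 * exp ((1 - \<epsilon> / 2 + \<theta>) * L))"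
      using k3 L by (intro mult_mono power_mono) auto
    also have "\<dots> = 3888 * L ^ 5 * exp ((1 - \<epsilon> / 2 + \<theta>) * L)" by (simp add: power_mult_distrib)
    also have "\<dots> \<le> exp (\<epsilon> / 8 * L) * exp ((1 - \<epsilon> / 2 + \<theta>) * L)"
      using F2 by (intro mult_right_mono) auto
    also have "\<dots> = exp (\<epsilon> / 8 * L + (1 - \<epsilon> / 2 + \<theta>) * L)" by (rule exp_add [symmetric])
    also have "\<dots> \<le> exp (- \<epsilon> / 4 * L + L)"
    proof -
      have "\<theta> * L \<le> \<epsilon> / 8 * L" using \<theta> L by (intro mult_right_mono) auto
      then show ?thesis by (simp add: algebra_simps)
    qed
    also have "\<dots> = exp (- \<epsilon> / 4 * L) * real N" unfolding NL by (rule exp_add)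
    finally show ?thesis using N by (simp add: divide_le_eq)
  qed
  \<comment> \<open>Bernoulli's inequality: each of the \<open>k - s\<close> factors loses a
    proportion F / N, and these losses add up to at most 1/2.\<close>
  have c2: "real N ^ (k - s) \<le> 2 * real (N - (k + k ^ 3)) ^ (k - s)"
  proof -
    let ?z = "k - s"
    define F where "F = real k + real k ^ 3"
    have zF: "real ?z * F \<le> N / 2"
    proof -
      have "real ?z * F \<le> (3 * L) * (3 * L + (3 * L) ^ 3)"
        unfolding F_def using k3 L by (intro mult_mono add_mono power_mono) auto
      then show ?thesis using F3 by linarith
    qed
    have "1 * F \<le> real ?z * F" using sk by (intro mult_right_mono) (auto simp: F_def)
    then have FN: "F \<le> N / 2" using order.trans[OF _ zF, of F] by (simp only: mult_1)
    have "real (k + k ^ 3) \<le> real N" using FN unfolding F_def by simp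
    then have "k + k ^ 3 \<le> N" by (simp only: of_nat_le_iff)
    then have eq: "real (N - (k + k ^ 3)) = N - F"
      by (simp add: of_nat_diff F_def)
    have "real N ^ ?z \<le> 2 * (real N ^ ?z * (1 + real ?z * (- F / N)))"
    proof -
      have "real ?z * (F / N) \<le> 1/2" using zF N by (simp add: field_simps)
      then have "1 \<le> 2 * (1 + real ?z * (- F / N))" by (simp add: mult_ac)
      then have "real N ^ ?z * 1 \<le> real N ^ ?z * (2 * (1 + real ?z * (- F / N)))"
        by (intro mult_left_mono) auto
      then show ?thesis by (simp only: mult_1_right mult.left_commute)
    qed
    also have "1 + real ?z * (- F / N) \<le> (1 + (- F / N)) ^ ?z"
      using FN N by (intro Bernoulli_inequality) (simp add: field_simps)
    also have "real N ^ ?z * (1 + (- F / N)) ^ ?z = (N - F) ^ ?z"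
      using N by (simp add: power_mult_distrib [symmetric] field_simps)
    finally show ?thesis using eq by (simp add: mult_left_mono)
  qed
  \<comment> \<open>The exponent is z (k + s - 1) / 2 for z = k - s, so each new vertex pays at most
    N^(1 - \<epsilon>/2 + \<theta>) against its N choices. As z is at least 1, the surplus of one
    vertex covers the factor 2 and \<open>\<kappa>\<close>.\<close>
  have c3: "2 * 2 ^ ((k choose 2) - (s choose 2)) \<le> exp (- \<epsilon> / 4 * L) * real N ^ (k - s)"
  proof -
    define z where "z = real (k - s)"
    have z: "1 \<le> z" "real k = z + s" using sk by (auto simp: z_def)
    have ch: "real (n choose 2) = real n * (real n - 1) / 2" for n
      by (cases n) (auto simp: choose_two real_of_nat_div algebra_simps)
    have "s choose 2 \<le> k choose 2" using sk by (simp add: choose_two div_le_mono mult_le_mono diff_le_mono)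
    then have "real ((k choose 2) - (s choose 2)) = z * (real (k + s) - 1) / 2"
      unfolding of_nat_diff[OF \<open>s choose 2 \<le> k choose 2\<close>] ch of_nat_add z(2) by (simp add: field_simps)
    also have "\<dots> \<le> z * (real (k + s) / 2)" using z by (simp add: field_simps)
    finally have "real ((k choose 2) - (s choose 2)) * ln 2 \<le> z * (real (k + s) / 2) * ln 2"
      using ln2 by (intro mult_right_mono) auto
    also have "\<dots> \<le> z * ((1 - \<epsilon> / 2 + \<theta>) * L)"
      using half z by (simp add: mult.assoc mult_left_mono)
    finally have b: "real ((k choose 2) - (s choose 2)) * ln 2 \<le> z * ((1 - \<epsilon> / 2 + \<theta>) * L)" .
    have gain: "ln 2 + \<epsilon> / 4 * L \<le> z * ((\<epsilon> / 2 - \<theta>) * L)"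
    proof -
      have "\<theta> * L \<le> \<epsilon> / 8 * L" using \<theta> L by (intro mult_right_mono) auto
      then have "ln 2 + \<epsilon> / 4 * L \<le> (\<epsilon> / 2 - \<theta>) * L" using F4 ln2 by (simp add: algebra_simps)
      moreover have "0 \<le> (\<epsilon> / 2 - \<theta>) * L" using \<theta> L \<epsilon> by simp
      ultimately show ?thesis using z mult_right_mono[of 1 z "(\<epsilon> / 2 - \<theta>) * L"] by linarith
    qed
    have "(2::real) * 2 ^ ((k choose 2) - (s choose 2)) = exp (ln 2 + real ((k choose 2) - (s choose 2)) * ln 2)"
      by (simp add: exp_add exp_of_nat_mult)
    also have "\<dots> \<le> exp (- \<epsilon> / 4 * L + z * L)"
      using b gain by (simp add: algebra_simps)
    also have "\<dots> = exp (- \<epsilon> / 4 * L) * real N ^ (k - s)"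
      unfolding exp_add z_def exp_of_nat_mult NL ..
    finally show ?thesis .
  qed
  show ?thesis
    unfolding extension_params_def k_def [symmetric] \<kappa> using sk c1 c2 c3 \<epsilon> L by auto
qed

text \<open>The halves allow for rounding down. The last hypothesis is where the constant 1 is won:
  \<open>ln (ln L)\<close> is of smaller order than \<open>ln L\<close>, so the factor 1 /
  \<theta>^2 does no harm.\<close>

lemma covering_count_bound:
  fixes N L \<theta> :: real and s1 s2 m :: nat
  assumes "0 < N" "0 < \<theta>" "0 < L" "0 < ln L" "0 < ln (ln L)"
    and "\<theta> * L / (2 * ln (ln L)) \<le> s1" "\<theta> * L / (2 * ln L) \<le> s2" "\<theta> * L / 2 \<le> m"
    and G: "16 * ln (ln L) / \<theta>\<^sup>2 + 4 / \<theta>\<^sup>2 + 1 \<le> ln L"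
  shows "4 * N / (real s1 * real m) + (1 / ln L) * N / (real s2 * real m) + (1 / L\<^sup>2) * N \<le> N * ln L / L\<^sup>2"
proof -
  have "0 < \<theta> * L / (2 * ln (ln L))" "0 < \<theta> * L / (2 * ln L)" "0 < \<theta> * L / 2"
    using assms by auto
  then have pos: "0 < s1" "0 < s2" "0 < m"
    using assms(6-8) by (auto simp only: of_nat_0_less_iff [symmetric, where 'a = real] intro: less_le_trans)
  have "(\<theta> * L / (2 * ln (ln L))) * (\<theta> * L / 2) \<le> real s1 * real m"
    using assms by (intro mult_mono) auto
  then have "4 * N / (real s1 * real m) \<le> 4 * N / ((\<theta> * L / (2 * ln (ln L))) * (\<theta> * L / 2))"
    using assms by (intro divide_left_mono) (auto intro!: mult_pos_pos divide_pos_pos pos)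
  also have "\<dots> = N / L\<^sup>2 * (16 * ln (ln L) / \<theta>\<^sup>2)"
    using assms by (simp add: field_simps power2_eq_square)
  finally have 1: "4 * N / (real s1 * real m) \<le> N / L\<^sup>2 * (16 * ln (ln L) / \<theta>\<^sup>2)" .
  have "(\<theta> * L / (2 * ln L)) * (\<theta> * L / 2) \<le> real s2 * real m"
    using assms by (intro mult_mono) auto
  then have "(1 / ln L) * N / (real s2 * real m) \<le> (1 / ln L) * N / ((\<theta> * L / (2 * ln L)) * (\<theta> * L / 2))"
    using assms by (intro divide_left_mono) (auto intro!: mult_pos_pos divide_pos_pos pos)
  also have "\<dots> = N / L\<^sup>2 * (4 / \<theta>\<^sup>2)"
    using assms by (simp add: field_simps power2_eq_square)
  finally have 2: "(1 / ln L) * N / (real s2 * real m) \<le> N / L\<^sup>2 * (4 / \<theta>\<^sup>2)" .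
  have "N / L\<^sup>2 * (16 * ln (ln L) / \<theta>\<^sup>2 + 4 / \<theta>\<^sup>2 + 1) \<le> N / L\<^sup>2 * ln L"
    using G assms by (intro mult_left_mono) auto
  then show ?thesis
    using 1 2 by (simp add: distrib_left)
qed

text \<open>Independent fair inclusion of the elements is the uniform distribution on
  subsets.\<close>

lemma prob_random_color_set:
  assumes "finite S"
  shows "measure_pmf.prob (random_color_set S) {R. E R} = subset_prob S E"
proof -
  have "random_color_set S = pmf_of_set (Pow S)"
    unfolding random_color_set_def by (rule pmf_of_set_Pow_conv_bernoulli[OF assms])
  then have "measure_pmf.prob (random_color_set S) {R. E R} = card (Pow S \<inter> {R. E R}) / card (Pow S)"
    using assms measure_pmf_of_set[of "Pow S" "{R. E R}"] by (simp only: finite_Pow_iff Pow_not_empty not_False_eq_True)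
  also have "Pow S \<inter> {R. E R} = {R. R \<subseteq> S \<and> E R}" by auto
  finally show ?thesis using assms by (simp add: subset_prob_eq_card card_Pow)
qed

lemma eventually_params:
  fixes \<theta> \<epsilon> :: real
  assumes "0 < \<theta>" "0 < \<epsilon>" "\<epsilon> < 2"
  shows "\<forall>\<^sub>F x :: real in at_top. 0 < x
      \<and> 6 * x powr (-1/10) * ln x \<le> 1/2
      \<and> 8 * (ln x)\<^sup>2 * x powr (19/20) \<le> x powr (39/40)
      \<and> 8 * x powr (17/20) + 4 * ln x + 4 * ln x ^ 3 < x powr (19/20)
      \<and> 2 \<le> (2 - \<epsilon>) / 2 * ln x
      \<and> 3888 * ln x ^ 5 \<le> exp (\<epsilon> / 8 * ln x)
      \<and> 3 * ln x * (3 * ln x + (3 * ln x) ^ 3) \<le> x / 2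
      \<and> 1 \<le> \<epsilon> / 8 * ln x
      \<and> 1 \<le> ln x
      \<and> ln 32 \<le> ln (ln (ln x))
      \<and> 2 \<le> \<theta> * ln x / ln (ln x)
      \<and> ln (ln x) \<le> (ln x)\<^sup>2
      \<and> 16 * ln (ln (ln x)) / \<theta>\<^sup>2 + 4 / \<theta>\<^sup>2 + 1 \<le> ln (ln x)"
  by (intro eventually_conj) (use assms in real_asymp)+

lemma error_tendsto_0:
  fixes \<theta> \<epsilon> :: real
  assumes "0 < \<epsilon>"
  shows "((\<lambda>x. 3 * x powr (-1/5) + 2 * exp (2 * \<theta> * (ln x)\<^sup>2 - x powr (\<epsilon> / 4) / 2)) \<longlongrightarrow> 0) at_top"
  using assms by real_asymp


text \<open>The error depends on the number of vertices only and the bound holds for all graphs of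
  that size, so it can later be composed with any sequence of sizes tending to infinity.\<close>

lemma cover_prob_bound:
  fixes \<epsilon> :: real
  assumes \<epsilon>: "0 < \<epsilon>" "\<epsilon> < 2"
  obtains err :: "real \<Rightarrow> real" where "(err \<longlongrightarrow> 0) at_top"
    and "\<forall>\<^sub>F n in sequentially. \<forall>(V :: 'v set) (col :: 'v set \<Rightarrow> 'c). colored_graph V col \<longrightarrow> card V = n \<longrightarrow>
      (\<forall>c\<in>clique_colors col V. real n / 4 \<le> card {e \<in> nsets V 2. col e = c}) \<longrightarrow>
      1 - err n \<le> subset_prob (clique_colors col V) (\<lambda>R. \<exists>\<C>. finite \<C>
        \<and> real (card \<C>) \<le> real n * ln (ln (real n)) / (ln (real n))\<^sup>2
        \<and> (\<forall>A\<in>\<C>. available_clique V col (clique_size \<epsilon> n) R A) \<and> R = (\<Union>A\<in>\<C>. clique_colors col A))"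
proof -
  \<comment> \<open>The three bounds demanded by \<open>seed_paramsI\<close> and
    \<open>extension_paramsI\<close>.\<close>
  define \<theta> where "\<theta> = min (1/200) (min (\<epsilon> / 8) ((2 - \<epsilon>) / 4))"
  have \<theta>: "0 < \<theta>" "\<theta> \<le> 1/200" "\<theta> \<le> \<epsilon> / 8" "\<theta> \<le> (2 - \<epsilon>) / 4"
    using \<epsilon> unfolding \<theta>_def by (simp_all only: min_less_iff_conj min.coboundedI1 min.coboundedI2 order.refl) auto
  let ?err = "\<lambda>x. 3 * x powr (-1/5) + 2 * exp (2 * \<theta> * (ln x)\<^sup>2 - x powr (\<epsilon> / 4) / 2)"
  have ev: "\<forall>\<^sub>F n in sequentially. \<forall>(V :: 'v set) (col :: 'v set \<Rightarrow> 'c). colored_graph V col \<longrightarrow> card V = n \<longrightarrow>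
      (\<forall>c\<in>clique_colors col V. real n / 4 \<le> card {e \<in> nsets V 2. col e = c}) \<longrightarrow>
      1 - ?err n \<le> subset_prob (clique_colors col V) (\<lambda>R. \<exists>\<C>. finite \<C>
        \<and> real (card \<C>) \<le> real n * ln (ln (real n)) / (ln (real n))\<^sup>2
        \<and> (\<forall>A\<in>\<C>. available_clique V col (clique_size \<epsilon> n) R A) \<and> R = (\<Union>A\<in>\<C>. clique_colors col A))"
    using eventually_compose_filterlim[OF eventually_params[OF \<theta>(1) \<epsilon>] filterlim_real_sequentially]
  proof eventually_elim
    case (elim n)
    define N L where "N = real n" and "L = ln N"
    have E: "0 < N" "6 * N powr (-1/10) * L \<le> 1/2" "8 * L\<^sup>2 * N powr (19/20) \<le> N powr (39/40)"
      "8 * N powr (17/20) + 4 * L + 4 * L ^ 3 < N powr (19/20)" "2 \<le> (2 - \<epsilon>) / 2 * L"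
      "3888 * L ^ 5 \<le> exp (\<epsilon> / 8 * L)" "3 * L * (3 * L + (3 * L) ^ 3) \<le> N / 2" "1 \<le> \<epsilon> / 8 * L" "1 \<le> L"
      "ln 32 \<le> ln (ln L)" "2 \<le> \<theta> * L / ln L" "ln L \<le> L\<^sup>2"
      "16 * ln (ln L) / \<theta>\<^sup>2 + 4 / \<theta>\<^sup>2 + 1 \<le> ln L"
      using elim unfolding N_def L_def by blast+
    have "exp 1 \<le> (32::real)" using exp_le by linarith
    then have ln32: "1 \<le> ln (32::real)" by (simp add: ln_ge_iff)
    have lam: "1 \<le> ln (ln L)" using E(10) ln32 by linarith
    have "0 < ln L"
      using E(13) lam \<theta>(1) by (smt (verit) divide_nonneg_pos zero_less_power)
    then have lamell: "ln (ln L) \<le> ln L" using ln_le_minus_one[of "ln L"] by linarith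
    then have ell: "1 \<le> ln L" using lam by linarith
    have \<theta>L: "0 < \<theta> * L" using \<theta> E(9) by simp
    have "\<theta> * L / ln L \<le> \<theta> * L / ln (ln L)"
      using lam lamell \<theta>L by (intro divide_left_mono mult_pos_pos) linarith+
    moreover have "\<theta> * L / ln (ln L) \<le> \<theta> * L / 1"
      using lam \<theta>L by (intro divide_left_mono mult_pos_pos) linarith+
    ultimately have big: "2 \<le> \<theta> * L / ln L" "2 \<le> \<theta> * L / ln (ln L)" "2 \<le> \<theta> * L"
      and ord: "\<theta> * L / ln L \<le> \<theta> * L" "\<theta> * L / ln (ln L) \<le> \<theta> * L"
      using E(11) by linarith+
    \<comment> \<open>\<open>s1\<close> and \<open>s2\<close> are about as large, up to a constant,
      as the condition \<open>real s * ln (32 / p) \<le> 3 * \<theta> * L\<close> permits for the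
      densities \<open>1 / ln L\<close> and \<open>1 / L\<^sup>2\<close>.\<close>
    define m s1 s2 where "m = nat \<lfloor>\<theta> * L\<rfloor>" and "s1 = nat \<lfloor>\<theta> * L / ln (ln L)\<rfloor>" and "s2 = nat \<lfloor>\<theta> * L / ln L\<rfloor>"
    have fl: "real (nat \<lfloor>y\<rfloor>) \<le> y" "y / 2 \<le> real (nat \<lfloor>y\<rfloor>)" "0 < nat \<lfloor>y\<rfloor>" if "2 \<le> y" for y
      using that by linarith+
    have m: "real m \<le> \<theta> * L" "\<theta> * L / 2 \<le> real m" "0 < m"
      unfolding m_def by (rule fl[OF big(3)])+
    have s1: "real s1 \<le> \<theta> * L / ln (ln L)" "\<theta> * L / ln (ln L) / 2 \<le> real s1" "0 < s1"
      unfolding s1_def by (rule fl[OF big(2)])+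
    have s2: "real s2 \<le> \<theta> * L / ln L" "\<theta> * L / ln L / 2 \<le> real s2" "0 < s2"
      unfolding s2_def by (rule fl[OF big(1)])+
    have sL: "real s1 \<le> \<theta> * L" "real s2 \<le> \<theta> * L" using s1 s2 ord by linarith+
    have par1: "seed_params N (N powr (19/20)) (N powr (17/20)) (N powr (-1/10)) s1 m (1 / ln L)"
    proof (rule seed_paramsI[OF E(1) L_def E(9) \<theta>(1,2) s1(3) sL(1) m(3,1) _ _ E(2-4)])
      show "1 / L\<^sup>2 \<le> 1 / ln L" using E(12) ell by (intro divide_left_mono mult_pos_pos) linarith+
      have "real s1 * ln (32 / (1 / ln L)) = real s1 * (ln 32 + ln (ln L))"
        using ell by (simp add: ln_mult)
      also have "\<dots> \<le> (\<theta> * L / ln (ln L)) * (3 * ln (ln L))"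
        using s1 lam \<theta>L E(10) ln32 by (intro mult_mono) linarith+
      also have "\<dots> = 3 * \<theta> * L" using lam by (simp add: field_simps)
      finally show "real s1 * ln (32 / (1 / ln L)) \<le> 3 * \<theta> * L" .
    qed
    have par2: "seed_params N (N powr (19/20)) (N powr (17/20)) (N powr (-1/10)) s2 m (1 / L\<^sup>2)"
    proof (rule seed_paramsI[OF E(1) L_def E(9) \<theta>(1,2) s2(3) sL(2) m(3,1) _ _ E(2-4)])
      have "real s2 * ln (32 / (1 / L\<^sup>2)) = real s2 * (ln 32 + 2 * ln L)"
        using E(9) by (simp add: ln_mult ln_realpow)
      also have "\<dots> \<le> (\<theta> * L / ln L) * (3 * ln L)"
        using s2 ell \<theta>L E(10) lamell ln32 by (intro mult_mono) linarith+
      also have "\<dots> = 3 * \<theta> * L" using ell by (simp add: field_simps)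
      finally show "real s2 * ln (32 / (1 / L\<^sup>2)) \<le> 3 * \<theta> * L" .
    qed simp
    have n0: "0 < n" using E(1) by (simp add: N_def)
    have ext: "extension_params n (clique_size \<epsilon> n) s (real n powr (- \<epsilon> / 4))" if "real s \<le> 2 * \<theta> * L" for s
      using extension_paramsI[OF \<epsilon> \<theta>(1,3,4) n0 _ E(9) that E(5,6) _ E(8)] E(7) by (simp add: L_def N_def)
    have sm: "real (s1 + m) \<le> 2 * \<theta> * L" "real (s2 + m) \<le> 2 * \<theta> * L"
      using sL m by auto
    have count: "4 * N / (real s1 * real m) + (1 / ln L) * N / (real s2 * real m) + (1 / L\<^sup>2) * N \<le> N * ln L / L\<^sup>2"
    proof (rule covering_count_bound[OF E(1) \<theta>(1) _ _ _ _ _ m(2) E(13)])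
      show "0 < L" "0 < ln L" "0 < ln (ln L)" using E(9) ell lam by linarith+
      show "\<theta> * L / (2 * ln (ln L)) \<le> s1" "\<theta> * L / (2 * ln L) \<le> s2"
        using s1(2) s2(2) by (simp_all only: divide_divide_eq_left mult.commute)
    qed
    show ?case
    proof (intro allI impI)
      fix V :: "'v set" and col :: "'v set \<Rightarrow> 'c"
      assume "colored_graph V col" and V: "card V = n"
        and classes: "\<forall>c\<in>clique_colors col V. real n / 4 \<le> card {e \<in> nsets V 2. col e = c}"
      then interpret colored_graph V col by simp
      have Vne: "V \<noteq> {}" using V n0 by auto
      have NV: "N = real (card V)" by (simp add: N_def V)
      \<comment> \<open>The energy threshold N^(16/5) is exceeded with probability at most 3
        N^(-1/5). Its root N^(8/5) matches the exponents of \<beta>, \<tau>^2 and w: 17/20 - 1/5 +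
        19/20 = 8/5.\<close>
      have qp: "0 < N powr (16/5)" "0 < N powr (-1/10)" "1 \<le> N powr (-1/10) * N powr (19/20)"
        "sqrt (N powr (16/5)) \<le> N powr (17/20) * (N powr (-1/10))\<^sup>2 * N powr (19/20)"
      proof -
        show "0 < N powr (16/5)" "0 < N powr (-1/10)" using E(1) by auto
        have "1 \<le> N" using n0 by (simp add: N_def)
        then show "1 \<le> N powr (-1/10) * N powr (19/20)"
          by (simp add: powr_add [symmetric] ge_one_powr_ge_zero)
        show "sqrt (N powr (16/5)) \<le> N powr (17/20) * (N powr (-1/10))\<^sup>2 * N powr (19/20)"
          using E(1) by (simp add: powr_half_sqrt [symmetric] powr_powr power2_eq_square powr_add [symmetric])
      qed
      let ?\<kappa> = "real n powr (- \<epsilon> / 4)"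
      have "1 - ?err N \<le> 1 - (3 * N ^ 3 / N powr (16/5) + (N ^ (s1 + m) + N ^ (s2 + m)) * exp (- 1 / (2 * ?\<kappa>)))"
      proof -
        have A: "N ^ 3 / N powr (16/5) = N powr (-1/5)"
        proof -
          have "N ^ 3 / N powr (16/5) = N powr 3 / N powr (16/5)" using E(1) by (simp add: powr_numeral)
          also have "\<dots> = N powr (3 - 16/5)" by (rule powr_diff [symmetric])
          finally show ?thesis by simp
        qed
        have B: "N ^ s * exp (- 1 / (2 * ?\<kappa>)) \<le> exp (2 * \<theta> * L\<^sup>2 - N powr (\<epsilon> / 4) / 2)"
          if "real s \<le> 2 * \<theta> * L" for s
        proof -
          have "N ^ s = exp (real s * L)" using E(1) by (simp add: exp_of_nat_mult L_def)
          also have "\<dots> \<le> exp (2 * \<theta> * L * L)" using that E(9) by (simp add: mult_right_mono)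
          finally have "N ^ s * exp (- 1 / (2 * ?\<kappa>)) \<le> exp (2 * \<theta> * L * L) * exp (- 1 / (2 * ?\<kappa>))"
            by (intro mult_right_mono) auto
          also have "\<dots> = exp (2 * \<theta> * L\<^sup>2 - N powr (\<epsilon> / 4) / 2)"
            using E(1) by (simp add: exp_add [symmetric] power2_eq_square N_def powr_minus field_simps)
          finally show ?thesis .
        qed
        have "3 * N ^ 3 / N powr (16/5) = 3 * N powr (-1/5)"
          using A by (metis times_divide_eq_right)
        then show ?thesis
          using B[OF sm(1)] B[OF sm(2)] unfolding L_def [symmetric] distrib_right by linarith
      qed
      also have "\<dots> \<le> subset_prob (clique_colors col V) (\<lambda>R. \<exists>\<C>. finite \<C> \<and> card \<C> \<le> N * ln L / L\<^sup>2
        \<and> (\<forall>A\<in>\<C>. available_clique V col (clique_size \<epsilon> n) R A) \<and> R = (\<Union>A\<in>\<C>. clique_colors col A))"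
      proof -
        have "extension_params (card V) (clique_size \<epsilon> n) (s1 + m) ?\<kappa>"
          "extension_params (card V) (clique_size \<epsilon> n) (s2 + m) ?\<kappa>"
          using ext[OF sm(1)] ext[OF sm(2)] V by simp_all
        moreover have "real (card V) / 4 \<le> card {e \<in> nsets V 2. col e = c}" if "c \<in> clique_colors col V" for c
          using classes that V by simp
        ultimately show ?thesis
          using prob_cover[OF par1[unfolded NV] par2[unfolded NV] qp[unfolded NV] _ _ Vne _ count[unfolded NV]]
          by (simp only: NV of_nat_mult of_nat_power of_nat_numeral)
      qed
      finally show "1 - ?err (real n) \<le> subset_prob (clique_colors col V) (\<lambda>R. \<exists>\<C>. finite \<C>
        \<and> real (card \<C>) \<le> real n * ln (ln (real n)) / (ln (real n))\<^sup>2
        \<and> (\<forall>A\<in>\<C>. available_clique V col (clique_size \<epsilon> n) R A) \<and> R = (\<Union>A\<in>\<C>. clique_colors col A))"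
        by (simp add: N_def L_def)
    qed
  qed
  show thesis
    by (rule that[OF error_tendsto_0[OF \<epsilon>(1)] ev])
qed

theorem theorem7p3:
  fixes \<epsilon> :: real
    and V :: "nat \<Rightarrow> 'v set"
    and N :: "nat \<Rightarrow> nat"
    and col :: "nat \<Rightarrow> 'v set \<Rightarrow> 'c"
  assumes "0 < \<epsilon>" and "\<epsilon> < 2"
    and "\<And>n. finite (V n)"
    and "\<And>n. card (V n) = N n"
    and "filterlim N at_top sequentially"
    and "\<And>n. proper_edge_coloring (V n) (col n)"
    and "\<And>\<delta>. \<delta> > 0 \<Longrightarrow>
           \<forall>\<^sub>F n in sequentially. \<forall>c\<in>clique_colors (col n) (V n).
             \<bar>real (card {e \<in> nsets (V n) 2. col n e = c}) - real (N n) / 2\<bar> \<le> \<delta> * (real (N n) / 2)"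
  shows "(\<lambda>n. measure_pmf.prob (random_color_set (clique_colors (col n) (V n)))
            {R. \<exists>\<C>. finite \<C> \<and>
                  real (card \<C>) \<le> real (N n) * ln (ln (real (N n))) / (ln (real (N n)))\<^sup>2 \<and>
                  (\<forall>A\<in>\<C>. available_clique (V n) (col n) (clique_size \<epsilon> (N n)) R A) \<and>
                  R = (\<Union>A\<in>\<C>. clique_colors (col n) A)})
         \<longlonglongrightarrow> 1"
proof -
  obtain err :: "real \<Rightarrow> real" where err: "(err \<longlongrightarrow> 0) at_top"
    and bound: "\<forall>\<^sub>F n in sequentially. \<forall>(V :: 'v set) (col :: 'v set \<Rightarrow> 'c). colored_graph V col \<longrightarrow> card V = n \<longrightarrow>
      (\<forall>c\<in>clique_colors col V. real n / 4 \<le> card {e \<in> nsets V 2. col e = c}) \<longrightarrow>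
      1 - err n \<le> subset_prob (clique_colors col V) (\<lambda>R. \<exists>\<C>. finite \<C>
        \<and> real (card \<C>) \<le> real n * ln (ln (real n)) / (ln (real n))\<^sup>2
        \<and> (\<forall>A\<in>\<C>. available_clique V col (clique_size \<epsilon> n) R A) \<and> R = (\<Union>A\<in>\<C>. clique_colors col A))"
    using cover_prob_bound[OF assms(1,2)] by blast
  have graph: "colored_graph (V n) (col n)" for n
    using assms(3,6) by (simp add: colored_graph_def)
  have lim: "(\<lambda>n. 1 - err (real (N n))) \<longlonglongrightarrow> 1 - 0"
    by (intro tendsto_intros filterlim_compose[OF err]
        filterlim_compose[OF filterlim_real_sequentially assms(5)])
  \<comment> \<open>The hypothesis on color classes with relative error 1/2 gives the N / 4 edges
    per color used throughout.\<close>
  have lower: "\<forall>\<^sub>F n in sequentially. 1 - err (real (N n))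
      \<le> measure_pmf.prob (random_color_set (clique_colors (col n) (V n)))
            {R. \<exists>\<C>. finite \<C> \<and>
                  real (card \<C>) \<le> real (N n) * ln (ln (real (N n))) / (ln (real (N n)))\<^sup>2 \<and>
                  (\<forall>A\<in>\<C>. available_clique (V n) (col n) (clique_size \<epsilon> (N n)) R A) \<and>
                  R = (\<Union>A\<in>\<C>. clique_colors (col n) A)}"
    using eventually_compose_filterlim[OF bound assms(5)] assms(7)[of "1/2", simplified]
  proof eventually_elim
    case (elim n)
    have "\<forall>c\<in>clique_colors (col n) (V n). real (N n) / 4 \<le> card {e \<in> nsets (V n) 2. col n e = c}"
    proof
      fix c assume "c \<in> clique_colors (col n) (V n)"
      with elim(2) have "\<bar>real (card {e \<in> nsets (V n) 2. col n e = c}) - real (N n) / 2\<bar> * 4 \<le> real (N n)"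
        by blast
      then show "real (N n) / 4 \<le> card {e \<in> nsets (V n) 2. col n e = c}"
        by (simp add: abs_if field_simps split: if_splits)
    qed
    then show ?case
      using elim(1) graph[of n] assms(4)[of n] colored_graph.finite_colors[OF graph]
      by (subst prob_random_color_set) auto
  qed
  show ?thesis
    by (rule tendsto_sandwich[OF lower _ lim[simplified] tendsto_const]) simp
qed

end
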